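(* Let $X$ and $Y$ be Banach spaces. For any bounded linear operator $T:X\to Y$ the following properties are equivalent: (1) $T$ has martingale subtype, i.e. $\tau(T|\mathcal M_n)/\sqrt n\to0$; (2) $T$ has martingale subcotype, i.e. $\gamma(T|\mathcal M_n)/\sqrt n\to0$; (3) $T$ has Haar subtype, i.e. $\tau(T|\mathcal H(\mathbb D_0^n))/\sqrt n\to0$; (4) $T$ has Haar subcotype, i.e. $\gamma(T|\mathcal H(\mathbb D_0^n))/\sqrt n\to0$.
   Context: $[0,1)$ carries Lebesgue measure. $[L_2,X]$ is the Banach space of (Bochner) square integrable $X$-valued functions on $[0,1)$ with norm $\|f|L_2\|=\big(\int_0^1\|f(t)\|^2dt\big)^{1/2}$. For $T:X\to Y$, $[L_2,T]:[L_2,X]\to[L_2,Y]$ is $[L_2,T]f(t):=T(f(t))$. Martingale differences: an $X$-valued martingale difference sequence $d_1,\dots,d_n$ on $[0,1)$ is given by $d_1=f_1$, $d_k=f_k-f_{k-1}$ for $k>1$, where $(f_k)$ is an $X$-valued martingale adapted to some filtration $\mathcal F_1\subseteq\mathcal F_2\subseteq\cdots$ of finitely generated $\sigma$-algebras on $[0,1)$ ($d_1$ need not have mean zero). Martingale ideal norms: $\tau(T|\mathcal M_n)$ is the smallest $c\ge0$ such that $\big\|\sum_{k=1}^n[L_2,T]d_k\big|L_2\big\|\le c\big(\sum_{k=1}^n\|d_k|L_2\|^2\big)^{1/2}$ for all $X$-valued martingale difference sequences $d_1,\dots,d_n$ adapted to any filtration on $[0,1)$; $\gamma(T|\mathcal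 M_n)$ is the smallest $c\ge0$ such that $\big(\sum_{k=1}^n\|[L_2,T]d_k|L_2\|^2\big)^{1/2}\le c\big\|\sum_{k=1}^nd_k\big|L_2\big\|$ for all such sequences. Haar ideal norms: let $\Delta_k^{(j)}=[\frac{j-1}{2^k},\frac j{2^k})$. The Haar functions are $\chi_0^{(0)}\equiv1$ and, for $k\ge1$, $1\le j\le2^{k-1}$, $\chi_k^{(j)}=2^{(k-1)/2}$ on $\Delta_k^{(2j-1)}$, $-2^{(k-1)/2}$ on $\Delta_k^{(2j)}$, $0$ otherwise. Let $\mathbb D_0^n=\{(0,0)\}\cup\{(k,j):1\le k\le n,\ 1\le j\le2^{k-1}\}$. $\tau(T|\mathcal H(\mathbb D_0^n))$ is the smallest $c\ge0$ such that $\big\|\sum_{\mathbb D_0^n}Tx_k^{(j)}\chi_k^{(j)}\big|L_2\big\|\le c\big(\sum_{\mathbb D_0^n}\|x_k^{(j)}\|^2\big)^{1/2}$ for all $(x_k^{(j)})\subseteq X$; $\gamma(T|\mathcal H(\mathbb D_0^n))$ is the smallest $c\ge0$ such that $\big(\sum_{\mathbb D_0^n}\|Tx_k^{(j)}\|^2\big)^{1/2}\le c\big\|\sum_{\mathbb D_0^n}x_k^{(j)}\chi_k^{(j)}\big|L_2\big\|$ for all $(x_k^{(j)})\subseteq X$. *)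

theory Defs
  imports "HOL-Probability.Conditional_Expectation"
begin

text \<open>Banach spaces are taken over the reals. A complex Banach space is covered by restriction of
  scalars, which changes none of the quantities below.\<close>

abbreviation unit_leb :: "real measure" where
  "unit_leb \<equiv> lebesgue_on {0..<1}"

text \<open>All functions this is applied to are finitely valued and measurable on \<open>[0,1)\<close>, so the integral
  is never the default value of a non-integrable function.\<close>

definition L2norm :: "(real \<Rightarrow> 'a::real_normed_vector) \<Rightarrow> real" where
  "L2norm f = sqrt (LINT t|unit_leb. (norm (f t))\<^sup>2)"

text \<open>A \<open>\<sigma>\<close>-algebra on \<open>[0,1)\<close> is represented by a value of type \<^typ>\<open>real measure\<close>, of which only the
  space and the measurable sets matter.\<close>

definition finitely_generated_subalgebra :: "real measure \<Rightarrow> bool" where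
  "finitely_generated_subalgebra F \<longleftrightarrow>
     subalgebra unit_leb F \<and>
     (\<exists>G. finite G \<and> G \<subseteq> Pow (space F) \<and> sets F = sigma_sets (space F) G)"

text \<open>\<open>h = E(g | F)\<close> almost everywhere, for \<open>h\<close> and \<open>g\<close> measurable with respect to finitely generated
  \<open>\<sigma>\<close>-algebras. Such functions are simple, so their Bochner integral is the library's
  \<^const>\<open>Bochner_Integration.simple_bochner_integral\<close>; unlike
  \<^const>\<open>lebesgue_integral\<close> it does not require the range space to be separable.\<close>

definition is_cond_exp ::
    "real measure \<Rightarrow> (real \<Rightarrow> 'a::real_normed_vector) \<Rightarrow> (real \<Rightarrow> 'a) \<Rightarrow> bool" where
  "is_cond_exp F g h \<longleftrightarrow>
     h \<in> borel_measurable F \<and>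
     (\<forall>A\<in>sets F. Bochner_Integration.simple_bochner_integral unit_leb (\<lambda>t. indicator A t *\<^sub>R g t) =
                 Bochner_Integration.simple_bochner_integral unit_leb (\<lambda>t. indicator A t *\<^sub>R h t))"

definition is_martingale ::
    "nat \<Rightarrow> (nat \<Rightarrow> real measure) \<Rightarrow> (nat \<Rightarrow> real \<Rightarrow> 'a::real_normed_vector) \<Rightarrow> bool" where
  "is_martingale n F f \<longleftrightarrow>
     (\<forall>k\<in>{1..n}. finitely_generated_subalgebra (F k)) \<and>
     (\<forall>k\<in>{1..n}. \<forall>j\<in>{1..k}. sets (F j) \<subseteq> sets (F k)) \<and>
     (\<forall>k\<in>{1..n}. f k \<in> borel_measurable (F k)) \<and>
     (\<forall>k\<in>{1..n}. \<forall>j\<in>{1..k}. is_cond_exp (F j) (f k) (f j))"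

definition martingale_differences :: "nat \<Rightarrow> (nat \<Rightarrow> real \<Rightarrow> 'a::real_normed_vector) \<Rightarrow> bool" where
  "martingale_differences n d \<longleftrightarrow>
     (\<exists>F f. is_martingale n F f \<and>
       (\<forall>k\<in>{1..n}. \<forall>t\<in>{0..<1}. d k t = (if k = 1 then f 1 t else f k t - f (k - 1) t)))"

text \<open>In the four ideal norms below the set of admissible constants is closed and, for bounded linear
  \<open>T\<close>, nonempty, so that the infimum is the smallest admissible constant.\<close>

definition tau_mart ::
    "nat \<Rightarrow> ('a::real_normed_vector \<Rightarrow> 'b::real_normed_vector) \<Rightarrow> real" where
  "tau_mart n T = Inf {c. 0 \<le> c \<and> (\<forall>d. martingale_differences n d \<longrightarrow>
     L2norm (\<lambda>t. \<Sum>k=1..n. T (d k t)) \<le> c * sqrt (\<Sum>k=1..n. (L2norm (d k))\<^sup>2))}"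

definition gamma_mart ::
    "nat \<Rightarrow> ('a::real_normed_vector \<Rightarrow> 'b::real_normed_vector) \<Rightarrow> real" where
  "gamma_mart n T = Inf {c. 0 \<le> c \<and> (\<forall>d. martingale_differences n d \<longrightarrow>
     sqrt (\<Sum>k=1..n. (L2norm (\<lambda>t. T (d k t)))\<^sup>2) \<le> c * L2norm (\<lambda>t. \<Sum>k=1..n. d k t))}"

definition dyadic :: "nat \<Rightarrow> nat \<Rightarrow> real set" where
  "dyadic k j = {(real j - 1) / 2 ^ k ..< real j / 2 ^ k}"

fun haar :: "nat \<times> nat \<Rightarrow> real \<Rightarrow> real" where
  "haar (k, j) t =
     (if k = 0 then 1
      else if t \<in> dyadic k (2 * j - 1) then 2 powr ((real k - 1) / 2)
      else if t \<in> dyadic k (2 * j) then - (2 powr ((real k - 1) / 2))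
      else 0)"

definition haar_index :: "nat \<Rightarrow> (nat \<times> nat) set" where
  "haar_index n = {(0, 0)} \<union> {(k, j). 1 \<le> k \<and> k \<le> n \<and> 1 \<le> j \<and> j \<le> 2 ^ (k - 1)}"

definition tau_haar ::
    "nat \<Rightarrow> ('a::real_normed_vector \<Rightarrow> 'b::real_normed_vector) \<Rightarrow> real" where
  "tau_haar n T = Inf {c. 0 \<le> c \<and> (\<forall>x :: nat \<times> nat \<Rightarrow> 'a.
     L2norm (\<lambda>t. \<Sum>i\<in>haar_index n. haar i t *\<^sub>R T (x i))
       \<le> c * sqrt (\<Sum>i\<in>haar_index n. (norm (x i))\<^sup>2))}"

definition gamma_haar ::
    "nat \<Rightarrow> ('a::real_normed_vector \<Rightarrow> 'b::real_normed_vector) \<Rightarrow> real" where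
  "gamma_haar n T = Inf {c. 0 \<le> c \<and> (\<forall>x :: nat \<times> nat \<Rightarrow> 'a.
     sqrt (\<Sum>i\<in>haar_index n. (norm (T (x i)))\<^sup>2)
       \<le> c * L2norm (\<lambda>t. \<Sum>i\<in>haar_index n. haar i t *\<^sub>R x i))}"

definition martingale_subtype :: "('a::real_normed_vector \<Rightarrow> 'b::real_normed_vector) \<Rightarrow> bool" where
  "martingale_subtype T \<longleftrightarrow> (\<lambda>n. tau_mart n T / sqrt (real n)) \<longlonglongrightarrow> 0"

definition martingale_subcotype :: "('a::real_normed_vector \<Rightarrow> 'b::real_normed_vector) \<Rightarrow> bool" where
  "martingale_subcotype T \<longleftrightarrow> (\<lambda>n. gamma_mart n T / sqrt (real n)) \<longlonglongrightarrow> 0"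

definition haar_subtype :: "('a::real_normed_vector \<Rightarrow> 'b::real_normed_vector) \<Rightarrow> bool" where
  "haar_subtype T \<longleftrightarrow> (\<lambda>n. tau_haar n T / sqrt (real n)) \<longlonglongrightarrow> 0"

definition haar_subcotype :: "('a::real_normed_vector \<Rightarrow> 'b::real_normed_vector) \<Rightarrow> bool" where
  "haar_subcotype T \<longleftrightarrow> (\<lambda>n. gamma_haar n T / sqrt (real n)) \<longlonglongrightarrow> 0"

end

theory Submission
  imports Defs
begin

text \<open>
  The link between the four properties is a separation property in the style of James, for the operator
  \<open>[L\<^sub>2,T]\<close>: there are arbitrarily long sequences in the unit ball of \<open>[L\<^sub>2,X]\<close> such that the images of the
  convex hulls of any initial segment and of the complementary final segment keep a fixed distance.

  If \<open>\<gamma>(T|M\<^sub>n) > \<epsilon> \<surd>n\<close>, such a sequence consists of the values \<open>f\<^sub>k\<close> of an extremal martingale at those times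
  \<open>k\<close> where \<open>[L\<^sub>2,T]d\<^sub>k\<close> is large, since conditional expectations are contractions. If
  \<open>\<tau>(T|M\<^sub>n) > \<epsilon> \<surd>n\<close>, it consists of normalized differences \<open>d\<^sub>k\<close> all of whose convex combinations have large
  image; here truncation of a combination is a contraction.

  Conversely, a sequence of length \<open>2\<^sup>m\<close> in \<open>[L\<^sub>2,X]\<close> yields Haar polynomials with coefficients in \<open>[L\<^sub>2,X]\<close>:
  dyadic averages show \<open>\<gamma>(T|H) \<ge> c \<surd>m\<close>, and the elements at dyadic midpoints show \<open>\<tau>(T|H) \<ge> c \<surd>m\<close>. Since the Haar
  inequalities are quadratic on both sides, they pass from \<open>X\<close> to \<open>[L\<^sub>2,X]\<close> by integration, so no descent of the
  separated sequence from \<open>[L\<^sub>2,X]\<close> to \<open>X\<close> is needed.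
\<close>

subsection \<open>Martingale differences as finite sums\<close>

text \<open>The argument is qualitative. A ladder has length proportional to \<open>n\<close>, but a
  sequence of length \<open>2 ^ m\<close> yields only Haar polynomials with \<open>m\<close> levels,
  so a logarithm is lost. This is harmless for a statement about \<open>o(\<surd>n)\<close> as long
  as the separation constant does not depend on the length, which is why one \<open>\<theta>\<close>
  has to serve for ladders of every length. Either martingale failure produces the same kind of
  sequence, and this sequence breaks both Haar properties. So subtype and subcotype are linked
  without any duality argument. The opposite implications are soft: a Haar polynomial with
  \<open>m\<close> levels is a martingale with \<open>m + 1\<close> differences on the dyadic
  filtration, and the shift by one does not affect the limits. Measure theory is removed at the
  start. A finitely generated algebra has finitely many atoms, so all norms of a martingale are
  finite weighted sums; the same expression then serves as the norm of \<open>[L2,X]\<close> for the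
  elements of a ladder.\<close>

definition wnorm :: "('i \<Rightarrow> real) \<Rightarrow> 'i set \<Rightarrow> ('i \<Rightarrow> 'v::real_normed_vector) \<Rightarrow> real" where
  "wnorm w I u = sqrt (\<Sum>a\<in>I. w a * (norm (u a))\<^sup>2)"

lemma wnorm_eq_L2_set:
  assumes "\<And>a. a \<in> I \<Longrightarrow> 0 \<le> w a"
  shows "wnorm w I u = L2_set (\<lambda>a. sqrt (w a) * norm (u a)) I"
  unfolding wnorm_def L2_set_def using assms
  by (auto intro!: arg_cong[where f=sqrt] sum.cong simp: power_mult_distrib)

lemma wnorm_nonneg:
  assumes "\<And>a. a \<in> I \<Longrightarrow> 0 \<le> w a"
  shows "0 \<le> wnorm w I u"
  unfolding wnorm_def using assms by (auto intro!: sum_nonneg)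

lemma wnorm_square:
  assumes "\<And>a. a \<in> I \<Longrightarrow> 0 \<le> w a"
  shows "(wnorm w I u)\<^sup>2 = (\<Sum>a\<in>I. w a * (norm (u a))\<^sup>2)"
  unfolding wnorm_def using assms by (auto intro!: sum_nonneg)

lemma wnorm_cong:
  assumes "\<And>a. a \<in> I \<Longrightarrow> norm (u a) = norm (v a)"
  shows "wnorm w I u = wnorm w I v"
  unfolding wnorm_def using assms by (auto intro!: sum.cong)

lemma wnorm_triangle:
  fixes u v :: "'i \<Rightarrow> 'v::real_normed_vector"
  assumes "\<And>a. a \<in> I \<Longrightarrow> 0 \<le> w a"
  shows "wnorm w I (\<lambda>a. u a + v a) \<le> wnorm w I u + wnorm w I v"
proof -
  have eq: "wnorm w I z = L2_set (\<lambda>a. sqrt (w a) * norm (z a)) I" for z :: "'i \<Rightarrow> 'v"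
    by (rule wnorm_eq_L2_set) (rule assms)
  have "wnorm w I (\<lambda>a. u a + v a) \<le> L2_set (\<lambda>a. sqrt (w a) * norm (u a) + sqrt (w a) * norm (v a)) I"
    unfolding eq using assms
    by (intro L2_set_mono) (auto simp flip: distrib_left intro!: mult_left_mono norm_triangle_ineq)
  also have "\<dots> \<le> wnorm w I u + wnorm w I v"
    unfolding eq by (rule L2_set_triangle_ineq)
  finally show ?thesis .
qed

lemma wnorm_scaleR: "wnorm w I (\<lambda>a. c *\<^sub>R u a) = \<bar>c\<bar> * wnorm w I u"
proof -
  have "(\<Sum>a\<in>I. w a * (norm (c *\<^sub>R u a))\<^sup>2) = c\<^sup>2 * (\<Sum>a\<in>I. w a * (norm (u a))\<^sup>2)"
    by (simp add: sum_distrib_left power_mult_distrib mult_ac)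
  then show ?thesis unfolding wnorm_def by (simp add: real_sqrt_mult)
qed

lemma wnorm_mono:
  assumes "\<And>a. a \<in> I \<Longrightarrow> 0 \<le> w a" and "\<And>a. a \<in> I \<Longrightarrow> norm (u a) \<le> norm (v a)"
  shows "wnorm w I u \<le> wnorm w I v"
  unfolding wnorm_def using assms
  by (auto intro!: sum_mono mult_left_mono power_mono)

lemma wnorm_bounded_linear:
  assumes "\<And>a. a \<in> I \<Longrightarrow> 0 \<le> w a" and "0 \<le> K" and "\<And>x. norm (T x) \<le> K * norm x"
  shows "wnorm w I (\<lambda>a. T (u a)) \<le> K * wnorm w I u"
proof -
  have "wnorm w I (\<lambda>a. T (u a)) \<le> wnorm w I (\<lambda>a. K *\<^sub>R u a)"
    using assms by (intro wnorm_mono) auto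
  then show ?thesis using assms by (simp add: wnorm_scaleR)
qed

lemma wnorm_sum:
  assumes "\<And>a. a \<in> I \<Longrightarrow> 0 \<le> w a"
  shows "wnorm w I (\<lambda>a. \<Sum>j\<in>S. u j a) \<le> (\<Sum>j\<in>S. wnorm w I (u j))"
proof (cases "finite S")
  case True
  then show ?thesis
  proof induction
    case empty
    then show ?case by (simp add: wnorm_def)
  next
    case (insert j S)
    with wnorm_triangle[of I w "u j" "\<lambda>a. \<Sum>j\<in>S. u j a"] assms show ?case by force
  qed
qed (simp add: wnorm_def)

lemma wnorm_diff_ge:
  assumes "\<And>a. a \<in> I \<Longrightarrow> 0 \<le> w a"
  shows "wnorm w I u - wnorm w I v \<le> wnorm w I (\<lambda>a. u a - v a)"
  using wnorm_triangle[of I w "\<lambda>a. u a - v a" v] assms by simp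

lemma wnorm_diff_le:
  assumes "\<And>a. a \<in> I \<Longrightarrow> 0 \<le> w a"
  shows "wnorm w I (\<lambda>a. u a - v a) \<le> wnorm w I u + wnorm w I v"
  using wnorm_triangle[of I w u "\<lambda>a. - v a"] wnorm_scaleR[of w I "-1" v] assms by simp

text \<open>A conditional expectation contracts the \<open>L2\<close> norm: \<open>avg\<close> says
  that \<open>h\<close> is the weighted mean of \<open>g\<close> on the blocks of
  \<open>\<rho>\<close>. The estimate holds on each block, and \<open>sum.group\<close> reassembles
  the blocks.\<close>

lemma wnorm_block_average_le:
  fixes g h :: "'i \<Rightarrow> 'v::real_normed_vector"
  assumes fin: "finite I" and w: "\<And>a. a \<in> I \<Longrightarrow> 0 < w a"
    and h: "\<And>a b. a \<in> I \<Longrightarrow> b \<in> I \<Longrightarrow> \<rho> a = \<rho> b \<Longrightarrow> h a = h b"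
    and avg: "\<And>b. b \<in> I \<Longrightarrow> (\<Sum>a\<in>{a\<in>I. \<rho> a = \<rho> b}. w a *\<^sub>R (g a - h a)) = 0"
  shows "wnorm w I h \<le> wnorm w I g"
proof -
  have "(\<Sum>a\<in>{a\<in>I. \<rho> a = c}. w a * (norm (h a))\<^sup>2) \<le> (\<Sum>a\<in>{a\<in>I. \<rho> a = c}. w a * (norm (g a))\<^sup>2)"
    if "c \<in> \<rho> ` I" for c
  proof -
    from that obtain b where b: "b \<in> I" "c = \<rho> b" by auto
    define B where "B = {a\<in>I. \<rho> a = c}"
    define W where "W = sum w B"
    have hb: "h a = h b" if "a \<in> B" for a
      by (rule h) (use that b in \<open>auto simp: B_def\<close>)
    have wB: "0 \<le> w a" if "a \<in> B" for a using that w unfolding B_def by (auto intro: less_imp_le)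
    have W: "0 \<le> W" unfolding W_def using wB by (auto intro: sum_nonneg)
    have "(\<Sum>a\<in>B. w a *\<^sub>R g a) = (\<Sum>a\<in>B. w a *\<^sub>R h a)"
      using avg[OF b(1)] unfolding B_def b(2) by (simp add: scaleR_diff_right sum_subtractf)
    also have "\<dots> = W *\<^sub>R h b"
      unfolding W_def scaleR_sum_left using hb by (auto intro: sum.cong)
    finally have "norm (W *\<^sub>R h b) = norm (\<Sum>a\<in>B. w a *\<^sub>R g a)" by simp
    also have "\<dots> \<le> (\<Sum>a\<in>B. w a * norm (g a))"
      using wB by (intro sum_norm_le) auto
    finally have *: "W * norm (h b) \<le> (\<Sum>a\<in>B. w a * norm (g a))" using W by simp
    \<comment> \<open>Jensen's inequality for the square, obtained by expanding around
      \<open>norm (h b)\<close>; no division by the block mass occurs.\<close>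
    have "0 \<le> (\<Sum>a\<in>B. w a * (norm (g a) - norm (h b))\<^sup>2)" using wB by (auto intro: sum_nonneg)
    also have "\<dots> = (\<Sum>a\<in>B. w a * (norm (g a))\<^sup>2) - 2 * norm (h b) * (\<Sum>a\<in>B. w a * norm (g a))
        + W * (norm (h b))\<^sup>2"
      unfolding W_def sum_distrib_left sum_distrib_right sum_subtractf[symmetric] sum.distrib[symmetric]
      by (intro sum.cong) (auto simp: power2_eq_square algebra_simps)
    also have "\<dots> \<le> (\<Sum>a\<in>B. w a * (norm (g a))\<^sup>2) - 2 * norm (h b) * (W * norm (h b))
        + W * (norm (h b))\<^sup>2"
      using * by (auto intro!: mult_left_mono)
    finally have "W * (norm (h b))\<^sup>2 \<le> (\<Sum>a\<in>B. w a * (norm (g a))\<^sup>2)"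
      by (simp add: power2_eq_square)
    moreover have "(\<Sum>a\<in>B. w a * (norm (h a))\<^sup>2) = W * (norm (h b))\<^sup>2"
      unfolding W_def sum_distrib_right using hb by (auto intro: sum.cong)
    ultimately show ?thesis unfolding B_def by simp
  qed
  then have "(\<Sum>c\<in>\<rho> ` I. \<Sum>a\<in>{a\<in>I. \<rho> a = c}. w a * (norm (h a))\<^sup>2)
      \<le> (\<Sum>c\<in>\<rho> ` I. \<Sum>a\<in>{a\<in>I. \<rho> a = c}. w a * (norm (g a))\<^sup>2)"
    by (rule sum_mono)
  then show ?thesis
    unfolding wnorm_def using fin by (simp add: sum.group)
qed

text \<open>Points lying in the same members of a finite generator \<open>G k\<close> cannot be told
  apart by the \<open>k\<close>-th algebra. So \<open>\<rho> k\<close> labels its atoms,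
  \<open>\<pi>\<close> picks a representative in each atom of the last algebra, and \<open>I\<close>
  collects the representatives of atoms of positive measure. Adapted functions factor through
  \<open>\<pi>\<close>, which turns integrals into finite sums; the martingale property, tested on
  single atoms, becomes the vanishing of block sums.\<close>

lemma martingale_differences_atoms:
  fixes d :: "nat \<Rightarrow> real \<Rightarrow> 'a::real_normed_vector"
  assumes d: "martingale_differences n d" and n: "1 \<le> n"
  obtains I :: "real set" and w :: "real \<Rightarrow> real" and \<pi> :: "real \<Rightarrow> real" and \<rho> :: "nat \<Rightarrow> real \<Rightarrow> real set set"
  where "finite I" "\<And>a. a \<in> I \<Longrightarrow> 0 < w a"
    and "\<And>k t. k \<in> {1..n} \<Longrightarrow> t \<in> {0..<1} \<Longrightarrow> d k (\<pi> t) = d k t"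
    and "\<And>u :: real \<Rightarrow> real. (\<And>t. t \<in> {0..<1} \<Longrightarrow> u (\<pi> t) = u t) \<Longrightarrow>
           (LINT t|unit_leb. u t) = (\<Sum>a\<in>I. w a * u a)"
    and "\<And>j k a b. j \<in> {1..k} \<Longrightarrow> k \<in> {1..n} \<Longrightarrow> a \<in> I \<Longrightarrow> b \<in> I \<Longrightarrow> \<rho> k a = \<rho> k b \<Longrightarrow> d j a = d j b"
    and "\<And>j k b. k \<in> {1..n} \<Longrightarrow> j \<in> {k<..n} \<Longrightarrow> b \<in> I \<Longrightarrow>
           (\<Sum>a\<in>{a\<in>I. \<rho> k a = \<rho> k b}. w a *\<^sub>R d j a) = 0"
proof -
  let ?U = "{0..<1::real}"
  obtain F f where mart: "is_martingale n F f"
    and df: "\<And>k t. k\<in>{1..n} \<Longrightarrow> t\<in>?U \<Longrightarrow> d k t = (if k = 1 then f 1 t else f k t - f (k - 1) t)"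
    using d unfolding martingale_differences_def by blast
  have fg: "finitely_generated_subalgebra (F k)" if "k \<in> {1..n}" for k
    using mart that unfolding is_martingale_def by blast
  have sub: "sets (F j) \<subseteq> sets (F k)" if "j \<in> {1..k}" "k \<in> {1..n}" for j k
    using mart that unfolding is_martingale_def by blast
  have ce: "is_cond_exp (F j) (f k) (f j)" if "j \<in> {1..k}" "k \<in> {1..n}" for j k
    using mart that unfolding is_martingale_def by blast
  have fm: "f k \<in> borel_measurable (F k)" if "k \<in> {1..n}" for k
    using mart that unfolding is_martingale_def by blast
  have [simp]: "space unit_leb = ?U" by (simp add: space_restrict_space)
  have sp: "space (F k) = ?U" if "k \<in> {1..n}" for k
    using fg[OF that] unfolding finitely_generated_subalgebra_def subalgebra_def by simp
  have "\<forall>k\<in>{1..n}. \<exists>G. finite G \<and> G \<subseteq> Pow ?U \<and> sets (F k) = sigma_sets ?U G"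
    using fg sp unfolding finitely_generated_subalgebra_def by metis
  then obtain G where G: "\<And>k. k\<in>{1..n} \<Longrightarrow> finite (G k) \<and> G k \<subseteq> Pow ?U \<and> sets (F k) = sigma_sets ?U (G k)"
    by metis
  define \<rho> where "\<rho> k t = {A\<in>G k. t \<in> A}" for k and t :: real
  \<comment> \<open>Generators do not split a class of \<open>\<rho> k\<close>, and this is
    inherited by every set they generate.\<close>
  have S1: "s \<in> A \<longleftrightarrow> t \<in> A" if k: "k \<in> {1..n}" and A: "A \<in> sets (F k)" and st: "s \<in> ?U" "t \<in> ?U" "\<rho> k s = \<rho> k t" for k A s t
  proof -
    have "A \<in> sigma_sets ?U (G k)" using A G[OF k] by simp
    then show ?thesis
    proof induction
      case (Basic a)
      then show ?case using st(3) unfolding \<rho>_def by blast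
    qed (use st in auto)
  qed
  \<comment> \<open>Conversely a class belongs to the algebra, as a finite intersection of
    generators and complements; so the classes are exactly the atoms.\<close>
  have S2: "{s\<in>?U. \<rho> k s = \<rho> k t} \<in> sets (F k)" if k: "k \<in> {1..n}" for k t
  proof -
    have "{s\<in>space (F k). \<forall>A\<in>G k. s \<in> A \<longleftrightarrow> t \<in> A} \<in> sets (F k)"
    proof (rule sets.sets_Collect_finite_All)
      fix A assume A: "A \<in> G k"
      then have As: "A \<in> sets (F k)" using G[OF k] by auto
      have "{s \<in> space (F k). (s \<in> A) = (t \<in> A)} = (if t \<in> A then A else space (F k) - A)"
        using sets.sets_into_space[OF As] by auto
      then show "{s \<in> space (F k). (s \<in> A) = (t \<in> A)} \<in> sets (F k)" using As by simp
    qed (use G[OF k] in \<open>auto\<close>)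
    moreover have "{s\<in>space (F k). \<forall>A\<in>G k. s \<in> A \<longleftrightarrow> t \<in> A} = {s\<in>?U. \<rho> k s = \<rho> k t}"
      using sp[OF k] unfolding \<rho>_def by auto
    ultimately show ?thesis by simp
  qed
  \<comment> \<open>Level sets of \<open>f j\<close> are measurable because singletons are Borel,
    and by \<open>S1\<close> they cannot split a class.\<close>
  have S3: "f j s = f j t" if jk: "j \<in> {1..k}" "k \<in> {1..n}" and st: "s \<in> ?U" "t \<in> ?U" "\<rho> k s = \<rho> k t" for j k s t
  proof -
    have j: "j \<in> {1..n}" using jk by auto
    have "f j -` {f j t} \<inter> space (F j) \<in> sets (F j)"
      using fm[OF j] by (rule measurable_sets) simp
    then have "f j -` {f j t} \<inter> ?U \<in> sets (F k)" using sub[OF jk] sp[OF j] by auto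
    from S1[OF jk(2) this st] st show ?thesis by auto
  qed
  have nn: "n \<in> {1..n}" using n by simp
  \<comment> \<open>The choice depends on \<open>t\<close> only through \<open>\<rho> n t\<close>,
    so a whole atom shares one representative; this is \<open>pi_eq\<close>.\<close>
  define \<pi> where "\<pi> t = (SOME s. s \<in> ?U \<and> \<rho> n s = \<rho> n t)" for t
  have pi: "\<pi> t \<in> ?U \<and> \<rho> n (\<pi> t) = \<rho> n t" if "t \<in> ?U" for t
    unfolding \<pi>_def by (rule someI[of _ t]) (use that in auto)
  have pi_eq: "\<pi> s = \<pi> t" if "\<rho> n s = \<rho> n t" for s t unfolding \<pi>_def that ..
  have pipi: "\<pi> (\<pi> t) = \<pi> t" if "t \<in> ?U" for t using pi[OF that] pi_eq by blast
  \<comment> \<open>The atoms of the last algebra refine the earlier ones, since an atom of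
    \<open>F k\<close> is itself a set of \<open>F n\<close>.\<close>
  have rho_k: "\<rho> k s = \<rho> k t" if "k \<in> {1..n}" "s \<in> ?U" "t \<in> ?U" "\<rho> n s = \<rho> n t" for k s t
    using S1[OF nn _ that(2-4), of "{r\<in>?U. \<rho> k r = \<rho> k t}"] S2[OF that(1), of t] sub[of k n] that by auto
  have fpi: "f k (\<pi> t) = f k t" if "k \<in> {1..n}" "t \<in> ?U" for k t
    by (rule S3[of k n]) (use pi[OF that(2)] that in auto)
  have Fle: "sets (F n) \<subseteq> sets unit_leb"
    using fg[OF nn] unfolding finitely_generated_subalgebra_def subalgebra_def by simp
  define I0 where "I0 = \<pi> ` ?U"
  have fin0: "finite I0"
  proof -
    have "finite (\<rho> n ` ?U)"
      by (rule finite_subset[of _ "Pow (G n)"]) (use G[OF nn] in \<open>auto simp: \<rho>_def\<close>)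
    moreover have "I0 \<subseteq> (\<lambda>r. SOME s. s \<in> ?U \<and> \<rho> n s = r) ` (\<rho> n ` ?U)"
      unfolding I0_def \<pi>_def by auto
    ultimately show ?thesis by (meson finite_imageI finite_subset)
  qed
  define w where "w a = measure unit_leb {x\<in>?U. \<pi> x = a}" for a
  have cell: "{x\<in>?U. \<pi> x = a} = {s\<in>?U. \<rho> n s = \<rho> n a}" if "a \<in> I0" for a
  proof -
    obtain t where t: "t \<in> ?U" "a = \<pi> t" using \<open>a \<in> I0\<close> unfolding I0_def by auto
    have "\<pi> x = a \<longleftrightarrow> \<rho> n x = \<rho> n a" if "x \<in> ?U" for x
    proof
      assume "\<pi> x = a"
      then show "\<rho> n x = \<rho> n a" using pi[OF that] by simp
    next
      assume "\<rho> n x = \<rho> n a"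
      then have "\<pi> x = \<pi> a" by (rule pi_eq)
      then show "\<pi> x = a" using pipi[OF t(1)] t(2) by simp
    qed
    then show ?thesis by auto
  qed
  have sf: "simple_function unit_leb \<pi>"
    unfolding simple_function_def
  proof safe
    show "finite (\<pi> ` space unit_leb)" using fin0 unfolding I0_def by simp
    fix x assume x: "x \<in> space unit_leb"
    have "\<pi> -` {\<pi> x} \<inter> space unit_leb = {y\<in>?U. \<pi> y = \<pi> x}" by auto
    also have "\<dots> \<in> sets unit_leb"
      using cell[of "\<pi> x"] x S2[OF nn] Fle unfolding I0_def by auto
    finally show "\<pi> -` {\<pi> x} \<inter> space unit_leb \<in> sets unit_leb" .
  qed
  have finU: "emeasure unit_leb A \<noteq> \<infinity>" for A
  proof -
    have "emeasure unit_leb A \<le> emeasure unit_leb (space unit_leb)" by (rule emeasure_space)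
    also have "\<dots> = ennreal 1"
      by (simp add: emeasure_restrict_space)
    finally show ?thesis by (auto simp: top_unique)
  qed
  \<comment> \<open>Null atoms are discarded: with strictly positive weights, a function of norm
    zero vanishes at every point of \<open>I\<close>.\<close>
  define I where "I = {a\<in>I0. 0 < w a}"
  have sbi: "Bochner_Integration.simple_bochner_integrable unit_leb g" if g: "\<And>t. t \<in> ?U \<Longrightarrow> g (\<pi> t) = g t" for g :: "real \<Rightarrow> 'c::real_normed_vector"
  proof (rule simple_bochner_integrable.intros)
    have "simple_function unit_leb (g \<circ> \<pi>)" using sf by (rule simple_function_compose)
    then show "simple_function unit_leb g"
      by (rule simple_function_cong[THEN iffD1, rotated]) (use g in auto)
  qed (rule finU)
  have int: "Bochner_Integration.simple_bochner_integral unit_leb g = (\<Sum>a\<in>I. w a *\<^sub>R g a)"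
    if g: "\<And>t. t \<in> ?U \<Longrightarrow> g (\<pi> t) = g t" for g :: "real \<Rightarrow> 'c::real_normed_vector"
  proof -
    have "Bochner_Integration.simple_bochner_integral unit_leb g = (\<Sum>y\<in>\<pi> ` space unit_leb. measure unit_leb {x\<in>space unit_leb. \<pi> x = y} *\<^sub>R g y)"
    proof (rule simple_bochner_integral_partition[OF _ sf])
      show "Bochner_Integration.simple_bochner_integrable unit_leb g" by (rule sbi) (rule g)
      show "g x = g y" if "x \<in> space unit_leb" "y \<in> space unit_leb" "\<pi> x = \<pi> y" for x y
        using g[of x] g[of y] that by simp
    qed (use g in auto)
    also have "\<dots> = (\<Sum>y\<in>I0. w y *\<^sub>R g y)" unfolding w_def I0_def by simp
    also have "\<dots> = (\<Sum>a\<in>I. w a *\<^sub>R g a)"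
      by (rule sum.mono_neutral_right) (use fin0 in \<open>auto simp: I_def w_def zero_less_measure_iff\<close>)
    finally show ?thesis .
  qed
  have IU: "a \<in> ?U" if "a \<in> I" for a using that pi unfolding I_def I0_def by auto
  show thesis
  proof (rule that)
    show "finite I" unfolding I_def using fin0 by simp
    show "0 < w a" if "a \<in> I" for a using that unfolding I_def by simp
    show "d k (\<pi> t) = d k t" if "k \<in> {1..n}" "t \<in> {0..<1}" for k t
    proof -
      have "k = 1 \<or> k - 1 \<in> {1..n}" using that by auto
      then show ?thesis
        using df[OF that(1), of "\<pi> t"] df[OF that] fpi[OF that] fpi[of 1 t] fpi[of "k-1" t] pi[OF that(2)] n that(2) by auto
    qed
    show "(LINT t|unit_leb. u t) = (\<Sum>a\<in>I. w a * u a)"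
      if u: "\<And>t. t \<in> {0..<1} \<Longrightarrow> u (\<pi> t) = u t" for u :: "real \<Rightarrow> real"
    proof -
      have "has_bochner_integral unit_leb u (Bochner_Integration.simple_bochner_integral unit_leb u)"
        by (rule has_bochner_integral_simple_bochner_integrable) (rule sbi, rule u)
      moreover have "Bochner_Integration.simple_bochner_integral unit_leb u = (\<Sum>a\<in>I. w a *\<^sub>R u a)"
        by (rule int) (rule u)
      ultimately show ?thesis by (simp add: has_bochner_integral_integral_eq)
    qed
    show "d j a = d j b" if "j \<in> {1..k}" "k \<in> {1..n}" "a \<in> I" "b \<in> I" "\<rho> k a = \<rho> k b" for j k a b
    proof -
      have ab: "a \<in> ?U" "b \<in> ?U" using that IU by auto
      have "j \<in> {1..n}" "j = 1 \<or> j - 1 \<in> {1..k}" using that by auto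
      then show ?thesis using S3[OF that(1,2) ab that(5)] S3[OF _ that(2) ab that(5), of 1] S3[OF _ that(2) ab that(5), of "j - 1"] 
          df[of j a] df[of j b] ab that by auto
    qed
    show "(\<Sum>a\<in>{a\<in>I. \<rho> k a = \<rho> k b}. w a *\<^sub>R d j a) = 0" if kj: "k \<in> {1..n}" "j \<in> {k<..n}" and b: "b \<in> I" for j k b
    proof -
      let ?A = "{s\<in>?U. \<rho> k s = \<rho> k b}"
      \<comment> \<open>An atom of \<open>F k\<close> is a union of atoms of \<open>F n\<close>, so
        the integral over it is the sum over the representatives it contains.\<close>
      have sm: "Bochner_Integration.simple_bochner_integral unit_leb (\<lambda>t. indicator ?A t *\<^sub>R f i t) = (\<Sum>a\<in>{a\<in>I. \<rho> k a = \<rho> k b}. w a *\<^sub>R f i a)"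
        if i: "i \<in> {1..n}" for i
      proof -
        have "(\<pi> t \<in> ?A) = (t \<in> ?A)" if "t \<in> ?U" for t
          using rho_k[OF kj(1), of "\<pi> t" t] pi[OF that] that by auto
        then have "Bochner_Integration.simple_bochner_integral unit_leb (\<lambda>t. indicator ?A t *\<^sub>R f i t) = (\<Sum>a\<in>I. w a *\<^sub>R (indicator ?A a *\<^sub>R f i a))"
          by (intro int) (simp add: fpi[OF i] indicator_def)
        also have "\<dots> = (\<Sum>a\<in>I. if \<rho> k a = \<rho> k b then w a *\<^sub>R f i a else 0)"
          using IU by (intro sum.cong) (auto simp: indicator_def)
        also have "\<dots> = (\<Sum>a\<in>{a\<in>I. \<rho> k a = \<rho> k b}. w a *\<^sub>R f i a)"
          using \<open>finite I\<close> by (simp add: sum.inter_filter)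
        finally show ?thesis .
      qed
      have eq: "Bochner_Integration.simple_bochner_integral unit_leb (\<lambda>t. indicator ?A t *\<^sub>R f i t) = Bochner_Integration.simple_bochner_integral unit_leb (\<lambda>t. indicator ?A t *\<^sub>R f k t)"
        if "i \<in> {k..n}" for i
        using ce[of k i] S2[OF kj(1), of b] that kj unfolding is_cond_exp_def by auto
      \<comment> \<open>From \<open>k < j\<close> also \<open>j - 1\<close> is at least
        \<open>k\<close>, so both martingale values have the same integral over the atom as
        \<open>f k\<close>.\<close>
      have "(\<Sum>a\<in>{a\<in>I. \<rho> k a = \<rho> k b}. w a *\<^sub>R f j a) = (\<Sum>a\<in>{a\<in>I. \<rho> k a = \<rho> k b}. w a *\<^sub>R f (j-1) a)"
      proof -
        have "j \<in> {1..n}" "j - 1 \<in> {1..n}" "j \<in> {k..n}" "j - 1 \<in> {k..n}" using kj by auto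
        then show ?thesis using sm[of j] sm[of "j - 1"] eq[of j] eq[of "j - 1"] by argo
      qed
      moreover have "d j a = f j a - f (j-1) a" if "a \<in> I" for a
        using df[of j a] kj IU[OF that] by auto
      ultimately show ?thesis
        by (simp add: scaleR_diff_right sum_subtractf)
    qed
  qed
qed

text \<open>The sum up to \<open>k\<close> is the block average of the full sum: its terms are
  constant on the blocks of \<open>\<rho>\<close>, and the later terms have block mean zero. Scalars
  and \<open>T\<close> commute with averaging, so arbitrary coefficients are allowed.\<close>

lemma wnorm_truncation_le:
  fixes T :: "'a::real_normed_vector \<Rightarrow> 'b::real_normed_vector" and k n :: nat
  assumes T: "bounded_linear T"
    and fin: "finite I" and w: "\<And>a. a \<in> I \<Longrightarrow> 0 < w a" and k: "k \<le> n"
    and const: "\<And>j a b. j \<in> {1..k} \<Longrightarrow> a \<in> I \<Longrightarrow> b \<in> I \<Longrightarrow> \<rho> a = \<rho> b \<Longrightarrow> d j a = d j b"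
    and avg: "\<And>j b. j \<in> {k<..n} \<Longrightarrow> b \<in> I \<Longrightarrow> (\<Sum>a\<in>{a\<in>I. \<rho> a = \<rho> b}. w a *\<^sub>R d j a) = 0"
  shows "wnorm w I (\<lambda>a. \<Sum>j=1..k. c j *\<^sub>R T (d j a)) \<le> wnorm w I (\<lambda>a. \<Sum>j=1..n. c j *\<^sub>R T (d j a))"
proof (rule wnorm_block_average_le[where \<rho>=\<rho>, OF fin w])
  interpret T: bounded_linear T by fact
  show "(\<Sum>j=1..k. c j *\<^sub>R T (d j a)) = (\<Sum>j=1..k. c j *\<^sub>R T (d j b))"
    if "a \<in> I" "b \<in> I" "\<rho> a = \<rho> b" for a b
    using const[OF _ that] by (auto intro!: sum.cong)
  fix b assume b: "b \<in> I"
  let ?B = "{a\<in>I. \<rho> a = \<rho> b}"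
  have split: "{1..n} = {1..k} \<union> {k<..n}" using k by auto
  have "(\<Sum>j=1..n. c j *\<^sub>R T (d j a)) - (\<Sum>j=1..k. c j *\<^sub>R T (d j a)) = (\<Sum>j\<in>{k<..n}. c j *\<^sub>R T (d j a))" for a
    unfolding split by (subst sum.union_disjoint) auto
  then have "(\<Sum>a\<in>?B. w a *\<^sub>R ((\<Sum>j=1..n. c j *\<^sub>R T (d j a)) - (\<Sum>j=1..k. c j *\<^sub>R T (d j a))))
      = (\<Sum>a\<in>?B. \<Sum>j\<in>{k<..n}. c j *\<^sub>R T (w a *\<^sub>R d j a))"
    by (simp add: scaleR_sum_right T.scaleR mult.commute)
  also have "\<dots> = (\<Sum>j\<in>{k<..n}. c j *\<^sub>R T (\<Sum>a\<in>?B. w a *\<^sub>R d j a))"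
    by (subst sum.swap) (simp add: scaleR_sum_right T.sum)
  also have "\<dots> = 0" using avg[OF _ b] by (intro sum.neutral) (auto simp: T.zero)
  finally show "(\<Sum>a\<in>?B. w a *\<^sub>R ((\<Sum>j=1..n. c j *\<^sub>R T (d j a)) - (\<Sum>j=1..k. c j *\<^sub>R T (d j a)))) = 0" .
qed

text \<open>The interface to the rest: of the filtration only the contractivity of truncation
  survives, once in \<open>X\<close> and once after \<open>T\<close>. The coefficients
  \<open>c\<close> stay arbitrary because they will later encode differences of convex
  combinations.\<close>

lemma martingale_differences_wnorm:
  fixes T :: "'a::real_normed_vector \<Rightarrow> 'b::real_normed_vector"
  assumes T: "bounded_linear T" and d: "martingale_differences n d"
  obtains I :: "real set" and w :: "real \<Rightarrow> real"
  where "finite I" "\<And>a. a \<in> I \<Longrightarrow> 0 < w a"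
    and "\<And>k. k \<in> {1..n} \<Longrightarrow> L2norm (d k) = wnorm w I (d k)"
    and "\<And>k. k \<in> {1..n} \<Longrightarrow> L2norm (\<lambda>t. T (d k t)) = wnorm w I (\<lambda>a. T (d k a))"
    and "L2norm (\<lambda>t. \<Sum>k=1..n. d k t) = wnorm w I (\<lambda>a. \<Sum>k=1..n. d k a)"
    and "L2norm (\<lambda>t. \<Sum>k=1..n. T (d k t)) = wnorm w I (\<lambda>a. \<Sum>k=1..n. T (d k a))"
    and "\<And>k c. k \<le> n \<Longrightarrow>
      wnorm w I (\<lambda>a. \<Sum>j=1..k. c j *\<^sub>R d j a) \<le> wnorm w I (\<lambda>a. \<Sum>j=1..n. c j *\<^sub>R d j a)"
    and "\<And>k c. k \<le> n \<Longrightarrow>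
      wnorm w I (\<lambda>a. \<Sum>j=1..k. c j *\<^sub>R T (d j a)) \<le> wnorm w I (\<lambda>a. \<Sum>j=1..n. c j *\<^sub>R T (d j a))"
proof (cases "n = 0")
  case True
  show thesis by (rule that[of "{}" "\<lambda>_. 1"]) (simp_all add: True L2norm_def wnorm_def)
next
  case False
  then have n: "1 \<le> n" by simp
  show thesis
  proof (rule martingale_differences_atoms[OF d n])
    fix I :: "real set" and w \<pi> and \<rho> :: "nat \<Rightarrow> real \<Rightarrow> real set set"
    assume fin: "finite I" and w: "\<And>a. a \<in> I \<Longrightarrow> 0 < w a"
      and pi: "\<And>k t. k \<in> {1..n} \<Longrightarrow> t \<in> {0..<1} \<Longrightarrow> d k (\<pi> t) = d k t"
      and int: "\<And>u :: real \<Rightarrow> real. (\<And>t. t \<in> {0..<1} \<Longrightarrow> u (\<pi> t) = u t) \<Longrightarrow>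
             (LINT t|unit_leb. u t) = (\<Sum>a\<in>I. w a * u a)"
      and const: "\<And>j k a b. j \<in> {1..k} \<Longrightarrow> k \<in> {1..n} \<Longrightarrow> a \<in> I \<Longrightarrow> b \<in> I \<Longrightarrow> \<rho> k a = \<rho> k b \<Longrightarrow> d j a = d j b"
      and avg: "\<And>j k b. k \<in> {1..n} \<Longrightarrow> j \<in> {k<..n} \<Longrightarrow> b \<in> I \<Longrightarrow>
             (\<Sum>a\<in>{a\<in>I. \<rho> k a = \<rho> k b}. w a *\<^sub>R d j a) = 0"
    have w0: "\<And>a. a \<in> I \<Longrightarrow> 0 \<le> w a" using w by (auto intro: less_imp_le)
    have L2: "L2norm u = wnorm w I u" if "\<And>t. t \<in> {0..<1} \<Longrightarrow> u (\<pi> t) = u t" for u :: "real \<Rightarrow> 'c::real_normed_vector"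
      unfolding L2norm_def wnorm_def using int[of "\<lambda>t. (norm (u t))\<^sup>2"] that by simp
    have trunc: "wnorm w I (\<lambda>a. \<Sum>j=1..k. c j *\<^sub>R S (d j a)) \<le> wnorm w I (\<lambda>a. \<Sum>j=1..n. c j *\<^sub>R S (d j a))"
      if k: "k \<le> n" and S: "bounded_linear S" for k c and S :: "'a \<Rightarrow> 'c::real_normed_vector"
    \<comment> \<open>The filtration starts at index 1, so truncation at 0 has no algebra to average
      over; there the left side is an empty sum.\<close>
    proof (cases "k = 0")
      case True
      then show ?thesis using wnorm_nonneg[of I w "\<lambda>a. \<Sum>j=1..n. c j *\<^sub>R S (d j a)", OF w0] by (simp add: wnorm_def)
    next
      case False
      show ?thesis
        by (rule wnorm_truncation_le[where \<rho>="\<rho> k", OF S fin w k const avg]) (use False k in auto)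
    qed
    show thesis
    proof (rule that[OF fin w])
      show "L2norm (d k) = wnorm w I (d k)" if "k \<in> {1..n}" for k
        by (rule L2) (rule pi[OF that])
      show "L2norm (\<lambda>t. T (d k t)) = wnorm w I (\<lambda>a. T (d k a))" if "k \<in> {1..n}" for k
        by (rule L2) (simp add: pi[OF that])
      show "L2norm (\<lambda>t. \<Sum>k=1..n. d k t) = wnorm w I (\<lambda>a. \<Sum>k=1..n. d k a)"
        by (rule L2) (use pi in \<open>auto intro!: sum.cong\<close>)
      show "L2norm (\<lambda>t. \<Sum>k=1..n. T (d k t)) = wnorm w I (\<lambda>a. \<Sum>k=1..n. T (d k a))"
        by (rule L2) (use pi in \<open>auto intro!: sum.cong\<close>)
    qed (use trunc[OF _ bounded_linear_ident] trunc[OF _ T] in auto)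
  qed
qed

subsection \<open>Separated sequences\<close>

text \<open>One weight \<open>\<alpha>\<close> encodes a pair of convex combinations, since the two
  segments use disjoint indices. The cuts \<open>k = 0\<close> and \<open>k = n\<close> impose
  nothing, as an empty sum is never 1. Points of the index set are reals, like the representatives
  of atoms, which avoids quantifying over a type.\<close>

definition ladder :: "('a::real_normed_vector \<Rightarrow> 'b::real_normed_vector) \<Rightarrow> real \<Rightarrow> nat \<Rightarrow> bool" where
  "ladder T \<theta> n \<longleftrightarrow> (\<exists>(I :: real set) w x. finite I \<and> (\<forall>a\<in>I. 0 \<le> w a) \<and> (\<forall>j<n. wnorm w I (x j) \<le> 1) \<and>
     (\<forall>k\<le>n. \<forall>\<alpha>. (\<forall>j<n. 0 \<le> \<alpha> j) \<longrightarrow> sum \<alpha> {..<k} = 1 \<longrightarrow> sum \<alpha> {k..<n} = 1 \<longrightarrow>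
        \<theta> \<le> wnorm w I (\<lambda>a. T ((\<Sum>j<k. \<alpha> j *\<^sub>R x j a) - (\<Sum>j=k..<n. \<alpha> j *\<^sub>R x j a)))))"

lemma bounded_linear_combination_swap:
  assumes "bounded_linear T"
  shows "T (\<Sum>j\<in>J. \<alpha> j *\<^sub>R (\<Sum>l\<in>L. e j l *\<^sub>R d l a)) = (\<Sum>l\<in>L. (\<Sum>j\<in>J. \<alpha> j * e j l) *\<^sub>R T (d l a))"
proof -
  interpret T: bounded_linear T by fact
  have "T (\<Sum>j\<in>J. \<alpha> j *\<^sub>R (\<Sum>l\<in>L. e j l *\<^sub>R d l a)) = (\<Sum>j\<in>J. \<Sum>l\<in>L. (\<alpha> j * e j l) *\<^sub>R T (d l a))"
    by (simp add: T.sum T.scaleR scaleR_sum_right)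
  also have "\<dots> = (\<Sum>l\<in>L. \<Sum>j\<in>J. (\<alpha> j * e j l) *\<^sub>R T (d l a))" by (rule sum.swap)
  finally show ?thesis by (simp add: scaleR_sum_left)
qed

text \<open>An increment is the difference of two truncations, each bounded by the full sum; hence
  the factor 2.\<close>

lemma martingale_wnorm_increment_le:
  fixes T :: "'a::real_normed_vector \<Rightarrow> 'b::real_normed_vector" and I :: "'i set" and k n :: nat
  assumes w: "\<And>a. a \<in> I \<Longrightarrow> 0 \<le> w a" and k: "k \<in> {1..n}"
    and trunc: "\<And>k c. k \<le> n \<Longrightarrow>
      wnorm w I (\<lambda>a. \<Sum>j=1..k. c j *\<^sub>R T (d j a)) \<le> wnorm w I (\<lambda>a. \<Sum>j=1..n. c j *\<^sub>R T (d j a))"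
  shows "\<bar>c k\<bar> * wnorm w I (\<lambda>a. T (d k a)) \<le> 2 * wnorm w I (\<lambda>a. \<Sum>j=1..n. c j *\<^sub>R T (d j a))"
proof -
  let ?s = "\<lambda>k a. \<Sum>j=1..k. c j *\<^sub>R T (d j a)"
  have "?s k a = ?s (k - 1) a + c k *\<^sub>R T (d k a)" for a
    using k by (cases k) auto
  then have "\<bar>c k\<bar> * wnorm w I (\<lambda>a. T (d k a)) = wnorm w I (\<lambda>a. ?s k a - ?s (k - 1) a)"
    by (simp add: wnorm_scaleR)
  also have "\<dots> \<le> wnorm w I (?s k) + wnorm w I (?s (k - 1))" by (rule wnorm_diff_le) (rule w)
  also have "\<dots> \<le> wnorm w I (?s n) + wnorm w I (?s n)"
    using k by (intro add_mono trunc) auto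
  finally show ?thesis by simp
qed

lemma bdd_below_admissible: "bdd_below {c::real. 0 \<le> c \<and> P c}"
  by (rule bdd_belowI[of _ 0]) auto

text \<open>Each \<open>D k\<close> is at most \<open>2 * K * N\<close>, and the indices with
  \<open>D k\<close> below \<open>\<epsilon> / 2 * N\<close> account for at most a quarter of
  \<open>\<epsilon>\<^sup>2 * n * N\<^sup>2\<close>. The other three quarters need more than
  \<open>3 * \<epsilon>\<^sup>2 * n / (16 * K\<^sup>2)\<close> indices, whence the hypothesis on
  \<open>M\<close>. The increment bound halves the threshold \<open>\<epsilon> / 2\<close> to
  \<open>\<epsilon> / 4\<close>.\<close>

lemma ladder_of_gamma_mart:
  fixes T :: "'a::real_normed_vector \<Rightarrow> 'b::real_normed_vector"
  assumes T: "bounded_linear T" and K: "0 < K" "\<And>x. norm (T x) \<le> K * norm x"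
    and e: "0 < \<epsilon>" "\<epsilon> * sqrt n < gamma_mart n T"
    and M: "16 * K\<^sup>2 * real M \<le> 3 * \<epsilon>\<^sup>2 * real n"
  shows "ladder T (\<epsilon> / 4) M"
proof -
  interpret T: bounded_linear T by fact
  have "\<not> (\<forall>d. martingale_differences n d \<longrightarrow>
     sqrt (\<Sum>k=1..n. (L2norm (\<lambda>t. T (d k t)))\<^sup>2) \<le> (\<epsilon> * sqrt n) * L2norm (\<lambda>t. \<Sum>k=1..n. d k t))"
  proof
    assume "\<forall>d. martingale_differences n d \<longrightarrow>
     sqrt (\<Sum>k=1..n. (L2norm (\<lambda>t. T (d k t)))\<^sup>2) \<le> (\<epsilon> * sqrt n) * L2norm (\<lambda>t. \<Sum>k=1..n. d k t)"
    then have "gamma_mart n T \<le> \<epsilon> * sqrt n"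
      unfolding gamma_mart_def using e(1) by (intro cInf_lower bdd_below_admissible) auto
    then show False using e by simp
  qed
  then obtain d where d: "martingale_differences n d"
    and large: "\<epsilon> * sqrt n * L2norm (\<lambda>t. \<Sum>k=1..n. d k t) < sqrt (\<Sum>k=1..n. (L2norm (\<lambda>t. T (d k t)))\<^sup>2)"
    by (auto simp: not_le)
  show ?thesis
  proof (rule martingale_differences_wnorm[OF T d])
    fix I :: "real set" and w assume fin: "finite I" and w: "\<And>a. a \<in> I \<Longrightarrow> 0 < w a"
      and L2: "\<And>k. k \<in> {1..n} \<Longrightarrow> L2norm (d k) = wnorm w I (d k)"
        "\<And>k. k \<in> {1..n} \<Longrightarrow> L2norm (\<lambda>t. T (d k t)) = wnorm w I (\<lambda>a. T (d k a))"
        "L2norm (\<lambda>t. \<Sum>k=1..n. d k t) = wnorm w I (\<lambda>a. \<Sum>k=1..n. d k a)"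
        "L2norm (\<lambda>t. \<Sum>k=1..n. T (d k t)) = wnorm w I (\<lambda>a. \<Sum>k=1..n. T (d k a))"
      and trunc: "\<And>k c. k \<le> n \<Longrightarrow>
        wnorm w I (\<lambda>a. \<Sum>j=1..k. c j *\<^sub>R d j a) \<le> wnorm w I (\<lambda>a. \<Sum>j=1..n. c j *\<^sub>R d j a)"
      and truncT: "\<And>k c. k \<le> n \<Longrightarrow>
        wnorm w I (\<lambda>a. \<Sum>j=1..k. c j *\<^sub>R T (d j a)) \<le> wnorm w I (\<lambda>a. \<Sum>j=1..n. c j *\<^sub>R T (d j a))"
    have w0: "\<And>a. a \<in> I \<Longrightarrow> 0 \<le> w a" using w by (auto intro: less_imp_le)
    define N where "N = wnorm w I (\<lambda>a. \<Sum>k=1..n. d k a)"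
    define D where "D k = wnorm w I (\<lambda>a. T (d k a))" for k
    have N0: "0 \<le> N" unfolding N_def by (rule wnorm_nonneg) (rule w0)
    have D0: "0 \<le> D k" for k unfolding D_def by (rule wnorm_nonneg) (rule w0)
    have DN: "D k \<le> 2 * K * N" if "k \<in> {1..n}" for k
    proof -
      have "wnorm w I (d k) \<le> 2 * N"
        unfolding N_def using martingale_wnorm_increment_le[of I w k n "\<lambda>x. x" d "\<lambda>_. 1"] w0 that trunc by auto
      moreover have "D k \<le> K * wnorm w I (d k)"
        unfolding D_def using K by (intro wnorm_bounded_linear w0) auto
      moreover have "K * wnorm w I (d k) \<le> K * (2 * N)" 
        using calculation(1) K by (intro mult_left_mono) auto
      ultimately show ?thesis by simp
    qed
    have large2: "\<epsilon>\<^sup>2 * n * N\<^sup>2 < (\<Sum>k=1..n. (D k)\<^sup>2)"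
    proof -
      have "\<epsilon> * sqrt n * N < sqrt (\<Sum>k=1..n. (D k)\<^sup>2)" using large L2 unfolding N_def D_def by simp
      then have "(\<epsilon> * sqrt n * N)\<^sup>2 < (sqrt (\<Sum>k=1..n. (D k)\<^sup>2))\<^sup>2"
        using e(1) N0 by (intro power_strict_mono) auto
      then show ?thesis by (simp add: power_mult_distrib sum_nonneg)
    qed
    \<comment> \<open>Needed for dividing by \<open>N\<close>: if the total vanished, so would every
      increment, against the strict inequality \<open>large2\<close>.\<close>
    have Npos: "0 < N"
    proof (rule ccontr)
      assume "\<not> 0 < N"
      then have "N = 0" using N0 by simp
      then have "(D k)\<^sup>2 = 0" if "k \<in> {1..n}" for k using DN[OF that] D0[of k] by simp
      then have "(\<Sum>k=1..n. (D k)\<^sup>2) = 0" by (intro sum.neutral) auto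
      then show False using large2 \<open>N = 0\<close> by simp
    qed
    define S where "S = {k\<in>{1..n}. \<epsilon> / 2 * N \<le> D k}"
    have finS: "finite S" unfolding S_def by simp
    have "M \<le> card S"
    proof -
      have "(\<Sum>k=1..n. (D k)\<^sup>2) \<le> (\<Sum>k=1..n. (\<epsilon> / 2 * N)\<^sup>2 + (if k \<in> S then (2 * K * N)\<^sup>2 else 0))"
      proof (rule sum_mono)
        fix k assume k: "k \<in> {1..n}"
        show "(D k)\<^sup>2 \<le> (\<epsilon> / 2 * N)\<^sup>2 + (if k \<in> S then (2 * K * N)\<^sup>2 else 0)"
        proof (cases "k \<in> S")
          case True
          have "(D k)\<^sup>2 \<le> (2 * K * N)\<^sup>2" using DN[OF k] D0 by (intro power_mono) auto
          then show ?thesis using True by (simp add: add_increasing)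
        next
          case False
          then have "(D k)\<^sup>2 \<le> (\<epsilon> / 2 * N)\<^sup>2" using k D0[of k] unfolding S_def by (intro power_mono) auto
          then show ?thesis using False by simp
        qed
      qed
      also have "\<dots> = n * (\<epsilon> / 2 * N)\<^sup>2 + card S * (2 * K * N)\<^sup>2"
      proof -
        have "(\<Sum>k=1..n. if k \<in> S then (2 * K * N)\<^sup>2 else 0) = (\<Sum>k\<in>S. (2 * K * N)\<^sup>2)"
          by (rule sum.mono_neutral_cong_right) (auto simp: S_def)
        then show ?thesis by (simp add: sum.distrib)
      qed
      finally have "\<epsilon>\<^sup>2 * n * N\<^sup>2 < n * (\<epsilon> / 2 * N)\<^sup>2 + card S * (2 * K * N)\<^sup>2" using large2 by simp
      then have "(3 * \<epsilon>\<^sup>2 * n) * N\<^sup>2 < (16 * K\<^sup>2 * card S) * N\<^sup>2"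
        by (simp add: power_mult_distrib field_simps)
      then have "3 * \<epsilon>\<^sup>2 * n < 16 * K\<^sup>2 * card S" using Npos by simp
      then have "16 * K\<^sup>2 * M < 16 * K\<^sup>2 * card S" using M by linarith
      then show ?thesis using K(1) by simp
    qed
    obtain r :: "nat \<Rightarrow> nat" where r: "strict_mono_on {..<card S} r" "\<And>i. i < card S \<Longrightarrow> r i \<in> S"
      using finite_enumerate[OF finS] by blast
    \<comment> \<open>The coefficient of \<open>d l\<close> in the martingale value at time
      \<open>r j\<close>, normalized by \<open>N\<close>.\<close>
    define e' where "e' j l = (if l \<le> r j then 1 / N else 0)" for j l
    define x where "x j a = (\<Sum>l=1..n. e' j l *\<^sub>R d l a)" for j a
    have xle: "wnorm w I (x j) \<le> 1" if "j < M" for j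
    proof -
      have rn: "r j \<in> {1..n}" using r(2)[of j] \<open>M \<le> card S\<close> that unfolding S_def by auto
      have "x j a = (1 / N) *\<^sub>R (\<Sum>l=1..r j. 1 *\<^sub>R d l a)" for a
      proof -
        have "x j a = (\<Sum>l=1..r j. (1 / N) *\<^sub>R d l a)"
          unfolding x_def e'_def by (rule sum.mono_neutral_cong_right) (use rn in auto)
        then show ?thesis by (simp add: scaleR_sum_right)
      qed
      then have "x j = (\<lambda>a. (1 / N) *\<^sub>R (\<Sum>l=1..r j. 1 *\<^sub>R d l a))" by blast
      then have "wnorm w I (x j) = 1 / N * wnorm w I (\<lambda>a. \<Sum>l=1..r j. 1 *\<^sub>R d l a)"
        using Npos wnorm_scaleR[of w I "1/N" "\<lambda>a. \<Sum>l=1..r j. 1 *\<^sub>R d l a"] by simp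
      also have "\<dots> \<le> 1 / N * N"
        using trunc[of "r j" "\<lambda>_. 1"] rn Npos unfolding N_def by (intro mult_left_mono) auto
      finally show ?thesis using Npos by simp
    qed
    have sep: "\<epsilon> / 4 \<le> wnorm w I (\<lambda>a. T ((\<Sum>j<k. \<alpha> j *\<^sub>R x j a) - (\<Sum>j=k..<M. \<alpha> j *\<^sub>R x j a)))"
      if k: "k \<le> M" and al: "sum \<alpha> {..<k} = 1" "sum \<alpha> {k..<M} = 1" for k \<alpha>
    proof -
      \<comment> \<open>For \<open>k = M\<close> the second sum is empty and cannot be 1; so
        \<open>k\<close> itself is the first index after the cut.\<close>
      have kM: "k < M" using al k by (cases "k = M") auto
      define c where "c l = (\<Sum>j<k. \<alpha> j * e' j l) - (\<Sum>j=k..<M. \<alpha> j * e' j l)" for l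
      have eq: "T ((\<Sum>j<k. \<alpha> j *\<^sub>R x j a) - (\<Sum>j=k..<M. \<alpha> j *\<^sub>R x j a)) = (\<Sum>l=1..n. c l *\<^sub>R T (d l a))" for a
        unfolding x_def T.diff bounded_linear_combination_swap[OF T] c_def
        by (simp add: scaleR_diff_left sum_subtractf)
      have rk: "r k \<in> S" using r(2) kM \<open>M \<le> card S\<close> by simp
      have lt: "r i < r j" if "i < j" "j < M" for i j
        using r(1) that \<open>M \<le> card S\<close> unfolding strict_mono_on_def by auto
      \<comment> \<open>Values before the cut stop short of time \<open>r k\<close>, while those
        from \<open>k\<close> on include it, \<open>x k\<close> among them because
        \<open>l \<le> r j\<close> is not strict. So the increment at \<open>r k\<close> enters only
        through the second combination, with total weight 1.\<close>
      have "(\<Sum>j<k. \<alpha> j * e' j (r k)) = 0"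
        using lt[of _ k] kM unfolding e'_def by (intro sum.neutral) (auto simp flip: not_less)
      moreover have "(\<Sum>j=k..<M. \<alpha> j * e' j (r k)) = (\<Sum>j=k..<M. \<alpha> j * (1 / N))"
      proof (rule sum.cong)
        fix j assume "j \<in> {k..<M}"
        then have "r k \<le> r j" using lt[of k j] by (cases "k = j") auto
        then show "\<alpha> j * e' j (r k) = \<alpha> j * (1 / N)" unfolding e'_def by simp
      qed simp
      moreover have "\<dots> = 1 / N" using al(2) by (simp flip: sum_divide_distrib)
      ultimately have c: "c (r k) = - (1 / N)" unfolding c_def by simp
      have "\<epsilon> / 2 \<le> \<bar>c (r k)\<bar> * D (r k)"
        using rk Npos unfolding c S_def by (simp add: field_simps)
      also have "\<dots> \<le> 2 * wnorm w I (\<lambda>a. \<Sum>l=1..n. c l *\<^sub>R T (d l a))"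
        unfolding D_def by (rule martingale_wnorm_increment_le[OF w0]) (use rk truncT in \<open>auto simp: S_def\<close>)
      finally show ?thesis unfolding eq by simp
    qed
    show ?thesis
      unfolding ladder_def using fin w0 xle sep by (intro exI[of _ I] exI[of _ w] exI[of _ x]) auto
  qed
qed

text \<open>Peel off convex combinations with small norm, each time with the largest multiple that keeps the
  remaining coefficients nonnegative; every step kills an index.\<close>

lemma convex_exhaustion:
  fixes g :: "nat \<Rightarrow> 'i \<Rightarrow> 'v::real_normed_vector"
  assumes w: "\<And>a. a \<in> I \<Longrightarrow> 0 \<le> w a" and "finite S"
    and "\<And>j. j \<in> S \<Longrightarrow> wnorm w I (g j) \<le> K" and "\<And>j. j \<in> S \<Longrightarrow> 0 \<le> \<alpha> j"
    and th: "0 \<le> \<theta>" and K: "0 \<le> K"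
    and no: "\<And>S'. S' \<subseteq> S \<Longrightarrow> M \<le> card S' \<Longrightarrow>
      \<exists>\<beta>. (\<forall>j\<in>S'. 0 \<le> \<beta> j) \<and> sum \<beta> S' = 1 \<and> wnorm w I (\<lambda>a. \<Sum>j\<in>S'. \<beta> j *\<^sub>R g j a) < \<theta>"
  shows "\<exists>S'\<subseteq>S. card S' < M \<and> wnorm w I (\<lambda>a. \<Sum>j\<in>S. \<alpha> j *\<^sub>R g j a) \<le> \<theta> * sum \<alpha> S + K * sum \<alpha> S'"
  using assms(2-4) no
proof (induction "card S" arbitrary: S \<alpha>)
  case less: (Suc m)
  note prems = less
  show ?case
  proof (cases "card S < M")
    case True
    \<comment> \<open>With fewer than \<open>M\<close> indices left, \<open>no\<close> says nothing
      more and each term is estimated crudely by \<open>K\<close>.\<close>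
    have "wnorm w I (\<lambda>a. \<Sum>j\<in>S. \<alpha> j *\<^sub>R g j a) \<le> (\<Sum>j\<in>S. wnorm w I (\<lambda>a. \<alpha> j *\<^sub>R g j a))"
      by (rule wnorm_sum) (rule w)
    also have "\<dots> \<le> (\<Sum>j\<in>S. K * \<alpha> j)"
      using prems(4,5) by (intro sum_mono) (auto simp: wnorm_scaleR mult.commute[of K] intro!: mult_left_mono)
    also have "\<dots> = K * sum \<alpha> S" by (simp add: sum_distrib_left)
    also have "\<dots> \<le> \<theta> * sum \<alpha> S + K * sum \<alpha> S" using th prems(5) by (simp add: sum_nonneg)
    finally show ?thesis using True by blast
  next
    case False
    obtain \<beta> where be: "\<And>j. j \<in> S \<Longrightarrow> 0 \<le> \<beta> j" "sum \<beta> S = 1" "wnorm w I (\<lambda>a. \<Sum>j\<in>S. \<beta> j *\<^sub>R g j a) < \<theta>"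
      using prems(6)[of S] False by auto
    define P where "P = {j\<in>S. 0 < \<beta> j}"
    have "P \<noteq> {}"
    proof
      assume "P = {}"
      then have "\<beta> j = 0" if "j \<in> S" for j using be(1)[OF that] that unfolding P_def by force
      then show False using be(2) by simp
    qed
    have finP: "finite P" using prems(3) unfolding P_def by simp
    obtain i where i: "i \<in> P" "\<And>j. j \<in> P \<Longrightarrow> \<alpha> i / \<beta> i \<le> \<alpha> j / \<beta> j"
      using arg_min_if_finite[OF finP \<open>P \<noteq> {}\<close>, of "\<lambda>j. \<alpha> j / \<beta> j"] by (metis not_le)
    define t where "t = \<alpha> i / \<beta> i"
    define \<alpha>' where "\<alpha>' j = \<alpha> j - t * \<beta> j" for j
    have iS: "i \<in> S" "0 < \<beta> i" using i(1) unfolding P_def by auto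
    have t0: "0 \<le> t" unfolding t_def using prems(5)[OF iS(1)] iS(2) by simp
    have al'i: "\<alpha>' i = 0" unfolding \<alpha>'_def t_def using iS(2) by simp
    have al'0: "0 \<le> \<alpha>' j" if "j \<in> S" for j
    proof (cases "j \<in> P")
      case True
      then have "t \<le> \<alpha> j / \<beta> j" "0 < \<beta> j" using i(2) unfolding t_def P_def by auto
      then show ?thesis unfolding \<alpha>'_def by (simp add: field_simps)
    next
      case False
      then have "\<beta> j = 0" using be(1)[OF that] that unfolding P_def by auto
      then show ?thesis unfolding \<alpha>'_def using prems(5)[OF that] by simp
    qed
    have al'le: "\<alpha>' j \<le> \<alpha> j" if "j \<in> S" for j unfolding \<alpha>'_def using t0 be(1)[OF that] by simp
    define S1 where "S1 = S - {i}"
    have S1: "S1 \<subseteq> S" "finite S1" "m = card S1" unfolding S1_def using prems(2,3) iS by auto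
    have "\<exists>S'\<subseteq>S1. card S' < M \<and> wnorm w I (\<lambda>a. \<Sum>j\<in>S1. \<alpha>' j *\<^sub>R g j a) \<le> \<theta> * sum \<alpha>' S1 + K * sum \<alpha>' S'"
      using prems(4,6) S1(1) al'0 by (intro prems(1)[OF S1(3,2)]) blast+
    then obtain S' where S': "S' \<subseteq> S1" "card S' < M"
      "wnorm w I (\<lambda>a. \<Sum>j\<in>S1. \<alpha>' j *\<^sub>R g j a) \<le> \<theta> * sum \<alpha>' S1 + K * sum \<alpha>' S'" by blast
    have S1s: "(\<Sum>j\<in>S. \<alpha>' j *\<^sub>R g j a) = (\<Sum>j\<in>S1. \<alpha>' j *\<^sub>R g j a)" for a
      unfolding S1_def using prems(3) iS al'i by (simp add: sum.remove)
    \<comment> \<open>As \<open>\<beta>\<close> has mass 1, peeling removes mass exactly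
      \<open>t\<close>, which pays for the cost \<open>t * \<theta>\<close> of the removed
      piece.\<close>
    have sum': "sum \<alpha>' S1 = sum \<alpha> S - t"
    proof -
      have "sum \<alpha>' S1 = sum \<alpha>' S" unfolding S1_def using prems(3) iS al'i by (simp add: sum.remove)
      also have "\<dots> = sum \<alpha> S - t * sum \<beta> S" unfolding \<alpha>'_def by (simp add: sum_subtractf sum_distrib_left)
      finally show ?thesis using be(2) by simp
    qed
    have "(\<Sum>j\<in>S. \<alpha> j *\<^sub>R g j a) = t *\<^sub>R (\<Sum>j\<in>S. \<beta> j *\<^sub>R g j a) + (\<Sum>j\<in>S. \<alpha>' j *\<^sub>R g j a)" for a
      unfolding \<alpha>'_def by (simp add: scaleR_diff_left sum_subtractf scaleR_sum_right)
    then have "wnorm w I (\<lambda>a. \<Sum>j\<in>S. \<alpha> j *\<^sub>R g j a)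
        \<le> wnorm w I (\<lambda>a. t *\<^sub>R (\<Sum>j\<in>S. \<beta> j *\<^sub>R g j a)) + wnorm w I (\<lambda>a. \<Sum>j\<in>S1. \<alpha>' j *\<^sub>R g j a)"
      unfolding S1s using wnorm_triangle[of I w "\<lambda>a. t *\<^sub>R (\<Sum>j\<in>S. \<beta> j *\<^sub>R g j a)"] w by simp
    also have "\<dots> \<le> t * \<theta> + (\<theta> * (sum \<alpha> S - t) + K * sum \<alpha>' S')"
      using S'(3) be(3) t0 unfolding sum' wnorm_scaleR by (intro add_mono) (auto intro!: mult_left_mono)
    also have "\<dots> \<le> \<theta> * sum \<alpha> S + K * sum \<alpha> S'"
    proof -
      \<comment> \<open>Coefficients only decrease, so the leftover can be charged to the original
        weights.\<close>
      have "sum \<alpha>' S' \<le> sum \<alpha> S'" using al'le S'(1) S1(1) by (intro sum_mono) auto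
      then show ?thesis using K by (simp add: algebra_simps mult_left_mono)
    qed
    finally show ?thesis using S' S1 by blast
  qed
next
  case (0 S \<alpha>)
  then have "S = {}" by simp
  \<comment> \<open>No weights on the empty set sum to 1, so \<open>no\<close> is incompatible with
    \<open>M = 0\<close>.\<close>
  have "0 < M"
  proof (rule ccontr)
    assume "\<not> 0 < M"
    then show False using 0(5)[of "{}"] by auto
  qed
  then show ?case unfolding \<open>S = {}\<close> by (simp add: wnorm_def)
qed


text \<open>Suppose every set of at least \<open>M\<close> indices had a convex combination of
  normalized images of norm below \<open>\<epsilon> / 2\<close>. Then
  \<open>convex_exhaustion\<close> with weights \<open>D l\<close> bounds the image of the total by
  \<open>\<epsilon> / 2 * sum D {1..n}\<close> plus \<open>K\<close> times the sum of fewer than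
  \<open>M\<close> weights. By Cauchy-Schwarz each part is at most
  \<open>\<epsilon> / 2 * sqrt n * A\<close>, the second one through the hypothesis on
  \<open>M\<close>; this contradicts the choice of \<open>d\<close>.\<close>

lemma ladder_of_tau_mart:
  fixes T :: "'a::real_normed_vector \<Rightarrow> 'b::real_normed_vector"
  assumes T: "bounded_linear T" and K: "0 < K" "\<And>x. norm (T x) \<le> K * norm x"
    and e: "0 < \<epsilon>" "\<epsilon> * sqrt n < tau_mart n T"
    and M: "4 * K\<^sup>2 * real M \<le> \<epsilon>\<^sup>2 * real n"
  shows "ladder T (\<epsilon> / 2) M"
proof -
  interpret T: bounded_linear T by fact
  have "\<not> (\<forall>d. martingale_differences n d \<longrightarrow>
     L2norm (\<lambda>t. \<Sum>k=1..n. T (d k t)) \<le> (\<epsilon> * sqrt n) * sqrt (\<Sum>k=1..n. (L2norm (d k))\<^sup>2))"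
  proof
    assume "\<forall>d. martingale_differences n d \<longrightarrow>
     L2norm (\<lambda>t. \<Sum>k=1..n. T (d k t)) \<le> (\<epsilon> * sqrt n) * sqrt (\<Sum>k=1..n. (L2norm (d k))\<^sup>2)"
    then have "tau_mart n T \<le> \<epsilon> * sqrt n"
      unfolding tau_mart_def using e(1) by (intro cInf_lower bdd_below_admissible) auto
    then show False using e by simp
  qed
  then obtain d where d: "martingale_differences n d"
    and large: "\<epsilon> * sqrt n * sqrt (\<Sum>k=1..n. (L2norm (d k))\<^sup>2) < L2norm (\<lambda>t. \<Sum>k=1..n. T (d k t))"
    by (auto simp: not_le)
  show ?thesis
  proof (rule martingale_differences_wnorm[OF T d])
    fix I :: "real set" and w assume fin: "finite I" and w: "\<And>a. a \<in> I \<Longrightarrow> 0 < w a"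
      and L2: "\<And>k. k \<in> {1..n} \<Longrightarrow> L2norm (d k) = wnorm w I (d k)"
        "\<And>k. k \<in> {1..n} \<Longrightarrow> L2norm (\<lambda>t. T (d k t)) = wnorm w I (\<lambda>a. T (d k a))"
        "L2norm (\<lambda>t. \<Sum>k=1..n. d k t) = wnorm w I (\<lambda>a. \<Sum>k=1..n. d k a)"
        "L2norm (\<lambda>t. \<Sum>k=1..n. T (d k t)) = wnorm w I (\<lambda>a. \<Sum>k=1..n. T (d k a))"
      and trunc: "\<And>k c. k \<le> n \<Longrightarrow>
        wnorm w I (\<lambda>a. \<Sum>j=1..k. c j *\<^sub>R d j a) \<le> wnorm w I (\<lambda>a. \<Sum>j=1..n. c j *\<^sub>R d j a)"
      and truncT: "\<And>k c. k \<le> n \<Longrightarrow>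
        wnorm w I (\<lambda>a. \<Sum>j=1..k. c j *\<^sub>R T (d j a)) \<le> wnorm w I (\<lambda>a. \<Sum>j=1..n. c j *\<^sub>R T (d j a))"
    have w0: "\<And>a. a \<in> I \<Longrightarrow> 0 \<le> w a" using w by (auto intro: less_imp_le)
    define D where "D k = wnorm w I (d k)" for k
    define A where "A = sqrt (\<Sum>k=1..n. (D k)\<^sup>2)"
    \<comment> \<open>Differences of norm zero are sent to zero, which keeps the bound in
      \<open>g1\<close>.\<close>
    define s where "s l = (if D l = 0 then 0 else 1 / D l)" for l
    define g where "g l a = s l *\<^sub>R d l a" for l a
    have D0: "0 \<le> D k" for k unfolding D_def by (rule wnorm_nonneg) (rule w0)
    have s0: "0 \<le> s l" for l unfolding s_def using D0 by simp
    have g1: "wnorm w I (g l) \<le> 1" for l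
    proof -
      have "wnorm w I (g l) = \<bar>s l\<bar> * D l" unfolding g_def D_def by (rule wnorm_scaleR)
      then show ?thesis unfolding s_def using D0[of l] by simp
    qed
    have Tg: "wnorm w I (\<lambda>a. T (g l a)) \<le> K" for l
    proof -
      have "wnorm w I (\<lambda>a. T (g l a)) \<le> K * wnorm w I (g l)"
        using K by (intro wnorm_bounded_linear w0) auto
      also have "\<dots> \<le> K * 1" using g1 K by (intro mult_left_mono) auto
      finally show ?thesis by simp
    qed
    \<comment> \<open>Here strict positivity of the weights matters: norm zero has to give back
      \<open>d l a = 0\<close> pointwise on \<open>I\<close>.\<close>
    have dg: "d l a = D l *\<^sub>R g l a" if "a \<in> I" for l a
    proof (cases "D l = 0")
      case True
      then have "(\<Sum>a\<in>I. w a * (norm (d l a))\<^sup>2) = 0"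
        unfolding D_def wnorm_def by simp
      then have "\<forall>a\<in>I. w a * (norm (d l a))\<^sup>2 = 0"
        using sum_nonneg_eq_0_iff[OF fin, of "\<lambda>a. w a * (norm (d l a))\<^sup>2"] w0 by simp
      then have "w a * (norm (d l a))\<^sup>2 = 0" using that by blast
      then show ?thesis using w[OF that] True by simp
    qed (simp add: g_def s_def)
    have large2: "\<epsilon> * sqrt n * A < wnorm w I (\<lambda>a. \<Sum>l=1..n. D l *\<^sub>R T (g l a))"
    proof -
      have "wnorm w I (\<lambda>a. \<Sum>l=1..n. T (d l a)) = wnorm w I (\<lambda>a. \<Sum>l=1..n. D l *\<^sub>R T (g l a))"
        by (rule wnorm_cong) (simp add: dg T.scaleR)
      then show ?thesis using large L2 unfolding A_def D_def by simp
    qed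
    have cs: "sum D S' \<le> sqrt (card S') * A" if "S' \<subseteq> {1..n}" for S'
    proof -
      have "(sum D S')\<^sup>2 \<le> (\<Sum>k\<in>S'. (D k)\<^sup>2) * card S'" by (rule sum_squared_le_sum_of_squares)
      also have "\<dots> \<le> (\<Sum>k=1..n. (D k)\<^sup>2) * card S'"
        using that by (intro mult_right_mono sum_mono2) auto
      finally have "sum D S' \<le> sqrt ((\<Sum>k=1..n. (D k)\<^sup>2) * card S')" by (rule real_le_rsqrt)
      then show ?thesis unfolding A_def by (simp add: real_sqrt_mult mult.commute)
    qed
    have A0: "0 \<le> A" unfolding A_def by (simp add: sum_nonneg)
    have "\<exists>S'\<subseteq>{1..n}. M \<le> card S' \<and> (\<forall>\<beta>. (\<forall>j\<in>S'. 0 \<le> \<beta> j) \<longrightarrow> sum \<beta> S' = 1 \<longrightarrow>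
        \<epsilon> / 2 \<le> wnorm w I (\<lambda>a. \<Sum>j\<in>S'. \<beta> j *\<^sub>R T (g j a)))"
    proof (rule ccontr)
      assume neg: "\<not> ?thesis"
      have "\<exists>S'\<subseteq>{1..n}. card S' < M \<and> wnorm w I (\<lambda>a. \<Sum>l=1..n. D l *\<^sub>R T (g l a)) \<le> \<epsilon> / 2 * sum D {1..n} + K * sum D S'"
        by (rule convex_exhaustion[where g="\<lambda>l a. T (g l a)", OF w0 finite_atLeastAtMost Tg D0])
          (use neg e K in \<open>auto simp: not_le\<close>)
      then obtain S' where S': "S' \<subseteq> {1..n}" "card S' < M"
        and le: "wnorm w I (\<lambda>a. \<Sum>l=1..n. D l *\<^sub>R T (g l a)) \<le> \<epsilon> / 2 * sum D {1..n} + K * sum D S'" by blast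
      have "K * sqrt (card S') \<le> \<epsilon> / 2 * sqrt n"
      proof (rule power2_le_imp_le)
        have "4 * K\<^sup>2 * card S' \<le> 4 * K\<^sup>2 * M" using S'(2) by (intro mult_left_mono) auto
        then have "4 * K\<^sup>2 * card S' \<le> \<epsilon>\<^sup>2 * n" using M by linarith
        then show "(K * sqrt (card S'))\<^sup>2 \<le> (\<epsilon> / 2 * sqrt n)\<^sup>2"
          by (simp add: power_mult_distrib power_divide)
      qed (use e in auto)
      then have "K * sqrt (card S') * A \<le> \<epsilon> / 2 * sqrt n * A" using A0 by (rule mult_right_mono)
      moreover have "K * sum D S' \<le> K * (sqrt (card S') * A)" using cs[OF S'(1)] K by (intro mult_left_mono) auto
      moreover have "\<epsilon> / 2 * sum D {1..n} \<le> \<epsilon> / 2 * (sqrt n * A)" using cs[of "{1..n}"] e by (intro mult_left_mono) auto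
      ultimately show False using le large2 by simp
    qed
    then obtain S where S: "S \<subseteq> {1..n}" "M \<le> card S"
      and low': "\<forall>\<beta>. (\<forall>j\<in>S. 0 \<le> \<beta> j) \<longrightarrow> sum \<beta> S = 1 \<longrightarrow>
        \<epsilon> / 2 \<le> wnorm w I (\<lambda>a. \<Sum>j\<in>S. \<beta> j *\<^sub>R T (g j a))" by (elim exE conjE)
    have low: "\<epsilon> / 2 \<le> wnorm w I (\<lambda>a. \<Sum>j\<in>S. \<beta> j *\<^sub>R T (g j a))"
      if "\<And>j. j \<in> S \<Longrightarrow> 0 \<le> \<beta> j" "sum \<beta> S = 1" for \<beta>
      using low' that by simp
    have finS: "finite S" using S(1) finite_subset by auto
    obtain r :: "nat \<Rightarrow> nat" where r: "strict_mono_on {..<card S} r" "\<And>i. i < card S \<Longrightarrow> r i \<in> S"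
      using finite_enumerate[OF finS] by blast
    define e' where "e' j l = (if l = r j then s l else 0)" for j l
    have rS: "r j \<in> S" "r j \<in> {1..n}" if "j < M" for j using r(2)[of j] S that by auto
    have x: "g (r j) a = (\<Sum>l=1..n. e' j l *\<^sub>R d l a)" if "j < M" for j a
    proof -
      have "(\<Sum>l=1..n. e' j l *\<^sub>R d l a) = (\<Sum>l\<in>{r j}. s l *\<^sub>R d l a)"
        using rS(2)[OF that] by (intro sum.mono_neutral_cong_right) (auto simp: e'_def)
      then show ?thesis unfolding g_def by simp
    qed
    have sep: "\<epsilon> / 2 \<le> wnorm w I (\<lambda>a. T ((\<Sum>j<k. \<alpha> j *\<^sub>R g (r j) a) - (\<Sum>j=k..<M. \<alpha> j *\<^sub>R g (r j) a)))"
      if k: "k \<le> M" and al0: "\<forall>j<M. 0 \<le> \<alpha> j" and al: "sum \<alpha> {..<k} = 1" for k \<alpha>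
    proof -
      \<comment> \<open>An empty first segment cannot have mass 1; so \<open>r (k - 1)\<close> is
        the last time of that segment.\<close>
      have k0: "0 < k" using al by (cases k) auto
      define c where "c l = (\<Sum>j<k. \<alpha> j * e' j l) - (\<Sum>j=k..<M. \<alpha> j * e' j l)" for l
      have eq: "T ((\<Sum>j<k. \<alpha> j *\<^sub>R g (r j) a) - (\<Sum>j=k..<M. \<alpha> j *\<^sub>R g (r j) a)) = (\<Sum>l=1..n. c l *\<^sub>R T (d l a))" for a
      proof -
        have "(\<Sum>j<k. \<alpha> j *\<^sub>R g (r j) a) = (\<Sum>j<k. \<alpha> j *\<^sub>R (\<Sum>l=1..n. e' j l *\<^sub>R d l a))"
          "(\<Sum>j=k..<M. \<alpha> j *\<^sub>R g (r j) a) = (\<Sum>j=k..<M. \<alpha> j *\<^sub>R (\<Sum>l=1..n. e' j l *\<^sub>R d l a))"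
          using x k by auto
        then show ?thesis
          unfolding T.diff bounded_linear_combination_swap[OF T, symmetric] c_def scaleR_diff_left sum_subtractf
          by (simp only: bounded_linear_combination_swap[OF T])
      qed
      have lt: "r i < r j" if "i < j" "j < M" for i j
        using r(1) that S(2) unfolding strict_mono_on_def by auto
      \<comment> \<open>As \<open>r\<close> increases, truncation at \<open>r (k - 1)\<close>
        deletes the second segment and leaves the first intact. What remains is a convex
        combination, to which \<open>low\<close> applies.\<close>
      have c1: "c l = (\<Sum>j<k. \<alpha> j * e' j l)" if "l \<le> r (k - 1)" for l
      proof -
        have "e' j l = 0" if "j \<in> {k..<M}" for j
        proof -
          have "k - 1 < j" using that k0 by auto
          then show ?thesis using lt[of "k - 1" j] that \<open>l \<le> r (k - 1)\<close> unfolding e'_def by auto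
        qed
        then show ?thesis unfolding c_def by simp
      qed
      have c2: "(\<Sum>j<k. \<alpha> j * e' j l) = 0" if "r (k - 1) < l" for l
      proof (rule sum.neutral, rule ballI)
        fix j assume "j \<in> {..<k}"
        then have "j = k - 1 \<or> j < k - 1" "k - 1 < M" using k by auto
        then have "r j \<le> r (k - 1)" using lt[of j "k - 1"] by auto
        then show "\<alpha> j * e' j l = 0" using that unfolding e'_def by auto
      qed
      have rk: "r (k - 1) \<in> {1..n}" using rS(2)[of "k - 1"] k k0 by auto
      \<comment> \<open>Weights are carried from positions \<open>j\<close> to indices
        \<open>r j\<close>; the other members of \<open>S\<close>, which may have more than
        \<open>M\<close> elements, get weight 0.\<close>
      define \<beta> where "\<beta> l = (\<Sum>j<k. if r j = l then \<alpha> j else 0)" for l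
      have "\<epsilon> / 2 \<le> wnorm w I (\<lambda>a. \<Sum>l\<in>S. \<beta> l *\<^sub>R T (g l a))"
      proof (rule low)
        show "0 \<le> \<beta> l" for l unfolding \<beta>_def using al0 k by (intro sum_nonneg) auto
        have "sum \<beta> S = (\<Sum>j<k. \<Sum>l\<in>S. if r j = l then \<alpha> j else 0)" unfolding \<beta>_def by (rule sum.swap)
        also have "\<dots> = sum \<alpha> {..<k}" using rS k finS by (intro sum.cong) auto
        finally show "sum \<beta> S = 1" using al by simp
      qed
      also have "(\<lambda>a. \<Sum>l\<in>S. \<beta> l *\<^sub>R T (g l a)) = (\<lambda>a. \<Sum>l=1..r (k - 1). c l *\<^sub>R T (d l a))"
      proof
        fix a
        have "(\<Sum>l\<in>S. \<beta> l *\<^sub>R T (g l a)) = (\<Sum>j<k. \<Sum>l\<in>S. (if r j = l then \<alpha> j else 0) *\<^sub>R T (g l a))"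
          unfolding \<beta>_def scaleR_sum_left by (rule sum.swap)
        also have "\<dots> = (\<Sum>j<k. \<alpha> j *\<^sub>R T (g (r j) a))"
        proof (rule sum.cong)
          fix j assume "j \<in> {..<k}"
          then have "r j \<in> S" using rS k by auto
          then have "(\<Sum>l\<in>S. (if r j = l then \<alpha> j else 0) *\<^sub>R T (g l a)) = (\<Sum>l\<in>{r j}. \<alpha> j *\<^sub>R T (g l a))"
            using finS by (intro sum.mono_neutral_cong_right) auto
          then show "(\<Sum>l\<in>S. (if r j = l then \<alpha> j else 0) *\<^sub>R T (g l a)) = \<alpha> j *\<^sub>R T (g (r j) a)" by simp
        qed simp
        also have "\<dots> = T (\<Sum>j<k. \<alpha> j *\<^sub>R (\<Sum>l=1..n. e' j l *\<^sub>R d l a))"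
          using x k by (simp add: T.sum T.scaleR)
        also have "\<dots> = (\<Sum>l=1..n. (\<Sum>j<k. \<alpha> j * e' j l) *\<^sub>R T (d l a))"
          by (rule bounded_linear_combination_swap[OF T])
        also have "\<dots> = (\<Sum>l=1..r (k - 1). c l *\<^sub>R T (d l a))"
          using rk c1 c2 by (intro sum.mono_neutral_cong_right) auto
        finally show "(\<Sum>l\<in>S. \<beta> l *\<^sub>R T (g l a)) = (\<Sum>l=1..r (k - 1). c l *\<^sub>R T (d l a))" .
      qed
      also have "wnorm w I \<dots> \<le> wnorm w I (\<lambda>a. \<Sum>l=1..n. c l *\<^sub>R T (d l a))"
        using rk by (intro truncT) auto
      finally show ?thesis unfolding eq .
    qed
    have "finite I \<and> (\<forall>a\<in>I. 0 \<le> w a) \<and> (\<forall>j<M. wnorm w I (\<lambda>a. g (r j) a) \<le> 1)" using fin w0 g1 by auto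
    then show ?thesis
      unfolding ladder_def using sep by (intro exI[of _ I] exI[of _ w] exI[of _ "\<lambda>j. g (r j)"]) auto
  qed
qed

subsection \<open>Dyadic cells and Haar polynomials\<close>

text \<open>Counted from 0, so that passing to a coarser level is integer division. The intervals
  \<open>dyadic\<close> are counted from 1, hence \<open>Suc\<close> wherever the two meet.\<close>

definition cell :: "nat \<Rightarrow> real \<Rightarrow> nat" where
  "cell m t = nat \<lfloor>2 ^ m * t\<rfloor>"

lemma cell_less: "t \<in> {0..<1} \<Longrightarrow> cell m t < 2 ^ m"
proof -
  assume "t \<in> {0..<1}"
  then have "0 \<le> \<lfloor>2 ^ m * t\<rfloor>" "\<lfloor>2 ^ m * t\<rfloor> < 2 ^ m" by (auto simp: floor_less_iff)
  then show ?thesis unfolding cell_def by (simp add: nat_less_iff)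
qed

text \<open>Rounding down to the fine grid and then to the coarse one equals rounding down
  once.\<close>

lemma cell_div:
  assumes "t \<in> {0..<1}" and "k \<le> m"
  shows "cell m t div 2 ^ (m - k) = cell k t"
proof -
  have "(2::real) ^ m * t / real_of_int (2 ^ (m - k)) = 2 ^ k * t"
    using assms(2) by (simp add: field_simps flip: power_add)
  then have "\<lfloor>(2::real) ^ k * t\<rfloor> = \<lfloor>2 ^ m * t\<rfloor> div 2 ^ (m - k)"
    using floor_divide_real_eq_div[of "2 ^ (m - k)" "2 ^ m * t"] by simp
  moreover have "0 \<le> \<lfloor>2 ^ m * t\<rfloor>" using assms(1) by simp
  ultimately show ?thesis unfolding cell_def by (simp add: nat_div_distrib nat_power_eq)
qed

lemma mem_dyadic_iff:
  assumes "t \<in> {0..<1}"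
  shows "t \<in> dyadic m (Suc c) \<longleftrightarrow> cell m t = c"
proof -
  have "cell m t = c \<longleftrightarrow> \<lfloor>2 ^ m * t\<rfloor> = int c" unfolding cell_def using assms by auto
  also have "\<dots> \<longleftrightarrow> real c \<le> 2 ^ m * t \<and> 2 ^ m * t < real c + 1" by (simp add: floor_eq_iff)
  also have "\<dots> \<longleftrightarrow> t \<in> dyadic m (Suc c)"
    unfolding dyadic_def by (simp add: field_simps)
  finally show ?thesis ..
qed

lemma dyadic_subset: "c < 2 ^ m \<Longrightarrow> dyadic m (Suc c) \<subseteq> {0..<1}"
proof
  fix t assume c: "c < 2 ^ m" and t: "t \<in> dyadic m (Suc c)"
  have "real (Suc c) \<le> real (2 ^ m)" using c by (subst of_nat_le_iff) simp
  then have "real (Suc c) / 2 ^ m \<le> 1" by simp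
  moreover have "0 \<le> (real (Suc c) - 1) / 2 ^ m" by simp
  moreover have "(real (Suc c) - 1) / 2 ^ m \<le> t" "t < real (Suc c) / 2 ^ m" using t unfolding dyadic_def by auto
  ultimately have "0 \<le> t" "t < 1" by linarith+
  then show "t \<in> {0..<1}" by simp
qed

lemma measure_dyadic:
  assumes "c < 2 ^ m"
  shows "dyadic m (Suc c) \<in> sets unit_leb" and "measure unit_leb (dyadic m (Suc c)) = 1 / 2 ^ m"
proof -
  show *: "dyadic m (Suc c) \<in> sets unit_leb"
    using dyadic_subset[OF assms] by (auto simp: sets_restrict_space_iff dyadic_def)
  have "measure unit_leb (dyadic m (Suc c)) = measure lebesgue (dyadic m (Suc c))"
    using dyadic_subset[OF assms] by (intro measure_restrict_space) auto
  also have "\<dots> = 1 / 2 ^ m" unfolding dyadic_def by (simp add: field_simps divide_right_mono)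
  finally show "measure unit_leb (dyadic m (Suc c)) = 1 / 2 ^ m" .
qed

lemma fun_cell_eq:
  assumes "t \<in> {0..<1}"
  shows "(\<Sum>c<2 ^ m. indicator (dyadic m (Suc c)) t *\<^sub>R v c) = (v (cell m t) :: 'v::real_vector)"
proof -
  have "(\<Sum>c<2 ^ m. indicator (dyadic m (Suc c)) t *\<^sub>R v c) = (\<Sum>c\<in>{cell m t}. v c)"
    using cell_less[OF assms] mem_dyadic_iff[OF assms]
    by (intro sum.mono_neutral_cong_right) (auto simp: indicator_def)
  then show ?thesis by simp
qed

lemma integral_cell:
  fixes v :: "nat \<Rightarrow> real"
  shows "(LINT t|unit_leb. v (cell m t)) = (\<Sum>c<2 ^ m. v c) / 2 ^ m"
proof -
  have "(LINT t|unit_leb. v (cell m t)) = (LINT t|unit_leb. (\<Sum>c<2 ^ m. indicator (dyadic m (Suc c)) t *\<^sub>R v c))"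
  proof (rule Bochner_Integration.integral_cong)
    fix t assume "t \<in> space unit_leb"
    then have "t \<in> {0..<1}" by (simp add: space_restrict_space)
    from fun_cell_eq[OF this, of m v]
    show "v (cell m t) = (\<Sum>c<2 ^ m. indicator (dyadic m (Suc c)) t *\<^sub>R v c)" by simp
  qed simp
  also have "\<dots> = (\<Sum>c<2 ^ m. (LINT t|unit_leb. indicator (dyadic m (Suc c)) t *\<^sub>R v c))"
  proof (rule Bochner_Integration.integral_sum)
    fix c :: nat assume "c \<in> {..<2 ^ m}"
    then have c: "c < 2 ^ m" by simp
    have "emeasure unit_leb (dyadic m (Suc c)) \<le> emeasure unit_leb (space unit_leb)"
      by (rule emeasure_space)
    also have "\<dots> = ennreal 1" by (simp add: emeasure_restrict_space space_restrict_space)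
    finally have "emeasure unit_leb (dyadic m (Suc c)) < \<infinity>" by (simp add: le_less_trans)
    then show "integrable unit_leb (\<lambda>t. indicator (dyadic m (Suc c)) t *\<^sub>R v c)"
      using measure_dyadic(1)[OF c] by (intro integrable_scaleR_left integrable_real_indicator) auto
  qed
  also have "\<dots> = (\<Sum>c<2 ^ m. v c / 2 ^ m)"
    using measure_dyadic(2) dyadic_subset by (intro sum.cong) (auto simp: space_restrict_space Int_absorb2)
  finally show ?thesis by (simp add: sum_divide_distrib)
qed

lemma L2norm_cong: "(\<And>t. t \<in> {0..<1} \<Longrightarrow> norm (f t) = norm (g t)) \<Longrightarrow> L2norm f = L2norm g"
  unfolding L2norm_def
  by (auto intro!: arg_cong[where f=sqrt] Bochner_Integration.integral_cong simp: space_restrict_space)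

lemma L2norm_cell:
  assumes "\<And>t. t \<in> {0..<1} \<Longrightarrow> f t = v (cell m t)"
  shows "L2norm f = sqrt ((\<Sum>c<2 ^ m. (norm (v c))\<^sup>2) / 2 ^ m)"
proof -
  have "L2norm f = L2norm (\<lambda>t. v (cell m t))" by (rule L2norm_cong) (simp add: assms)
  then show ?thesis unfolding L2norm_def integral_cell[of "\<lambda>c. (norm (v c))\<^sup>2"] by simp
qed

section \<open>Haar polynomials as functions of the dyadic cell\<close>

definition alt :: "nat \<Rightarrow> real" where
  "alt c = (if even c then 1 else - 1)"

text \<open>The support is read off from the cell at level \<open>k\<close>, the sign from the
  parity of the cell at level \<open>Suc k\<close>: left halves have even index.\<close>

lemma haar_eq:
  assumes "t \<in> {0..<1}"
  shows "haar (Suc k, Suc i) t = (if cell k t = i then 2 powr (real k / 2) * alt (cell (Suc k) t) else 0)"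
proof -
  have ck: "cell (Suc k) t div 2 = cell k t" using cell_div[OF assms, of k "Suc k"] by simp
  have 1: "t \<in> dyadic (Suc k) (2 * Suc i - 1) \<longleftrightarrow> cell (Suc k) t = 2 * i"
    using mem_dyadic_iff[OF assms, of "Suc k" "2 * i"] by simp
  have 2: "t \<in> dyadic (Suc k) (2 * Suc i) \<longleftrightarrow> cell (Suc k) t = 2 * i + 1"
    using mem_dyadic_iff[OF assms, of "Suc k" "2 * i + 1"] by simp
  have 3: "cell k t = i \<longleftrightarrow> cell (Suc k) t = 2 * i \<or> cell (Suc k) t = 2 * i + 1"
    unfolding ck[symmetric] by presburger
  show ?thesis
    unfolding haar.simps 1 2 3 alt_def by auto
qed

text \<open>At each point exactly one Haar function of a level is nonzero.\<close>

lemma haar_level_sum: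
  fixes x :: "nat \<times> nat \<Rightarrow> 'v::real_vector"
  assumes "t \<in> {0..<1}"
  shows "(\<Sum>j=1..2 ^ k. haar (Suc k, j) t *\<^sub>R x (Suc k, j))
    = (2 powr (real k / 2) * alt (cell (Suc k) t)) *\<^sub>R x (Suc k, Suc (cell k t))"
proof -
  have "(\<Sum>j=1..2 ^ k. haar (Suc k, j) t *\<^sub>R x (Suc k, j)) = (\<Sum>j\<in>{Suc (cell k t)}. haar (Suc k, j) t *\<^sub>R x (Suc k, j))"
  proof (rule sum.mono_neutral_right)
    show "\<forall>j\<in>{1..2 ^ k} - {Suc (cell k t)}. haar (Suc k, j) t *\<^sub>R x (Suc k, j) = 0"
    proof
      fix j assume j: "j \<in> {1..2 ^ k} - {Suc (cell k t)}"
      then obtain i where "j = Suc i" by (cases j) auto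
      with j show "haar (Suc k, j) t *\<^sub>R x (Suc k, j) = 0" by (simp add: haar_eq[OF assms] del: haar.simps)
    qed
    show "{Suc (cell k t)} \<subseteq> {1..2 ^ k}" using cell_less[OF assms, of k] by auto
  qed simp
  then show ?thesis by (simp add: haar_eq[OF assms] del: haar.simps)
qed

lemma haar_index_sum:
  fixes F :: "nat \<times> nat \<Rightarrow> 'v::comm_monoid_add"
  shows "(\<Sum>i\<in>haar_index m. F i) = F (0, 0) + (\<Sum>k<m. \<Sum>j=1..2 ^ k. F (Suc k, j))"
proof -
  have eq: "haar_index m = insert (0, 0) (\<Union>k\<in>{..<m}. {Suc k} \<times> {1..2 ^ k})" (is "_ = insert _ ?R")
  proof -
    have "(k, j) \<in> (\<Union>k\<in>{..<m}. {Suc k} \<times> {1..2 ^ k}) \<longleftrightarrow> 1 \<le> k \<and> k \<le> m \<and> 1 \<le> j \<and> j \<le> 2 ^ (k - 1)" for k j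
      by (cases k) auto
    then show ?thesis unfolding haar_index_def by auto
  qed
  have "(\<Sum>i\<in>?R. F i) = (\<Sum>k<m. \<Sum>i\<in>{Suc k} \<times> {1..2 ^ k}. F i)"
    by (rule sum.UNION_disjoint) auto
  also have "\<dots> = (\<Sum>k<m. \<Sum>j=1..2 ^ k. F (Suc k, j))"
  proof (rule sum.cong)
    fix k
    have "{Suc k} \<times> {1..2 ^ k} = Pair (Suc k) ` {1..2 ^ k :: nat}" by auto
    then show "(\<Sum>i\<in>{Suc k} \<times> {1..2 ^ k}. F i) = (\<Sum>j=1..2 ^ k. F (Suc k, j))"
      by (simp add: sum.reindex inj_on_def)
  qed simp
  finally show ?thesis unfolding eq by (subst sum.insert) auto
qed

text \<open>Haar polynomials in terms of the cell index \<open>c\<close> of level \<open>m\<close>. Here \<open>z k i\<close> stands for the coefficient of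
  \<open>\<chi>\<^sub>k\<^sub>+\<^sub>1\<close> number \<open>i + 1\<close>, scaled so that the Haar function takes the values \<open>\<plusminus>1\<close> on its support.\<close>

definition tree_sum :: "nat \<Rightarrow> 'v::real_vector \<Rightarrow> (nat \<Rightarrow> nat \<Rightarrow> 'v) \<Rightarrow> nat \<Rightarrow> 'v" where
  "tree_sum m y z c = y + (\<Sum>k<m. alt (c div 2 ^ (m - Suc k)) *\<^sub>R z k (c div 2 ^ (m - k)))"

definition haar_coeff :: "'v::real_vector \<Rightarrow> (nat \<Rightarrow> nat \<Rightarrow> 'v) \<Rightarrow> nat \<times> nat \<Rightarrow> 'v" where
  "haar_coeff y z i = (if fst i = 0 then y
     else (1 / 2 powr (real (fst i - 1) / 2)) *\<^sub>R z (fst i - 1) (snd i - 1))"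

lemma haar_sum_haar_coeff:
  assumes "t \<in> {0..<1}"
  shows "(\<Sum>i\<in>haar_index m. haar i t *\<^sub>R haar_coeff y z i) = tree_sum m y z (cell m t)"
proof -
  have "(\<Sum>j=1..2 ^ k. haar (Suc k, j) t *\<^sub>R haar_coeff y z (Suc k, j))
      = alt (cell m t div 2 ^ (m - Suc k)) *\<^sub>R z k (cell m t div 2 ^ (m - k))" if "k < m" for k
    unfolding haar_level_sum[OF assms] using that cell_div[OF assms, of k m] cell_div[OF assms, of "Suc k" m]
    by (simp add: haar_coeff_def)
  then show ?thesis unfolding haar_index_sum tree_sum_def by (simp add: haar_coeff_def)
qed

lemma haar_coeff_linear:
  assumes "linear T"
  shows "T (haar_coeff y z i) = haar_coeff (T y) (\<lambda>k i. T (z k i)) i"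
  using linear_cmul[OF assms] by (simp add: haar_coeff_def)

text \<open>The squared height of a Haar function at level \<open>Suc k\<close> is
  \<open>2 ^ k\<close>, which is also the number of nodes there; so each level contributes the mean
  square of its node values.\<close>

lemma sum_norm_haar_coeff:
  fixes y :: "'v::real_normed_vector"
  shows "(\<Sum>i\<in>haar_index m. (norm (haar_coeff y z i))\<^sup>2) = (norm y)\<^sup>2 + (\<Sum>k<m. (\<Sum>i<2 ^ k. (norm (z k i))\<^sup>2) / 2 ^ k)"
proof -
  have p: "(2 powr (real k / 2))\<^sup>2 = 2 ^ k" for k
    by (simp add: powr_power powr_realpow)
  have "(\<Sum>j=1..2 ^ k. (norm (haar_coeff y z (Suc k, j)))\<^sup>2) = (\<Sum>i<2 ^ k. (norm (z k i))\<^sup>2) / 2 ^ k" for k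
  proof -
    have "(\<Sum>j=1..2 ^ k. (norm (haar_coeff y z (Suc k, j)))\<^sup>2) = (\<Sum>i<2 ^ k. (norm (haar_coeff y z (Suc k, Suc i)))\<^sup>2)"
      by (rule sum.reindex_bij_witness[of _ Suc "\<lambda>j. j - 1"]) auto
    also have "\<dots> = (\<Sum>i<2 ^ k. (norm (z k i))\<^sup>2 / 2 ^ k)"
      by (simp add: haar_coeff_def power_mult_distrib power_divide p)
    finally show ?thesis by (simp add: sum_divide_distrib)
  qed
  then show ?thesis unfolding haar_index_sum by (simp add: haar_coeff_def)
qed

section \<open>Haar polynomials as martingales on the dyadic filtration\<close>

definition dyadic_algebra :: "nat \<Rightarrow> real measure" where
  "dyadic_algebra m = sigma {0..<1} ((\<lambda>c. dyadic m (Suc c)) ` {..<2 ^ m})"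

lemma dyadic_generators: "(\<lambda>c. dyadic m (Suc c)) ` {..<2 ^ m} \<subseteq> Pow {0..<1}"
  using dyadic_subset by blast

lemma space_dyadic_algebra [simp]: "space (dyadic_algebra m) = {0..<1}"
  unfolding dyadic_algebra_def by (rule space_measure_of) (rule dyadic_generators)

lemma sets_dyadic_algebra_sigma:
  "sets (dyadic_algebra m) = sigma_sets {0..<1} ((\<lambda>c. dyadic m (Suc c)) ` {..<2 ^ m})"
  unfolding dyadic_algebra_def by (rule sets_measure_of) (rule dyadic_generators)

text \<open>A description by cells alone: inclusions between the algebras and measurability of
  functions of the cell then follow without returning to generators.\<close>

lemma sets_dyadic_algebra:
  "A \<in> sets (dyadic_algebra m) \<longleftrightarrow> A \<subseteq> {0..<1} \<and> (\<forall>s\<in>{0..<1}. \<forall>t\<in>{0..<1}. cell m s = cell m t \<longrightarrow> s \<in> A \<longrightarrow> t \<in> A)"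
    (is "_ \<longleftrightarrow> ?P A")
proof
  assume A: "A \<in> sets (dyadic_algebra m)"
  then have "A \<subseteq> {0..<1}" using sets.sets_into_space[OF A] by simp
  moreover have "s \<in> A \<longleftrightarrow> t \<in> A" if st: "s \<in> {0..<1}" "t \<in> {0..<1}" "cell m s = cell m t" for s t
    using A unfolding sets_dyadic_algebra_sigma
  proof induction
    case (Basic a)
    then obtain c where "a = dyadic m (Suc c)" by auto
    then show ?case using mem_dyadic_iff st by simp
  qed (use st in auto)
  ultimately show "?P A" by blast
next
  assume A: "?P A"
  have "A = (\<Union>c\<in>cell m ` A. dyadic m (Suc c))"
  proof (intro equalityI subsetI)
    fix t assume "t \<in> A"
    then show "t \<in> (\<Union>c\<in>cell m ` A. dyadic m (Suc c))" using A mem_dyadic_iff by blast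
  next
    fix t assume "t \<in> (\<Union>c\<in>cell m ` A. dyadic m (Suc c))"
    then obtain s where s: "s \<in> A" "t \<in> dyadic m (Suc (cell m s))" by auto
    then have "s \<in> {0..<1}" using A by auto
    moreover have "t \<in> {0..<1}" using dyadic_subset cell_less[OF \<open>s \<in> {0..<1}\<close>] s(2) by blast
    ultimately show "t \<in> A" using A s mem_dyadic_iff by metis
  qed
  also have "\<dots> \<in> sets (dyadic_algebra m)"
  proof (rule sets.finite_UN)
    have "cell m ` A \<subseteq> {..<2 ^ m}" using A cell_less by blast
    then show "finite (cell m ` A)" by (rule finite_subset) simp
    show "dyadic m (Suc c) \<in> sets (dyadic_algebra m)" if "c \<in> cell m ` A" for c
      unfolding sets_dyadic_algebra_sigma using \<open>cell m ` A \<subseteq> {..<2 ^ m}\<close> that by (intro sigma_sets.Basic) auto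
  qed
  finally show "A \<in> sets (dyadic_algebra m)" .
qed

lemma cell_eq_mono:
  assumes "s \<in> {0..<1}" "t \<in> {0..<1}" "k \<le> m" "cell m s = cell m t"
  shows "cell k s = cell k t"
  using cell_div[OF assms(1,3)] cell_div[OF assms(2,3)] assms(4) by simp

lemma dyadic_algebra_mono: "k \<le> m \<Longrightarrow> sets (dyadic_algebra k) \<subseteq> sets (dyadic_algebra m)"
  using cell_eq_mono[of _ _ k m] unfolding subset_iff[of "sets _"] sets_dyadic_algebra by blast

lemma finitely_generated_dyadic_algebra: "finitely_generated_subalgebra (dyadic_algebra m)"
proof -
  have "sets (dyadic_algebra m) \<subseteq> sets unit_leb"
  proof -
    have "sigma_sets (space unit_leb) ((\<lambda>c. dyadic m (Suc c)) ` {..<2 ^ m}) \<subseteq> sets unit_leb"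
      by (rule sets.sigma_sets_subset) (use measure_dyadic(1) in auto)
    then show ?thesis unfolding sets_dyadic_algebra_sigma by (simp add: space_restrict_space)
  qed
  moreover have "\<exists>G. finite G \<and> G \<subseteq> Pow {0..<1} \<and> sets (dyadic_algebra m) = sigma_sets {0..<1} G"
    using dyadic_generators sets_dyadic_algebra_sigma by (intro exI conjI) auto
  ultimately show ?thesis
    unfolding finitely_generated_subalgebra_def subalgebra_def by (simp add: space_restrict_space)
qed

lemma measurable_fun_cell: "(\<lambda>t. v (cell m t)) \<in> borel_measurable (dyadic_algebra m)"
proof (rule measurableI)
  fix B :: "'a set"
  show "(\<lambda>t. v (cell m t)) -` B \<inter> space (dyadic_algebra m) \<in> sets (dyadic_algebra m)"
    unfolding sets_dyadic_algebra by auto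
qed simp

text \<open>The counterpart of \<open>integral_cell\<close> for values in an arbitrary normed space,
  for the integral that occurs in \<open>is_cond_exp\<close>.\<close>

lemma simple_bochner_integral_cell:
  fixes v :: "nat \<Rightarrow> 'v::real_normed_vector"
  assumes f: "\<And>t. t \<in> {0..<1} \<Longrightarrow> f t = v (cell m t)"
  shows "Bochner_Integration.simple_bochner_integral unit_leb f = (1 / 2 ^ m) *\<^sub>R (\<Sum>c<2 ^ m. v c)"
proof -
  have [simp]: "space unit_leb = {0..<1}" by (simp add: space_restrict_space)
  have cells: "{x \<in> {0..<1}. cell m x = c} = dyadic m (Suc c)" if "c < 2 ^ m" for c
    using mem_dyadic_iff dyadic_subset[OF that] by blast
  have img: "cell m ` {0..<1} = {..<2 ^ m}"
  proof
    show "cell m ` {0..<1} \<subseteq> {..<2 ^ m}" using cell_less by blast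
    show "{..<2 ^ m} \<subseteq> cell m ` {0..<1}"
    proof
      fix c :: nat assume c: "c \<in> {..<2 ^ m}"
      have "real c / 2 ^ m \<in> dyadic m (Suc c)" unfolding dyadic_def by (simp add: divide_strict_right_mono)
      then have "real c / 2 ^ m \<in> {x \<in> {0..<1}. cell m x = c}" using cells c by simp
      then show "c \<in> cell m ` {0..<1}" by (intro image_eqI[of _ _ "real c / 2 ^ m"]) simp_all
    qed
  qed
  have sf: "simple_function unit_leb (cell m)"
    unfolding simple_function_def
  proof safe
    show "finite (cell m ` space unit_leb)" using img by simp
    fix x assume x: "x \<in> space unit_leb"
    then have c: "cell m x < 2 ^ m" by (intro cell_less) simp
    have "cell m -` {cell m x} \<inter> space unit_leb = {y \<in> {0..<1}. cell m y = cell m x}" by auto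
    also have "\<dots> = dyadic m (Suc (cell m x))" by (rule cells[OF c])
    also have "\<dots> \<in> sets unit_leb" by (rule measure_dyadic(1)[OF c])
    finally show "cell m -` {cell m x} \<inter> space unit_leb \<in> sets unit_leb" .
  qed
  have "Bochner_Integration.simple_bochner_integral unit_leb f
      = (\<Sum>c\<in>cell m ` space unit_leb. measure unit_leb {x \<in> space unit_leb. cell m x = c} *\<^sub>R v c)"
  proof (rule simple_bochner_integral_partition[OF _ sf])
    show "Bochner_Integration.simple_bochner_integrable unit_leb f"
    proof (rule simple_bochner_integrable.intros)
      have "simple_function unit_leb (v \<circ> cell m)" using sf by (rule simple_function_compose)
      then show "simple_function unit_leb f"
        by (rule simple_function_cong[THEN iffD1, rotated]) (use f in auto)
      have "emeasure unit_leb {y \<in> space unit_leb. f y \<noteq> 0} \<le> emeasure unit_leb (space unit_leb)"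
        by (rule emeasure_space)
      also have "\<dots> = ennreal 1" by (simp add: emeasure_restrict_space)
      finally show "emeasure unit_leb {y \<in> space unit_leb. f y \<noteq> 0} \<noteq> \<infinity>" by (auto simp: top_unique)
    qed
  qed (use f in auto)
  also have "\<dots> = (\<Sum>c<2 ^ m. (1 / 2 ^ m) *\<^sub>R v c)"
  proof (rule sum.cong)
    fix c :: nat assume "c \<in> {..<2 ^ m}"
    then have c: "c < 2 ^ m" by simp
    have "{x \<in> space unit_leb. cell m x = c} = dyadic m (Suc c)" using cells[OF c] by simp
    then show "measure unit_leb {x \<in> space unit_leb. cell m x = c} *\<^sub>R v c = (1 / 2 ^ m) *\<^sub>R v c"
      using measure_dyadic(2)[OF c] by simp
  qed (simp add: img)
  finally show ?thesis by (simp add: scaleR_sum_right)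
qed

lemma tree_sum_Suc:
  "tree_sum (Suc m) y z c = tree_sum m y z (c div 2) + alt c *\<^sub>R z m (c div 2)"
proof -
  have "c div 2 ^ (m - k) = (c div 2) div 2 ^ (m - Suc k)" "c div 2 ^ (Suc m - k) = (c div 2) div 2 ^ (m - k)" if "k < m" for k
    using that by (simp_all add: Suc_diff_le Suc_diff_Suc flip: div_mult2_eq power_Suc)
  then show ?thesis unfolding tree_sum_def by (simp add: add.assoc)
qed

lemma sum_double:
  fixes f :: "nat \<Rightarrow> 'v::comm_monoid_add"
  shows "(\<Sum>c<2 * n. f c) = (\<Sum>c<n. f (2 * c) + f (2 * c + 1))"
  by (induction n) (simp_all add: add.assoc)

text \<open>The two children of a cell carry opposite signs, so the new term cancels in pairs, and a
  set of the coarser algebra never separates siblings.\<close>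

lemma tree_sum_integral_step:
  fixes y :: "'v::real_normed_vector"
  assumes A: "A \<in> sets (dyadic_algebra m)"
  shows "Bochner_Integration.simple_bochner_integral unit_leb (\<lambda>t. indicator A t *\<^sub>R tree_sum (Suc m) y z (cell (Suc m) t))
    = Bochner_Integration.simple_bochner_integral unit_leb (\<lambda>t. indicator A t *\<^sub>R tree_sum m y z (cell m t))"
proof -
  define ind :: "nat \<Rightarrow> real" where "ind c = (if c \<in> cell m ` A then 1 else 0)" for c
  have chi: "indicator A t = ind (cell m t)" if "t \<in> {0..<1}" for t
    using A that unfolding sets_dyadic_algebra ind_def by (auto simp: indicator_def)
  have cd: "cell m t = cell (Suc m) t div 2" if "t \<in> {0..<1}" for t
    using cell_div[OF that, of m "Suc m"] by simp
  have "Bochner_Integration.simple_bochner_integral unit_leb (\<lambda>t. indicator A t *\<^sub>R tree_sum (Suc m) y z (cell (Suc m) t))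
     = (1 / 2 ^ Suc m) *\<^sub>R (\<Sum>c<2 ^ Suc m. ind (c div 2) *\<^sub>R tree_sum (Suc m) y z c)"
    by (rule simple_bochner_integral_cell) (simp add: chi cd)
  also have "(\<Sum>c<2 ^ Suc m. ind (c div 2) *\<^sub>R tree_sum (Suc m) y z c) = (\<Sum>c<2 ^ m. 2 *\<^sub>R (ind c *\<^sub>R tree_sum m y z c))"
    unfolding power_Suc sum_double
    by (rule sum.cong) (auto simp: tree_sum_Suc alt_def scaleR_2 scaleR_add_right scaleR_diff_right simp del: scaleR_scaleR)
  also have "(1 / 2 ^ Suc m) *\<^sub>R (\<Sum>c<2 ^ m. 2 *\<^sub>R (ind c *\<^sub>R tree_sum m y z c)) = (1 / 2 ^ m) *\<^sub>R (\<Sum>c<2 ^ m. ind c *\<^sub>R tree_sum m y z c)"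
    by (simp add: scaleR_sum_right)
  also have "\<dots> = Bochner_Integration.simple_bochner_integral unit_leb (\<lambda>t. indicator A t *\<^sub>R tree_sum m y z (cell m t))"
    by (rule simple_bochner_integral_cell[symmetric]) (simp add: chi)
  finally show ?thesis .
qed

text \<open>Martingale differences start at index 1 with the constant term. So from
  \<open>k = 2\<close> on, the sign comes from level \<open>k - 1\<close> and the node from level
  \<open>k - 2\<close>, and \<open>m\<close> levels make \<open>Suc m\<close> differences.\<close>

definition tree_difference :: "'v::real_vector \<Rightarrow> (nat \<Rightarrow> nat \<Rightarrow> 'v) \<Rightarrow> nat \<Rightarrow> real \<Rightarrow> 'v" where
  "tree_difference y z k t = (if k = 1 then y else alt (cell (k - 1) t) *\<^sub>R z (k - 2) (cell (k - 2) t))"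

lemma martingale_differences_tree: "martingale_differences n (tree_difference y z)"
proof -
  define F where "F k = dyadic_algebra (k - 1)" for k
  define f where "f k t = tree_sum (k - 1) y z (cell (k - 1) t)" for k t
  have int: "Bochner_Integration.simple_bochner_integral unit_leb (\<lambda>t. indicator A t *\<^sub>R tree_sum k y z (cell k t))
    = Bochner_Integration.simple_bochner_integral unit_leb (\<lambda>t. indicator A t *\<^sub>R tree_sum j y z (cell j t))"
    if "j \<le> k" "A \<in> sets (dyadic_algebra j)" for A j k
    using that(1)
  proof (induction k rule: dec_induct)
    case (step k)
    \<comment> \<open>A set of the coarse algebra belongs to all finer ones, so the one-step
      identity can be iterated.\<close>
    have "A \<in> sets (dyadic_algebra k)" using that(2) dyadic_algebra_mono[OF step(1)] by blast
    from tree_sum_integral_step[OF this, of y z] step(3) show ?case by (rule trans)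
  qed simp
  have fm: "f k \<in> borel_measurable (F k)" for k
    unfolding f_def[abs_def] F_def by (rule measurable_fun_cell)
  have fg: "finitely_generated_subalgebra (F k)" for k
    unfolding F_def by (rule finitely_generated_dyadic_algebra)
  have "is_martingale n F f"
    unfolding is_martingale_def is_cond_exp_def
  proof (intro conjI ballI)
    fix k j assume "k \<in> {1..n}" "j \<in> {1..k}"
    then have jk: "j - 1 \<le> k - 1" by auto
    show "sets (F j) \<subseteq> sets (F k)" unfolding F_def by (rule dyadic_algebra_mono) (rule jk)
    fix A assume "A \<in> sets (F j)"
    then show "Bochner_Integration.simple_bochner_integral unit_leb (\<lambda>t. indicator A t *\<^sub>R f k t)
       = Bochner_Integration.simple_bochner_integral unit_leb (\<lambda>t. indicator A t *\<^sub>R f j t)"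
      unfolding f_def F_def by (intro int jk)
  qed (simp_all add: fm fg)
  moreover have "\<forall>k\<in>{1..n}. \<forall>t\<in>{0..<1}. tree_difference y z k t = (if k = 1 then f 1 t else f k t - f (k - 1) t)"
  proof (intro ballI)
    fix k t assume k: "k \<in> {1..n}" and t: "t \<in> {0..<1::real}"
    show "tree_difference y z k t = (if k = 1 then f 1 t else f k t - f (k - 1) t)"
    proof (cases "k = 1")
      case True
      then show ?thesis by (simp add: tree_difference_def f_def tree_sum_def)
    next
      case False
      then obtain l where l: "k = Suc (Suc l)" using k by (cases k; cases "k - 1") auto
      have "cell (Suc l) t div 2 = cell l t" using cell_div[OF t, of l "Suc l"] by simp
      then show ?thesis unfolding l tree_difference_def f_def by (simp add: tree_sum_Suc)
    qed
  qed
  ultimately show ?thesis unfolding martingale_differences_def by blast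
qed

lemma tree_difference_linear:
  assumes "linear T"
  shows "T (tree_difference y z k t) = tree_difference (T y) (\<lambda>k i. T (z k i)) k t"
  using linear_cmul[OF assms] by (simp add: tree_difference_def)

lemma sum_tree_difference:
  assumes t: "t \<in> {0..<1}"
  shows "(\<Sum>k=1..Suc m. tree_difference y z k t) = tree_sum m y z (cell m t)"
proof (induction m)
  case 0
  then show ?case by (simp add: tree_difference_def tree_sum_def)
next
  case (Suc m)
  have "cell (Suc m) t div 2 = cell m t" using cell_div[OF t, of m "Suc m"] by simp
  then show ?case using Suc by (simp add: tree_sum_Suc tree_difference_def)
qed

text \<open>The right-hand side is that of \<open>sum_norm_haar_coeff\<close>. Together with
  \<open>sum_tree_difference\<close> this identifies both sides of a Haar inequality with those of a
  martingale inequality.\<close>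

lemma sum_L2norm_tree_difference:
  fixes y :: "'v::real_normed_vector"
  shows "(\<Sum>k=1..Suc m. (L2norm (tree_difference y z k))\<^sup>2) = (norm y)\<^sup>2 + (\<Sum>k<m. (\<Sum>i<2 ^ k. (norm (z k i))\<^sup>2) / 2 ^ k)"
proof (induction m)
  case 0
  have "L2norm (tree_difference y z 1) = sqrt ((\<Sum>c<(2::nat) ^ 0. (norm y)\<^sup>2) / 2 ^ 0)"
    by (rule L2norm_cell) (simp add: tree_difference_def)
  then show ?case by simp
next
  case (Suc m)
  have "L2norm (tree_difference y z (Suc (Suc m))) = sqrt ((\<Sum>c<2 ^ Suc m. (norm (alt c *\<^sub>R z m (c div 2)))\<^sup>2) / 2 ^ Suc m)"
  proof (rule L2norm_cell)
    fix t assume t: "t \<in> {0..<1::real}"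
    have "cell (Suc m) t div 2 = cell m t" using cell_div[OF t, of m "Suc m"] by simp
    then show "tree_difference y z (Suc (Suc m)) t = alt (cell (Suc m) t) *\<^sub>R z m (cell (Suc m) t div 2)"
      by (simp add: tree_difference_def)
  qed
  also have "(\<Sum>c<2 ^ Suc m. (norm (alt c *\<^sub>R z m (c div 2)))\<^sup>2) = (\<Sum>c<2 ^ m. 2 * (norm (z m c))\<^sup>2)"
    unfolding power_Suc sum_double by (rule sum.cong) (auto simp: alt_def)
  also have "\<dots> / 2 ^ Suc m = (\<Sum>i<2 ^ m. (norm (z m i))\<^sup>2) / 2 ^ m"
    by (simp flip: sum_distrib_left)
  finally have "(L2norm (tree_difference y z (Suc (Suc m))))\<^sup>2 = (\<Sum>i<2 ^ m. (norm (z m i))\<^sup>2) / 2 ^ m"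
    by (simp add: sum_nonneg)
  then show ?case using Suc by simp
qed

text \<open>Every coefficient family comes from a tree, so statements about trees cover all Haar
  polynomials.\<close>

lemma haar_coeff_surj:
  fixes x :: "nat \<times> nat \<Rightarrow> 'v::real_vector"
  assumes "i \<in> haar_index m"
  shows "haar_coeff (x (0, 0)) (\<lambda>k i. 2 powr (real k / 2) *\<^sub>R x (Suc k, Suc i)) i = x i"
  using assms by (cases i) (auto simp: haar_coeff_def haar_index_def)

section \<open>Comparison of the ideal norms\<close>

lemma tau_mart_admissible:
  fixes T :: "'a::real_normed_vector \<Rightarrow> 'b::real_normed_vector"
  assumes T: "bounded_linear T" and K: "0 \<le> K" "\<And>x. norm (T x) \<le> K * norm x" and d: "martingale_differences n d"
  shows "L2norm (\<lambda>t. \<Sum>k=1..n. T (d k t)) \<le> (K * sqrt n) * sqrt (\<Sum>k=1..n. (L2norm (d k))\<^sup>2)"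
proof (rule martingale_differences_wnorm[OF T d])
  fix I :: "real set" and w assume w: "\<And>a. a \<in> I \<Longrightarrow> 0 < w a"
    and L2: "\<And>k. k \<in> {1..n} \<Longrightarrow> L2norm (d k) = wnorm w I (d k)"
      "L2norm (\<lambda>t. \<Sum>k=1..n. T (d k t)) = wnorm w I (\<lambda>a. \<Sum>k=1..n. T (d k a))"
  have w0: "\<And>a. a \<in> I \<Longrightarrow> 0 \<le> w a" using w by (auto intro: less_imp_le)
  have "wnorm w I (\<lambda>a. \<Sum>k=1..n. T (d k a)) \<le> (\<Sum>k=1..n. wnorm w I (\<lambda>a. T (d k a)))"
    by (rule wnorm_sum) (rule w0)
  also have "\<dots> \<le> (\<Sum>k=1..n. K * wnorm w I (d k))"
    using K by (intro sum_mono wnorm_bounded_linear w0) auto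
  also have "\<dots> = K * (\<Sum>k=1..n. L2norm (d k))" using L2(1) by (simp add: sum_distrib_left)
  also have "\<dots> \<le> K * sqrt ((\<Sum>k=1..n. (L2norm (d k))\<^sup>2) * card {1..n})"
    using K by (intro mult_left_mono real_le_rsqrt sum_squared_le_sum_of_squares) auto
  finally show ?thesis using L2(2) by (simp add: real_sqrt_mult mult_ac)
qed

lemma gamma_mart_admissible:
  fixes T :: "'a::real_normed_vector \<Rightarrow> 'b::real_normed_vector"
  assumes T: "bounded_linear T" and K: "0 \<le> K" "\<And>x. norm (T x) \<le> K * norm x" and d: "martingale_differences n d"
  shows "sqrt (\<Sum>k=1..n. (L2norm (\<lambda>t. T (d k t)))\<^sup>2) \<le> (2 * K * sqrt n) * L2norm (\<lambda>t. \<Sum>k=1..n. d k t)"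
proof (rule martingale_differences_wnorm[OF T d])
  fix I :: "real set" and w assume w: "\<And>a. a \<in> I \<Longrightarrow> 0 < w a"
    and L2: "\<And>k. k \<in> {1..n} \<Longrightarrow> L2norm (\<lambda>t. T (d k t)) = wnorm w I (\<lambda>a. T (d k a))"
      "L2norm (\<lambda>t. \<Sum>k=1..n. d k t) = wnorm w I (\<lambda>a. \<Sum>k=1..n. d k a)"
    and trunc: "\<And>k c. k \<le> n \<Longrightarrow>
      wnorm w I (\<lambda>a. \<Sum>j=1..k. c j *\<^sub>R d j a) \<le> wnorm w I (\<lambda>a. \<Sum>j=1..n. c j *\<^sub>R d j a)"
  have w0: "\<And>a. a \<in> I \<Longrightarrow> 0 \<le> w a" using w by (auto intro: less_imp_le)
  let ?N = "wnorm w I (\<lambda>a. \<Sum>k=1..n. d k a)"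
  have le: "wnorm w I (\<lambda>a. T (d k a)) \<le> 2 * K * ?N" if "k \<in> {1..n}" for k
  proof -
    have "wnorm w I (d k) \<le> 2 * ?N"
      using martingale_wnorm_increment_le[of I w k n "\<lambda>x. x" d "\<lambda>_. 1"] w0 that trunc by auto
    then have "K * wnorm w I (d k) \<le> K * (2 * ?N)" using K by (intro mult_left_mono)
    moreover have "wnorm w I (\<lambda>a. T (d k a)) \<le> K * wnorm w I (d k)"
      using K by (intro wnorm_bounded_linear w0) auto
    ultimately show ?thesis by simp
  qed
  have N0: "0 \<le> ?N" by (rule wnorm_nonneg) (rule w0)
  have "(\<Sum>k=1..n. (L2norm (\<lambda>t. T (d k t)))\<^sup>2) \<le> (\<Sum>k=1..n. (2 * K * ?N)\<^sup>2)"
    using L2(1) le by (intro sum_mono power_mono) (auto intro: wnorm_nonneg w0)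
  also have "\<dots> = (2 * K * sqrt n * ?N)\<^sup>2" by (simp add: power_mult_distrib)
  finally have "sqrt (\<Sum>k=1..n. (L2norm (\<lambda>t. T (d k t)))\<^sup>2) \<le> 2 * K * sqrt n * ?N"
    using K N0 by (intro real_le_lsqrt) (auto intro: sum_nonneg)
  then show ?thesis using L2(2) by simp
qed

text \<open>Named sets of admissible constants turn the comparison of ideal norms into an inclusion,
  and lower bounds can be proved for one admissible constant at a time.\<close>

definition tau_mart_bounds :: "nat \<Rightarrow> ('a::real_normed_vector \<Rightarrow> 'b::real_normed_vector) \<Rightarrow> real set" where
  "tau_mart_bounds n T = {c. 0 \<le> c \<and> (\<forall>d. martingale_differences n d \<longrightarrow>
     L2norm (\<lambda>t. \<Sum>k=1..n. T (d k t)) \<le> c * sqrt (\<Sum>k=1..n. (L2norm (d k))\<^sup>2))}"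

definition gamma_mart_bounds :: "nat \<Rightarrow> ('a::real_normed_vector \<Rightarrow> 'b::real_normed_vector) \<Rightarrow> real set" where
  "gamma_mart_bounds n T = {c. 0 \<le> c \<and> (\<forall>d. martingale_differences n d \<longrightarrow>
     sqrt (\<Sum>k=1..n. (L2norm (\<lambda>t. T (d k t)))\<^sup>2) \<le> c * L2norm (\<lambda>t. \<Sum>k=1..n. d k t))}"

definition tau_haar_bounds :: "nat \<Rightarrow> ('a::real_normed_vector \<Rightarrow> 'b::real_normed_vector) \<Rightarrow> real set" where
  "tau_haar_bounds n T = {c. 0 \<le> c \<and> (\<forall>x :: nat \<times> nat \<Rightarrow> 'a.
     L2norm (\<lambda>t. \<Sum>i\<in>haar_index n. haar i t *\<^sub>R T (x i))
       \<le> c * sqrt (\<Sum>i\<in>haar_index n. (norm (x i))\<^sup>2))}"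

definition gamma_haar_bounds :: "nat \<Rightarrow> ('a::real_normed_vector \<Rightarrow> 'b::real_normed_vector) \<Rightarrow> real set" where
  "gamma_haar_bounds n T = {c. 0 \<le> c \<and> (\<forall>x :: nat \<times> nat \<Rightarrow> 'a.
     sqrt (\<Sum>i\<in>haar_index n. (norm (T (x i)))\<^sup>2)
       \<le> c * L2norm (\<lambda>t. \<Sum>i\<in>haar_index n. haar i t *\<^sub>R x i))}"

lemma ideal_norms_eq_Inf:
  "tau_mart n T = Inf (tau_mart_bounds n T)" "gamma_mart n T = Inf (gamma_mart_bounds n T)"
  "tau_haar n T = Inf (tau_haar_bounds n T)" "gamma_haar n T = Inf (gamma_haar_bounds n T)"
  unfolding tau_mart_def gamma_mart_def tau_haar_def gamma_haar_def
    tau_mart_bounds_def gamma_mart_bounds_def tau_haar_bounds_def gamma_haar_bounds_def by (rule refl)+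

lemma bdd_below_ideal_norm_bounds:
  "bdd_below (tau_haar_bounds n T)" "bdd_below (gamma_haar_bounds n T)"
  unfolding tau_haar_bounds_def gamma_haar_bounds_def by (rule bdd_below_admissible)+

text \<open>Crude constants of order \<open>\<surd>n\<close> are admissible, by the triangle
  inequality and by truncation. Comparing infima through inclusions is sound only for nonempty
  sets.\<close>

lemma mart_bounds_nonempty:
  assumes T: "bounded_linear T"
  shows "tau_mart_bounds n T \<noteq> {}" "gamma_mart_bounds n T \<noteq> {}"
proof -
  obtain K where K: "0 \<le> K" "\<And>x. norm (T x) \<le> K * norm x"
    using bounded_linear.nonneg_bounded[OF T] by (auto simp: mult.commute)
  have "K * sqrt n \<in> tau_mart_bounds n T"
    unfolding tau_mart_bounds_def using tau_mart_admissible[OF T K] K(1) by auto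
  moreover have "2 * K * sqrt n \<in> gamma_mart_bounds n T"
    unfolding gamma_mart_bounds_def using gamma_mart_admissible[OF T K] K(1) by auto
  ultimately show "tau_mart_bounds n T \<noteq> {}" "gamma_mart_bounds n T \<noteq> {}" by auto
qed

text \<open>The constant term of a Haar polynomial is a difference of its own, which explains
  \<open>Suc m\<close>.\<close>

lemma tau_mart_bounds_subset:
  fixes T :: "'a::real_normed_vector \<Rightarrow> 'b::real_normed_vector"
  assumes T: "bounded_linear T"
  shows "tau_mart_bounds (Suc m) T \<subseteq> tau_haar_bounds m T"
proof -
  interpret T: bounded_linear T by fact
  show ?thesis
    unfolding tau_mart_bounds_def tau_haar_bounds_def
  proof safe
    fix c and x :: "nat \<times> nat \<Rightarrow> 'a"
    assume c: "\<forall>d. martingale_differences (Suc m) d \<longrightarrow>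
     L2norm (\<lambda>t. \<Sum>k=1..Suc m. T (d k t)) \<le> c * sqrt (\<Sum>k=1..Suc m. (L2norm (d k))\<^sup>2)"
    define y where "y = x (0, 0)"
    define z where "z k i = 2 powr (real k / 2) *\<^sub>R x (Suc k, Suc i)" for k i
    have x: "x i = haar_coeff y z i" if "i \<in> haar_index m" for i
      using haar_coeff_surj[OF that, of x] unfolding y_def z_def[abs_def] by simp
    have "L2norm (\<lambda>t. \<Sum>i\<in>haar_index m. haar i t *\<^sub>R T (x i)) = L2norm (\<lambda>t. \<Sum>k=1..Suc m. T (tree_difference y z k t))"
    proof (rule L2norm_cong)
      fix t assume t: "t \<in> {0..<1::real}"
      have "(\<Sum>i\<in>haar_index m. haar i t *\<^sub>R T (x i)) = (\<Sum>i\<in>haar_index m. haar i t *\<^sub>R haar_coeff (T y) (\<lambda>k i. T (z k i)) i)"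
        using x by (intro sum.cong) (auto simp: haar_coeff_linear[OF T.linear])
      also have "\<dots> = (\<Sum>k=1..Suc m. T (tree_difference y z k t))"
        unfolding haar_sum_haar_coeff[OF t] tree_difference_linear[OF T.linear] sum_tree_difference[OF t] ..
      finally show "norm (\<Sum>i\<in>haar_index m. haar i t *\<^sub>R T (x i)) = norm (\<Sum>k=1..Suc m. T (tree_difference y z k t))"
        by simp
    qed
    also have "\<dots> \<le> c * sqrt (\<Sum>k=1..Suc m. (L2norm (tree_difference y z k))\<^sup>2)"
      using c martingale_differences_tree by blast
    also have "(\<Sum>k=1..Suc m. (L2norm (tree_difference y z k))\<^sup>2) = (\<Sum>i\<in>haar_index m. (norm (x i))\<^sup>2)"
      unfolding sum_L2norm_tree_difference sum_norm_haar_coeff[symmetric] using x by (intro sum.cong) auto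
    finally show "L2norm (\<lambda>t. \<Sum>i\<in>haar_index m. haar i t *\<^sub>R T (x i)) \<le> c * sqrt (\<Sum>i\<in>haar_index m. (norm (x i))\<^sup>2)" .
  qed
qed

lemma gamma_mart_bounds_subset:
  fixes T :: "'a::real_normed_vector \<Rightarrow> 'b::real_normed_vector"
  assumes T: "bounded_linear T"
  shows "gamma_mart_bounds (Suc m) T \<subseteq> gamma_haar_bounds m T"
proof -
  interpret T: bounded_linear T by fact
  show ?thesis
    unfolding gamma_mart_bounds_def gamma_haar_bounds_def
  proof safe
    fix c and x :: "nat \<times> nat \<Rightarrow> 'a"
    assume c: "\<forall>d. martingale_differences (Suc m) d \<longrightarrow>
     sqrt (\<Sum>k=1..Suc m. (L2norm (\<lambda>t. T (d k t)))\<^sup>2) \<le> c * L2norm (\<lambda>t. \<Sum>k=1..Suc m. d k t)"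
    define y where "y = x (0, 0)"
    define z where "z k i = 2 powr (real k / 2) *\<^sub>R x (Suc k, Suc i)" for k i
    have x: "x i = haar_coeff y z i" if "i \<in> haar_index m" for i
      using haar_coeff_surj[OF that, of x] unfolding y_def z_def[abs_def] by simp
    have "(\<Sum>i\<in>haar_index m. (norm (T (x i)))\<^sup>2) = (\<Sum>i\<in>haar_index m. (norm (haar_coeff (T y) (\<lambda>k i. T (z k i)) i))\<^sup>2)"
      using x by (intro sum.cong) (auto simp: haar_coeff_linear[OF T.linear])
    also have "\<dots> = (\<Sum>k=1..Suc m. (L2norm (tree_difference (T y) (\<lambda>k i. T (z k i)) k))\<^sup>2)"
      unfolding sum_L2norm_tree_difference sum_norm_haar_coeff ..
    also have "\<dots> = (\<Sum>k=1..Suc m. (L2norm (\<lambda>t. T (tree_difference y z k t)))\<^sup>2)"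
      unfolding tree_difference_linear[OF T.linear] ..
    finally have "sqrt (\<Sum>i\<in>haar_index m. (norm (T (x i)))\<^sup>2) \<le> c * L2norm (\<lambda>t. \<Sum>k=1..Suc m. tree_difference y z k t)"
      using c martingale_differences_tree by metis
    also have "L2norm (\<lambda>t. \<Sum>k=1..Suc m. tree_difference y z k t) = L2norm (\<lambda>t. \<Sum>i\<in>haar_index m. haar i t *\<^sub>R x i)"
    proof (rule L2norm_cong)
      fix t assume t: "t \<in> {0..<1::real}"
      have "(\<Sum>i\<in>haar_index m. haar i t *\<^sub>R x i) = (\<Sum>i\<in>haar_index m. haar i t *\<^sub>R haar_coeff y z i)"
        using x by (intro sum.cong) auto
      then show "norm (\<Sum>k=1..Suc m. tree_difference y z k t) = norm (\<Sum>i\<in>haar_index m. haar i t *\<^sub>R x i)"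
        unfolding haar_sum_haar_coeff[OF t] sum_tree_difference[OF t] by simp
    qed
    finally show "sqrt (\<Sum>i\<in>haar_index m. (norm (T (x i)))\<^sup>2) \<le> c * L2norm (\<lambda>t. \<Sum>i\<in>haar_index m. haar i t *\<^sub>R x i)" .
  qed
qed


lemma haar_bounds_nonempty:
  assumes T: "bounded_linear T"
  shows "tau_haar_bounds m T \<noteq> {}" "gamma_haar_bounds m T \<noteq> {}"
  using mart_bounds_nonempty[OF T, of "Suc m"] tau_mart_bounds_subset[OF T, of m] gamma_mart_bounds_subset[OF T, of m] by blast+

lemma haar_norm_le_mart_norm:
  assumes T: "bounded_linear T"
  shows "tau_haar m T \<le> tau_mart (Suc m) T" "gamma_haar m T \<le> gamma_mart (Suc m) T"
  unfolding ideal_norms_eq_Inf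
  by (rule cInf_superset_mono, rule mart_bounds_nonempty[OF T], rule bdd_below_ideal_norm_bounds,
      rule tau_mart_bounds_subset[OF T] gamma_mart_bounds_subset[OF T])+

lemma ideal_norms_nonneg:
  assumes T: "bounded_linear T"
  shows "0 \<le> tau_mart n T" "0 \<le> gamma_mart n T" "0 \<le> tau_haar n T" "0 \<le> gamma_haar n T"
  unfolding ideal_norms_eq_Inf
  by (rule cInf_greatest, rule mart_bounds_nonempty[OF T] haar_bounds_nonempty[OF T],
      simp add: tau_mart_bounds_def gamma_mart_bounds_def tau_haar_bounds_def gamma_haar_bounds_def)+

subsection \<open>Lower bounds for the Haar ideal norms\<close>

text \<open>With all nodes equal to 1 the tree is a sum of \<open>m\<close> Rademacher functions,
  and orthonormality makes its mean square \<open>m\<close>. The recursion rests on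
  \<open>(D + 1)^2 + (D - 1)^2 = 2 * D^2 + 2\<close>.\<close>

lemma sum_alt_squares:
  "(\<Sum>c<2 ^ m. (tree_sum m 0 (\<lambda>_ _. 1) c)\<^sup>2) = real m * 2 ^ m"
proof (induction m)
  case 0
  then show ?case by (simp add: tree_sum_def)
next
  case (Suc m)
  let ?D = "\<lambda>c. tree_sum m 0 (\<lambda>_ _. 1::real) c"
  have "(\<Sum>c<2 ^ Suc m. (tree_sum (Suc m) 0 (\<lambda>_ _. 1::real) c)\<^sup>2) = (\<Sum>c<2 ^ m. 2 * (?D c)\<^sup>2 + 2)"
    unfolding power_Suc sum_double
    by (rule sum.cong) (auto simp: tree_sum_Suc alt_def power2_eq_square algebra_simps)
  also have "\<dots> = 2 * (\<Sum>c<2 ^ m. (?D c)\<^sup>2) + 2 * 2 ^ m"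
    by (simp add: sum.distrib sum_distrib_left)
  also have "\<dots> = real (Suc m) * 2 ^ Suc m" unfolding Suc by (simp add: algebra_simps)
  finally show ?case .
qed

text \<open>The squared form, ready to be weighted by \<open>w a\<close> and summed over the points
  \<open>a\<close> of a ladder.\<close>

lemma tau_haar_bounds_tree:
  fixes T :: "'a::real_normed_vector \<Rightarrow> 'b::real_normed_vector"
  assumes T: "bounded_linear T" and C: "C \<in> tau_haar_bounds m T"
  shows "(\<Sum>c<2 ^ m. (norm (T (tree_sum m y z c)))\<^sup>2) / 2 ^ m
    \<le> C\<^sup>2 * ((norm y)\<^sup>2 + (\<Sum>k<m. (\<Sum>i<2 ^ k. (norm (z k i))\<^sup>2) / 2 ^ k))"
proof -
  interpret T: bounded_linear T by fact
  have eq: "L2norm (\<lambda>t. \<Sum>i\<in>haar_index m. haar i t *\<^sub>R T (haar_coeff y z i)) = sqrt ((\<Sum>c<2 ^ m. (norm (T (tree_sum m y z c)))\<^sup>2) / 2 ^ m)"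
  proof (rule L2norm_cell)
    fix t assume t: "t \<in> {0..<1::real}"
    have "(\<Sum>i\<in>haar_index m. haar i t *\<^sub>R T (haar_coeff y z i)) = T (\<Sum>i\<in>haar_index m. haar i t *\<^sub>R haar_coeff y z i)"
      by (simp add: T.sum T.scaleR)
    then show "(\<Sum>i\<in>haar_index m. haar i t *\<^sub>R T (haar_coeff y z i)) = T (tree_sum m y z (cell m t))"
      unfolding haar_sum_haar_coeff[OF t] .
  qed
  have "sqrt ((\<Sum>c<2 ^ m. (norm (T (tree_sum m y z c)))\<^sup>2) / 2 ^ m) \<le> C * sqrt (\<Sum>i\<in>haar_index m. (norm (haar_coeff y z i))\<^sup>2)"
    using C unfolding tau_haar_bounds_def eq[symmetric] by blast
  then have "(sqrt ((\<Sum>c<2 ^ m. (norm (T (tree_sum m y z c)))\<^sup>2) / 2 ^ m))\<^sup>2 \<le> (C * sqrt (\<Sum>i\<in>haar_index m. (norm (haar_coeff y z i))\<^sup>2))\<^sup>2"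
    by (rule power_mono) (simp add: sum_nonneg)
  then show ?thesis
    by (simp add: sum_nonneg power_mult_distrib sum_norm_haar_coeff)
qed

lemma gamma_haar_bounds_tree:
  fixes T :: "'a::real_normed_vector \<Rightarrow> 'b::real_normed_vector"
  assumes T: "bounded_linear T" and C: "C \<in> gamma_haar_bounds m T"
  shows "(norm (T y))\<^sup>2 + (\<Sum>k<m. (\<Sum>i<2 ^ k. (norm (T (z k i)))\<^sup>2) / 2 ^ k)
    \<le> C\<^sup>2 * ((\<Sum>c<2 ^ m. (norm (tree_sum m y z c))\<^sup>2) / 2 ^ m)"
proof -
  interpret T: bounded_linear T by fact
  have eq: "L2norm (\<lambda>t. \<Sum>i\<in>haar_index m. haar i t *\<^sub>R haar_coeff y z i) = sqrt ((\<Sum>c<2 ^ m. (norm (tree_sum m y z c))\<^sup>2) / 2 ^ m)"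
    by (rule L2norm_cell) (rule haar_sum_haar_coeff)
  have eq2: "(\<Sum>i\<in>haar_index m. (norm (T (haar_coeff y z i)))\<^sup>2) = (norm (T y))\<^sup>2 + (\<Sum>k<m. (\<Sum>i<2 ^ k. (norm (T (z k i)))\<^sup>2) / 2 ^ k)"
    unfolding haar_coeff_linear[OF T.linear] by (rule sum_norm_haar_coeff)
  have "sqrt (\<Sum>i\<in>haar_index m. (norm (T (haar_coeff y z i)))\<^sup>2) \<le> C * sqrt ((\<Sum>c<2 ^ m. (norm (tree_sum m y z c))\<^sup>2) / 2 ^ m)"
    using C unfolding gamma_haar_bounds_def eq[symmetric] by blast
  then have "(sqrt (\<Sum>i\<in>haar_index m. (norm (T (haar_coeff y z i)))\<^sup>2))\<^sup>2 \<le> (C * sqrt ((\<Sum>c<2 ^ m. (norm (tree_sum m y z c))\<^sup>2) / 2 ^ m))\<^sup>2"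
    by (rule power_mono) (simp add: sum_nonneg)
  then have "(\<Sum>i\<in>haar_index m. (norm (T (haar_coeff y z i)))\<^sup>2) \<le> C\<^sup>2 * ((\<Sum>c<2 ^ m. (norm (tree_sum m y z c))\<^sup>2) / 2 ^ m)"
    by (simp add: sum_nonneg power_mult_distrib)
  then show ?thesis unfolding eq2 .
qed

text \<open>Interchange of finite sums: a pointwise inequality, weighted and summed, becomes one
  between values of \<open>wnorm\<close>.\<close>

lemma sum_norm_eq_wnorm:
  assumes "\<And>a. a \<in> I \<Longrightarrow> 0 \<le> w a"
  shows "(\<Sum>a\<in>I. w a * (\<Sum>c\<in>J. (norm (f c a))\<^sup>2)) = (\<Sum>c\<in>J. (wnorm w I (f c))\<^sup>2)"
proof -
  have "(\<Sum>a\<in>I. w a * (\<Sum>c\<in>J. (norm (f c a))\<^sup>2)) = (\<Sum>c\<in>J. \<Sum>a\<in>I. w a * (norm (f c a))\<^sup>2)"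
    unfolding sum_distrib_left by (rule sum.swap)
  moreover have "(wnorm w I (f c))\<^sup>2 = (\<Sum>a\<in>I. w a * (norm (f c a))\<^sup>2)" for c
    by (rule wnorm_square) (rule assms)
  ultimately show ?thesis by simp
qed

text \<open>The leaves of the tree are the \<open>x c\<close>, of norm at most 1. Each node is half
  the difference of two neighbouring block means, so separation keeps its image at norm at least
  \<open>\<theta> / 2\<close>. Thus each of the \<open>m\<close> levels contributes at least
  \<open>(\<theta> / 2)^2\<close>, against a total of at most \<open>C^2\<close>.\<close>

lemma gamma_haar_ge_of_ladder:
  fixes T :: "'a::real_normed_vector \<Rightarrow> 'b::real_normed_vector"
  assumes T: "bounded_linear T" and th: "0 \<le> \<theta>" and lad: "ladder T \<theta> (2 ^ m)"
  shows "\<theta> / 2 * sqrt m \<le> gamma_haar m T"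
  unfolding ideal_norms_eq_Inf
proof (rule cInf_greatest[OF haar_bounds_nonempty(2)[OF T]])
  fix C assume C: "C \<in> gamma_haar_bounds m T"
  interpret T: bounded_linear T by fact
  obtain I :: "real set" and w and x :: "nat \<Rightarrow> real \<Rightarrow> 'a" where w0: "\<forall>a\<in>I. 0 \<le> w a"
    and x1: "\<forall>j<2 ^ m. wnorm w I (x j) \<le> 1"
    and sep: "\<forall>k\<le>2 ^ m. \<forall>\<alpha>. (\<forall>j<2 ^ m. 0 \<le> \<alpha> j) \<longrightarrow> sum \<alpha> {..<k} = 1 \<longrightarrow> sum \<alpha> {k..<2 ^ m} = 1 \<longrightarrow>
        \<theta> \<le> wnorm w I (\<lambda>a. T ((\<Sum>j<k. \<alpha> j *\<^sub>R x j a) - (\<Sum>j=k..<2 ^ m. \<alpha> j *\<^sub>R x j a)))"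
    using lad unfolding ladder_def by (elim exE conjE)
  have w: "\<And>a. a \<in> I \<Longrightarrow> 0 \<le> w a" using w0 by blast
  \<comment> \<open>The mean of block \<open>i\<close> at level \<open>k\<close>; at level
    \<open>m\<close> the blocks are single elements.\<close>
  define A where "A k i a = (1 / 2 ^ (m - k)) *\<^sub>R (\<Sum>j=i * 2 ^ (m - k)..<Suc i * 2 ^ (m - k). x j a)" for k i a
  define z where "z a k i = (1 / 2) *\<^sub>R (A (Suc k) (2 * i) a - A (Suc k) (2 * i + 1) a)" for a k i
  have A_split: "A k i a = (1 / 2) *\<^sub>R (A (Suc k) (2 * i) a + A (Suc k) (2 * i + 1) a)" if "k < m" for k i a
  proof -
    define h :: nat where "h = 2 ^ (m - Suc k)"
    have h: "2 ^ (m - k) = 2 * h" "(2::real) ^ (m - k) = 2 * 2 ^ (m - Suc k)"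
      unfolding h_def using that by (simp_all flip: power_Suc add: Suc_diff_Suc)
    have "(\<Sum>j=i * (2 * h)..<Suc i * (2 * h). x j a) = (\<Sum>j=2 * i * h..<Suc (2 * i) * h. x j a) + (\<Sum>j=(2 * i + 1) * h..<Suc (2 * i + 1) * h. x j a)"
      using sum.atLeastLessThan_concat[of "2 * i * h" "Suc (2 * i) * h" "Suc (2 * i + 1) * h" "\<lambda>j. x j a"]
      by (simp add: algebra_simps)
    then show ?thesis unfolding A_def h h_def[symmetric] by (simp add: scaleR_add_right)
  qed
  \<comment> \<open>Adding or subtracting the half difference leads from the mean of a block to the
    mean of its left or right half, so the partial sums along a branch telescope to block
    means.\<close>
  have partial: "A 0 0 a + (\<Sum>k<n. alt (c div 2 ^ (m - Suc k)) *\<^sub>R z a k (c div 2 ^ (m - k))) = A n (c div 2 ^ (m - n)) a"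
    if "n \<le> m" "c < 2 ^ m" for n c a
    using that(1)
  proof (induction n)
    case 0
    then show ?case using that(2) by simp
  next
    case (Suc n)
    define c' where "c' = c div 2 ^ (m - Suc n)"
    have "2 ^ (m - n) = 2 ^ (m - Suc n) * (2::nat)"
      using Suc.prems by (simp flip: power_Suc2 add: Suc_diff_Suc)
    then have c2: "c div 2 ^ (m - n) = c' div 2" unfolding c'_def by (simp add: div_mult2_eq)
    have "A n (c' div 2) a + alt c' *\<^sub>R z a n (c' div 2) = A (Suc n) c' a"
    proof (cases "even c'")
      case True
      then have "2 * (c' div 2) = c'" by simp
      then show ?thesis using A_split[of n "c' div 2" a] Suc.prems True unfolding z_def alt_def
        by (simp add: scaleR_add_right scaleR_diff_right flip: scaleR_left.add)
    next
      case False
      then have "2 * (c' div 2) + 1 = c'" by simp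
      then show ?thesis using A_split[of n "c' div 2" a] Suc.prems False unfolding z_def alt_def
        by (simp add: scaleR_add_right scaleR_diff_right flip: scaleR_left.add)
    qed
    then show ?case using Suc c2 unfolding c'_def by (simp flip: add.assoc)
  qed
  have tree: "tree_sum m (A 0 0 a) (z a) c = x c a" if "c < 2 ^ m" for c a
    using partial[OF order_refl that, of a] unfolding tree_sum_def by (simp add: A_def)
  have low: "\<theta> / 2 \<le> wnorm w I (\<lambda>a. T (z a k i))" if k: "k < m" and i: "i < 2 ^ k" for k i
  proof -
    define h :: nat where "h = 2 ^ (m - Suc k)"
    have h0: "0 < h" unfolding h_def by simp
    define s where "s = (2 * i + 1) * h"
    \<comment> \<open>Uniform weight on two adjacent blocks of length \<open>h\<close>, of mass 1 on
      either side of their common boundary \<open>s\<close>; the ladder cut at \<open>s\<close> then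
      compares the two means.\<close>
    define \<alpha> where "\<alpha> j = (if j \<in> {2 * i * h..<(2 * i + 2) * h} then 1 / real h else 0)" for j
    have "(2 * i + 2) * h \<le> 2 ^ m"
    proof -
      have "(2 * i + 2) * h \<le> (2 * 2 ^ k) * h" using i by (intro mult_right_mono) auto
      also have "\<dots> = 2 ^ m" unfolding h_def using k by (simp flip: power_Suc power_add)
      finally show ?thesis .
    qed
    then have sets: "{..<s} \<inter> {2 * i * h..<(2 * i + 2) * h} = {2 * i * h..<Suc (2 * i) * h}"
      "{s..<2 ^ m} \<inter> {2 * i * h..<(2 * i + 2) * h} = {Suc (2 * i) * h..<Suc (Suc (2 * i)) * h}" and s: "s \<le> 2 ^ m"
      unfolding s_def by (auto simp: algebra_simps)
    have restr: "(\<Sum>j\<in>S. \<alpha> j *\<^sub>R f j) = (1 / real h) *\<^sub>R (\<Sum>j\<in>S \<inter> {2 * i * h..<(2 * i + 2) * h}. f j)"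
      if "finite S" for S and f :: "nat \<Rightarrow> 'c::real_vector"
      unfolding scaleR_sum_right using that
      by (intro sum.mono_neutral_cong_right) (auto simp: \<alpha>_def)
    have "sum \<alpha> {..<s} = 1" "sum \<alpha> {s..<2 ^ m} = 1"
      using restr[of "{..<s}" "\<lambda>_. 1::real"] restr[of "{s..<2 ^ m}" "\<lambda>_. 1::real"] h0 unfolding sets by simp_all
    moreover have "\<forall>j<2 ^ m. 0 \<le> \<alpha> j" unfolding \<alpha>_def by simp
    ultimately have "\<theta> \<le> wnorm w I (\<lambda>a. T ((\<Sum>j<s. \<alpha> j *\<^sub>R x j a) - (\<Sum>j=s..<2 ^ m. \<alpha> j *\<^sub>R x j a)))"
      using sep s by blast
    also have "(\<lambda>a. T ((\<Sum>j<s. \<alpha> j *\<^sub>R x j a) - (\<Sum>j=s..<2 ^ m. \<alpha> j *\<^sub>R x j a))) = (\<lambda>a. 2 *\<^sub>R T (z a k i))"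
    proof
      fix a
      have "(\<Sum>j<s. \<alpha> j *\<^sub>R x j a) = A (Suc k) (2 * i) a" "(\<Sum>j=s..<2 ^ m. \<alpha> j *\<^sub>R x j a) = A (Suc k) (2 * i + 1) a"
        unfolding restr[OF finite_lessThan] restr[OF finite_atLeastLessThan] sets unfolding A_def h_def by simp_all
      then show "T ((\<Sum>j<s. \<alpha> j *\<^sub>R x j a) - (\<Sum>j=s..<2 ^ m. \<alpha> j *\<^sub>R x j a)) = 2 *\<^sub>R T (z a k i)"
        unfolding z_def by (simp add: T.scaleR)
    qed
    finally show ?thesis by (simp add: wnorm_scaleR)
  qed
  have C0: "0 \<le> C" using C unfolding gamma_haar_bounds_def by simp
  have "(\<theta> / 2)\<^sup>2 * m = (\<Sum>k<m. (\<Sum>i<(2::nat) ^ k. (\<theta> / 2)\<^sup>2) / 2 ^ k)" by simp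
  also have "\<dots> \<le> (\<Sum>k<m. (\<Sum>i<2 ^ k. (wnorm w I (\<lambda>a. T (z a k i)))\<^sup>2) / 2 ^ k)"
    using low th by (intro sum_mono divide_right_mono power_mono) auto
  also have "\<dots> = (\<Sum>k<m. (\<Sum>a\<in>I. w a * ((\<Sum>i<2 ^ k. (norm (T (z a k i)))\<^sup>2) / 2 ^ k)))"
    using sum_norm_eq_wnorm[OF w, where f="\<lambda>i a. T (z a _ i)"] by (simp flip: sum_divide_distrib)
  also have "\<dots> = (\<Sum>a\<in>I. w a * (\<Sum>k<m. (\<Sum>i<2 ^ k. (norm (T (z a k i)))\<^sup>2) / 2 ^ k))"
    unfolding sum_distrib_left by (rule sum.swap)
  also have "\<dots> \<le> (\<Sum>a\<in>I. w a * (C\<^sup>2 * ((\<Sum>c<2 ^ m. (norm (x c a))\<^sup>2) / 2 ^ m)))"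
  proof (intro sum_mono mult_left_mono w)
    fix a
    have "(norm (T (A 0 0 a)))\<^sup>2 + (\<Sum>k<m. (\<Sum>i<2 ^ k. (norm (T (z a k i)))\<^sup>2) / 2 ^ k)
      \<le> C\<^sup>2 * ((\<Sum>c<2 ^ m. (norm (tree_sum m (A 0 0 a) (z a) c))\<^sup>2) / 2 ^ m)"
      by (rule gamma_haar_bounds_tree[OF T C])
    then have "(norm (T (A 0 0 a)))\<^sup>2 + (\<Sum>k<m. (\<Sum>i<2 ^ k. (norm (T (z a k i)))\<^sup>2) / 2 ^ k)
      \<le> C\<^sup>2 * ((\<Sum>c<2 ^ m. (norm (x c a))\<^sup>2) / 2 ^ m)"
      using tree by simp
    \<comment> \<open>The nonnegative contribution of the root, the overall mean, is
      dropped.\<close>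
    then show "(\<Sum>k<m. (\<Sum>i<2 ^ k. (norm (T (z a k i)))\<^sup>2) / 2 ^ k) \<le> C\<^sup>2 * ((\<Sum>c<2 ^ m. (norm (x c a))\<^sup>2) / 2 ^ m)"
      by (smt (verit) zero_le_power2)
  qed
  also have "\<dots> = C\<^sup>2 * ((\<Sum>a\<in>I. w a * (\<Sum>c<2 ^ m. (norm (x c a))\<^sup>2)) / 2 ^ m)"
    by (simp add: sum_distrib_left sum_divide_distrib mult_ac)
  also have "\<dots> = C\<^sup>2 * ((\<Sum>c<2 ^ m. (wnorm w I (x c))\<^sup>2) / 2 ^ m)"
    by (simp add: sum_norm_eq_wnorm[OF w])
  also have "\<dots> \<le> C\<^sup>2 * ((\<Sum>c<(2::nat) ^ m. 1) / 2 ^ m)"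
    using x1 wnorm_nonneg[OF w] by (intro mult_left_mono divide_right_mono sum_mono) (auto intro!: power_le_one)
  finally have "(\<theta> / 2)\<^sup>2 * m \<le> C\<^sup>2" by simp
  moreover have "(\<theta> / 2 * sqrt m)\<^sup>2 = (\<theta> / 2)\<^sup>2 * m" by (simp only: power_mult_distrib) simp
  ultimately have "(\<theta> / 2 * sqrt m)\<^sup>2 \<le> C\<^sup>2" by simp
  then show "\<theta> / 2 * sqrt m \<le> C" using C0 by (rule power2_le_imp_le)
qed


text \<open>Separation speaks of combinations of mass 1. For unequal masses the heavier combination
  is scaled down to the lighter mass; the surplus has mass equal to the difference, and its image
  costs at most \<open>K\<close> times as much.\<close>

lemma ladder_unnormalized:
  fixes T :: "'a::real_normed_vector \<Rightarrow> 'b::real_normed_vector" and x :: "nat \<Rightarrow> 'i \<Rightarrow> 'a"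
  assumes T: "bounded_linear T" and K: "0 \<le> K" "\<And>x. norm (T x) \<le> K * norm x"
    and w: "\<And>a. a \<in> I \<Longrightarrow> 0 \<le> w a" and x1: "\<And>j. j < n \<Longrightarrow> wnorm w I (x j) \<le> 1"
    and sep: "\<And>\<alpha>. (\<And>j. j < n \<Longrightarrow> 0 \<le> \<alpha> j) \<Longrightarrow> sum \<alpha> {..<k} = 1 \<Longrightarrow> sum \<alpha> {k..<n} = 1 \<Longrightarrow>
        \<theta> \<le> wnorm w I (\<lambda>a. T ((\<Sum>j<k. \<alpha> j *\<^sub>R x j a) - (\<Sum>j=k..<n. \<alpha> j *\<^sub>R x j a)))"
    and k: "k \<le> n" and al: "\<And>j. j < n \<Longrightarrow> 0 \<le> \<alpha> j"
  shows "\<theta> * min (sum \<alpha> {..<k}) (sum \<alpha> {k..<n}) - K * \<bar>sum \<alpha> {k..<n} - sum \<alpha> {..<k}\<bar>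
    \<le> wnorm w I (\<lambda>a. T ((\<Sum>j<k. \<alpha> j *\<^sub>R x j a) - (\<Sum>j=k..<n. \<alpha> j *\<^sub>R x j a)))"
proof -
  interpret T: bounded_linear T by fact
  define A where "A = sum \<alpha> {..<k}"
  define B where "B = sum \<alpha> {k..<n}"
  define p where "p a = (\<Sum>j<k. \<alpha> j *\<^sub>R x j a)" for a
  define q where "q a = (\<Sum>j=k..<n. \<alpha> j *\<^sub>R x j a)" for a
  have A0: "0 \<le> A" unfolding A_def using al k by (intro sum_nonneg) auto
  have B0: "0 \<le> B" unfolding B_def using al k by (intro sum_nonneg) auto
  have TW: "wnorm w I (\<lambda>a. T (u a)) \<le> K * wnorm w I u" for u
    using K w by (intro wnorm_bounded_linear) auto
  have conv: "wnorm w I (\<lambda>a. \<Sum>j\<in>J. \<alpha> j *\<^sub>R x j a) \<le> sum \<alpha> J" if "J \<subseteq> {..<n}" for J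
  proof -
    have "wnorm w I (\<lambda>a. \<Sum>j\<in>J. \<alpha> j *\<^sub>R x j a) \<le> (\<Sum>j\<in>J. wnorm w I (\<lambda>a. \<alpha> j *\<^sub>R x j a))"
      by (rule wnorm_sum) (rule w)
    also have "\<dots> \<le> sum \<alpha> J"
      using that al x1 by (intro sum_mono) (auto simp: wnorm_scaleR subset_iff intro!: mult_left_le)
    finally show ?thesis .
  qed
  have p: "wnorm w I p \<le> A" unfolding p_def[abs_def] A_def using k by (intro conv) auto
  have q: "wnorm w I q \<le> B" unfolding q_def[abs_def] B_def using k by (intro conv) auto
  have N0: "0 \<le> wnorm w I (\<lambda>a. T (p a - q a))" by (rule wnorm_nonneg) (rule w)
  have "\<theta> * min A B - K * \<bar>B - A\<bar> \<le> wnorm w I (\<lambda>a. T (p a - q a))"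
  proof (cases "0 < A \<and> 0 < B")
    \<comment> \<open>If one mass is zero, the left side is at most 0.\<close>
    case False
    then have "min A B = 0" using A0 B0 by auto
    moreover have "0 \<le> K * \<bar>B - A\<bar>" using K by simp
    ultimately show ?thesis using N0 by simp
  next
    case True
    define \<beta> where "\<beta> j = (if j < k then \<alpha> j / A else \<alpha> j / B)" for j
    have th: "\<theta> \<le> wnorm w I (\<lambda>a. T ((1 / A) *\<^sub>R p a - (1 / B) *\<^sub>R q a))"
    proof -
      have "\<theta> \<le> wnorm w I (\<lambda>a. T ((\<Sum>j<k. \<beta> j *\<^sub>R x j a) - (\<Sum>j=k..<n. \<beta> j *\<^sub>R x j a)))"
      proof (rule sep)
        show "0 \<le> \<beta> j" if "j < n" for j unfolding \<beta>_def using al[OF that] True by simp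
        show "sum \<beta> {..<k} = 1" using True unfolding \<beta>_def A_def by (simp flip: sum_divide_distrib)
        show "sum \<beta> {k..<n} = 1" using True unfolding \<beta>_def B_def by (simp flip: sum_divide_distrib)
      qed
      moreover have "(\<Sum>j<k. \<beta> j *\<^sub>R x j a) = (1 / A) *\<^sub>R p a" "(\<Sum>j=k..<n. \<beta> j *\<^sub>R x j a) = (1 / B) *\<^sub>R q a" for a
        unfolding \<beta>_def p_def q_def scaleR_sum_right by (auto intro!: sum.cong)
      ultimately show ?thesis by simp
    qed
    let ?P = "wnorm w I (\<lambda>a. T ((1 / A) *\<^sub>R p a - (1 / B) *\<^sub>R q a))"
    \<comment> \<open>Used with \<open>s\<close> the smaller mass and \<open>r\<close> the surplus
      of the heavier side, up to sign.\<close>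
    have main: "s * ?P - wnorm w I (\<lambda>a. T (r a)) \<le> wnorm w I (\<lambda>a. T (p a - q a))"
      if "0 \<le> s" "\<And>a. p a - q a = s *\<^sub>R ((1 / A) *\<^sub>R p a - (1 / B) *\<^sub>R q a) - r a" for s r
      using wnorm_diff_ge[of I w "\<lambda>a. T (s *\<^sub>R ((1 / A) *\<^sub>R p a - (1 / B) *\<^sub>R q a))" "\<lambda>a. T (r a)"] w that
      by (simp add: T.diff T.scaleR wnorm_scaleR flip: scaleR_diff_right)
    show ?thesis
    proof (cases "A \<le> B")
      case le: True
      define r where "r a = ((B - A) / B) *\<^sub>R q a" for a
      have "A * ?P - wnorm w I (\<lambda>a. T (r a)) \<le> wnorm w I (\<lambda>a. T (p a - q a))"
      proof (rule main)
        fix a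
        have "((B - A) / B) *\<^sub>R q a = q a - (A / B) *\<^sub>R q a"
          using True by (simp add: diff_divide_distrib scaleR_diff_left)
        then show "p a - q a = A *\<^sub>R ((1 / A) *\<^sub>R p a - (1 / B) *\<^sub>R q a) - r a"
          unfolding r_def using True by (simp add: scaleR_diff_right)
      qed (use A0 in simp)
      moreover have "wnorm w I (\<lambda>a. T (r a)) \<le> K * (B - A)"
      proof -
        have "wnorm w I r = (B - A) / B * wnorm w I q"
          unfolding r_def[abs_def] wnorm_scaleR using True le by simp
        also have "\<dots> \<le> (B - A) / B * B" using q True le by (intro mult_left_mono) auto
        also have "\<dots> = B - A" using True by simp
        finally have "K * wnorm w I r \<le> K * (B - A)" using K by (intro mult_left_mono)
        then show ?thesis using TW[of r] by simp
      qed
      moreover have "A * \<theta> \<le> A * ?P" using th A0 by (rule mult_left_mono)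
      ultimately show ?thesis using le by (simp add: min_def mult.commute)
    next
      case False
      define r where "r a = - (((A - B) / A) *\<^sub>R p a)" for a
      have "B * ?P - wnorm w I (\<lambda>a. T (r a)) \<le> wnorm w I (\<lambda>a. T (p a - q a))"
      proof (rule main)
        fix a
        have "((A - B) / A) *\<^sub>R p a = p a - (B / A) *\<^sub>R p a"
          using True by (simp add: diff_divide_distrib scaleR_diff_left)
        then show "p a - q a = B *\<^sub>R ((1 / A) *\<^sub>R p a - (1 / B) *\<^sub>R q a) - r a"
          unfolding r_def using True by (simp add: scaleR_diff_right)
      qed (use B0 in simp)
      moreover have "wnorm w I (\<lambda>a. T (r a)) \<le> K * (A - B)"
      proof -
        have "wnorm w I r = wnorm w I (\<lambda>a. ((A - B) / A) *\<^sub>R p a)"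
          unfolding r_def by (rule wnorm_cong) simp
        also have "\<dots> = (A - B) / A * wnorm w I p"
          unfolding wnorm_scaleR using True False by simp
        also have "\<dots> \<le> (A - B) / A * A" using p True False by (intro mult_left_mono) auto
        also have "\<dots> = A - B" using True by simp
        finally have "K * wnorm w I r \<le> K * (A - B)" using K by (intro mult_left_mono)
        then show ?thesis using TW[of r] by simp
      qed
      moreover have "B * \<theta> \<le> B * ?P" using th B0 by (rule mult_left_mono)
      ultimately show ?thesis using False by (simp add: min_def mult.commute)
    qed
  qed
  then show ?thesis unfolding A_def B_def p_def q_def .
qed

text \<open>The coefficient of a node is the element at the midpoint of its interval. On cell \<open>c\<close> it gets the sign \<open>+\<close>
  if the midpoint lies after \<open>c\<close> and \<open>-\<close> otherwise; the numbers of the two signs differ by about \<open>\<surd>m\<close> only.\<close>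

lemma tau_haar_ge_of_ladder:
  fixes T :: "'a::real_normed_vector \<Rightarrow> 'b::real_normed_vector"
  assumes T: "bounded_linear T" and K: "0 \<le> K" "\<And>x. norm (T x) \<le> K * norm x"
    and th: "0 \<le> \<theta>" and lad: "ladder T \<theta> (2 ^ m)"
  shows "\<theta> / 2 * m - (\<theta> / 2 + K) * sqrt m \<le> tau_haar m T * sqrt m"
proof -
  interpret T: bounded_linear T by fact
  obtain I :: "real set" and w and x :: "nat \<Rightarrow> real \<Rightarrow> 'a" where w0: "\<forall>a\<in>I. 0 \<le> w a"
    and x1: "\<forall>j<2 ^ m. wnorm w I (x j) \<le> 1"
    and sep: "\<forall>k\<le>2 ^ m. \<forall>\<alpha>. (\<forall>j<2 ^ m. 0 \<le> \<alpha> j) \<longrightarrow> sum \<alpha> {..<k} = 1 \<longrightarrow> sum \<alpha> {k..<2 ^ m} = 1 \<longrightarrow>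
        \<theta> \<le> wnorm w I (\<lambda>a. T ((\<Sum>j<k. \<alpha> j *\<^sub>R x j a) - (\<Sum>j=k..<2 ^ m. \<alpha> j *\<^sub>R x j a)))"
    using lad unfolding ladder_def by (elim exE conjE)
  have w: "\<And>a. a \<in> I \<Longrightarrow> 0 \<le> w a" using w0 by blast
  \<comment> \<open>The first level-\<open>m\<close> cell in the right half of the interval of node
    \<open>i\<close> at level \<open>k\<close>.\<close>
  define mid :: "nat \<Rightarrow> nat \<Rightarrow> nat" where "mid k i = (2 * i + 1) * 2 ^ (m - Suc k)" for k i
  define z where "z a k i = x (mid k i) a" for a k i
  define N where "N c = wnorm w I (\<lambda>a. T (tree_sum m 0 (z a) c))" for c
  \<comment> \<open>The excess of plus signs over minus signs along the branch to \<open>c\<close>: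
    a sum of Rademacher functions.\<close>
  define D where "D c = tree_sum m 0 (\<lambda>_ _. 1::real) c" for c
  have mid_less: "mid k i < 2 ^ m" if "k < m" "i < 2 ^ k" for k i
  proof -
    have "mid k i < (2 * 2 ^ k) * 2 ^ (m - Suc k)" unfolding mid_def using that(2) by (intro mult_strict_right_mono) auto
    also have "\<dots> = 2 ^ m" using that by (simp flip: power_Suc power_add)
    finally show ?thesis .
  qed
  \<comment> \<open>With \<open>A\<close> midpoints up to \<open>c\<close> and \<open>B\<close>
    after it, \<open>A + B = m\<close> and \<open>B - A = D c\<close>. So the smaller mass is
    \<open>(m - \<bar>D c\<bar>) / 2\<close>, and \<open>ladder_unnormalized\<close> gives the
    estimate.\<close>
  have Nlow: "\<theta> / 2 * m - (\<theta> / 2 + K) * \<bar>D c\<bar> \<le> N c" if c: "c < 2 ^ m" for c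
  proof -
    define p where "p k = mid k (c div 2 ^ (m - k))" for k
    have node: "c div 2 ^ (m - k) < 2 ^ k" if "k < m" for k
      using c that by (intro less_mult_imp_div_less) (simp flip: power_add)
    have p_less: "p k < 2 ^ m" if "k < m" for k unfolding p_def using mid_less node that by blast
    \<comment> \<open>A midpoint equal to \<open>c\<close> gets the sign \<open>-\<close>, because
      it is the first cell of a right half; hence the cut at \<open>Suc c\<close> rather than
      \<open>c\<close>.\<close>
    have alt: "alt (c div 2 ^ (m - Suc k)) = (if p k < Suc c then - 1 else 1)" if "k < m" for k
    proof -
      define h :: nat where "h = 2 ^ (m - Suc k)"
      define b where "b = c div h"
      have h0: "0 < h" unfolding h_def by simp
      have "2 ^ (m - k) = h * 2" unfolding h_def using that by (simp flip: power_Suc2 add: Suc_diff_Suc)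
      then have pk: "p k = (2 * (b div 2) + 1) * h" unfolding p_def mid_def b_def h_def[symmetric] by (simp add: div_mult2_eq)
      have bc: "b * h \<le> c" "c < (b + 1) * h" unfolding b_def using h0
        by (simp_all add: div_times_less_eq_dividend dividend_less_div_times)
      show ?thesis
      proof (cases "even b")
        case True
        then have "2 * (b div 2) = b" by simp
        then have "p k = (b + 1) * h" using pk by simp
        then have "\<not> p k < Suc c" using bc by simp
        then show ?thesis using True unfolding alt_def b_def h_def by simp
      next
        case False
        then have "2 * (b div 2) + 1 = b" by simp
        then have "p k = b * h" using pk by simp
        then have "p k < Suc c" using bc by simp
        then show ?thesis using False unfolding alt_def b_def h_def by simp
      qed
    qed
    \<comment> \<open>The number of levels whose midpoint is \<open>j\<close>; coinciding midpoints
      would simply add up.\<close>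
    define \<alpha> :: "nat \<Rightarrow> real" where "\<alpha> j = (\<Sum>k<m. if p k = j then 1 else 0)" for j
    have al0: "0 \<le> \<alpha> j" for j unfolding \<alpha>_def by (simp add: sum_nonneg)
    have comb: "(\<Sum>j\<in>J. \<alpha> j *\<^sub>R f j) = (\<Sum>k<m. if p k \<in> J then f (p k) else 0)" if "finite J"
      for J and f :: "nat \<Rightarrow> 'c::real_vector"
    proof -
      have "(\<Sum>j\<in>J. \<alpha> j *\<^sub>R f j) = (\<Sum>k<m. \<Sum>j\<in>J. (if p k = j then 1 else 0) *\<^sub>R f j)"
        unfolding \<alpha>_def scaleR_sum_left by (rule sum.swap)
      also have "\<dots> = (\<Sum>k<m. if p k \<in> J then f (p k) else 0)"
      proof (rule sum.cong)
        fix k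
        have "(\<Sum>j\<in>J. (if p k = j then 1 else 0) *\<^sub>R f j) = (\<Sum>j\<in>J. if p k = j then f j else 0)"
          by (rule sum.cong) auto
        then show "(\<Sum>j\<in>J. (if p k = j then 1 else 0) *\<^sub>R f j) = (if p k \<in> J then f (p k) else 0)"
          using that by simp
      qed simp
      finally show ?thesis .
    qed
    define A where "A = sum \<alpha> {..<Suc c}"
    define B where "B = sum \<alpha> {Suc c..<2 ^ m}"
    have A: "A = (\<Sum>k<m. if p k < Suc c then 1 else 0)"
      unfolding A_def using comb[of "{..<Suc c}" "\<lambda>_. 1::real"] by (simp only: real_scaleR_def mult_1_right) simp
    have B: "B = (\<Sum>k<m. if p k < Suc c then 0 else 1)"
    proof -
      have "B = (\<Sum>k<m. if p k \<in> {Suc c..<2 ^ m} then 1 else 0)"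
        unfolding B_def using comb[of "{Suc c..<2 ^ m}" "\<lambda>_. 1::real"] by simp
      also have "\<dots> = (\<Sum>k<m. if p k < Suc c then 0 else 1)" using p_less by (intro sum.cong) auto
      finally show ?thesis .
    qed
    have AB: "A + B = m"
    proof -
      have "A + B = (\<Sum>k<m. 1)" unfolding A B sum.distrib[symmetric] by (intro sum.cong) auto
      then show ?thesis by simp
    qed
    have BA: "B - A = D c"
    proof -
      have "D c = (\<Sum>k<m. alt (c div 2 ^ (m - Suc k)))" unfolding D_def tree_sum_def by simp
      also have "\<dots> = B - A" unfolding A B sum_subtractf[symmetric] by (intro sum.cong) (auto simp: alt)
      finally show ?thesis ..
    qed
    have tree: "tree_sum m 0 (z a) c = - ((\<Sum>j<Suc c. \<alpha> j *\<^sub>R x j a) - (\<Sum>j=Suc c..<2 ^ m. \<alpha> j *\<^sub>R x j a))" for a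
    proof -
      have "tree_sum m 0 (z a) c = (\<Sum>k<m. alt (c div 2 ^ (m - Suc k)) *\<^sub>R x (p k) a)"
        unfolding tree_sum_def z_def p_def by simp
      also have "\<dots> = (\<Sum>k<m. (if p k \<in> {Suc c..<2 ^ m} then x (p k) a else 0) - (if p k \<in> {..<Suc c} then x (p k) a else 0))"
        using p_less by (intro sum.cong) (auto simp: alt)
      also have "\<dots> = (\<Sum>j=Suc c..<2 ^ m. \<alpha> j *\<^sub>R x j a) - (\<Sum>j<Suc c. \<alpha> j *\<^sub>R x j a)"
        unfolding sum_subtractf using comb[of "{Suc c..<2 ^ m}" "\<lambda>j. x j a"] comb[of "{..<Suc c}" "\<lambda>j. x j a"] by (simp only: finite_atLeastLessThan finite_lessThan)
      finally show ?thesis by simp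
    qed
    have "\<theta> * min A B - K * \<bar>B - A\<bar>
      \<le> wnorm w I (\<lambda>a. T ((\<Sum>j<Suc c. \<alpha> j *\<^sub>R x j a) - (\<Sum>j=Suc c..<2 ^ m. \<alpha> j *\<^sub>R x j a)))"
      unfolding A_def B_def
    proof (rule ladder_unnormalized[OF T K w])
      show "Suc c \<le> 2 ^ m" using c by simp
      then show "\<theta> \<le> wnorm w I (\<lambda>a. T ((\<Sum>j<Suc c. \<alpha> j *\<^sub>R x j a) - (\<Sum>j=Suc c..<2 ^ m. \<alpha> j *\<^sub>R x j a)))"
        if "\<And>j. j < 2 ^ m \<Longrightarrow> 0 \<le> \<alpha> j" "sum \<alpha> {..<Suc c} = 1" "sum \<alpha> {Suc c..<2 ^ m} = 1" for \<alpha>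
        using sep that by blast
    qed (use x1 al0 in auto)
    also have "\<dots> = N c"
      unfolding N_def tree by (rule wnorm_cong) (simp add: T.neg T.diff norm_minus_commute)
    finally have "\<theta> * min A B - K * \<bar>D c\<bar> \<le> N c" unfolding BA .
    moreover have "min A B = (m - \<bar>D c\<bar>) / 2" unfolding BA[symmetric] AB[symmetric] by (simp add: min_def)
    ultimately show ?thesis by (simp add: algebra_simps)
  qed
  have sqrt_avg: "(\<Sum>c<2 ^ m. \<bar>f c\<bar>) \<le> sqrt (\<Sum>c<2 ^ m. (f c)\<^sup>2) * sqrt (2 ^ m)" for f :: "nat \<Rightarrow> real"
  proof -
    have "(\<Sum>c<2 ^ m. \<bar>f c\<bar>)\<^sup>2 \<le> (\<Sum>c<2 ^ m. \<bar>f c\<bar>\<^sup>2) * card {..<(2::nat) ^ m}"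
      by (rule sum_squared_le_sum_of_squares)
    then have "(\<Sum>c<2 ^ m. \<bar>f c\<bar>) \<le> sqrt ((\<Sum>c<2 ^ m. (f c)\<^sup>2) * 2 ^ m)" by (intro real_le_rsqrt) simp
    then show ?thesis by (simp add: real_sqrt_mult)
  qed
  have sq: "sqrt (2 ^ m) * sqrt (2 ^ m) = (2 ^ m :: real)" by simp
  \<comment> \<open>By Cauchy-Schwarz and the second moment of the Rademacher sum, the mean
    imbalance is at most \<open>\<surd>m\<close>.\<close>
  have Dsum: "(\<Sum>c<2 ^ m. \<bar>D c\<bar>) \<le> sqrt m * 2 ^ m"
    using sqrt_avg[of D] sum_alt_squares[of m] sq unfolding D_def by (simp add: real_sqrt_mult mult.assoc)
  \<comment> \<open>The mean of \<open>N\<close> over all cells is bounded below by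
    \<open>Nlow\<close> and \<open>Dsum\<close>, and above by the Haar inequality: the node elements
    have norm at most 1, so the \<open>m\<close> levels contribute at most \<open>m\<close> to its
    right side.\<close>
  have bound: "\<theta> / 2 * m - (\<theta> / 2 + K) * sqrt m \<le> C * sqrt m" if C: "C \<in> tau_haar_bounds m T" for C
  proof -
    have C0: "0 \<le> C" using C unfolding tau_haar_bounds_def by simp
    have "(\<Sum>c<2 ^ m. (N c)\<^sup>2) / 2 ^ m = (\<Sum>a\<in>I. w a * (\<Sum>c<2 ^ m. (norm (T (tree_sum m 0 (z a) c)))\<^sup>2)) / 2 ^ m"
      unfolding N_def using sum_norm_eq_wnorm[OF w, where f="\<lambda>c a. T (tree_sum m 0 (z a) c)"] by simp
    also have "\<dots> = (\<Sum>a\<in>I. w a * ((\<Sum>c<2 ^ m. (norm (T (tree_sum m 0 (z a) c)))\<^sup>2) / 2 ^ m))"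
      by (simp add: sum_divide_distrib[of _ I])
    also have "\<dots> \<le> (\<Sum>a\<in>I. w a * (C\<^sup>2 * (\<Sum>k<m. (\<Sum>i<2 ^ k. (norm (z a k i))\<^sup>2) / 2 ^ k)))"
    proof (intro sum_mono mult_left_mono w)
      fix a
      show "(\<Sum>c<2 ^ m. (norm (T (tree_sum m 0 (z a) c)))\<^sup>2) / 2 ^ m \<le> C\<^sup>2 * (\<Sum>k<m. (\<Sum>i<2 ^ k. (norm (z a k i))\<^sup>2) / 2 ^ k)"
        using tau_haar_bounds_tree[OF T C, of 0 "z a"] by simp
    qed
    also have "\<dots> = C\<^sup>2 * (\<Sum>a\<in>I. \<Sum>k<m. w a * ((\<Sum>i<2 ^ k. (norm (z a k i))\<^sup>2) / 2 ^ k))"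
      by (simp add: sum_distrib_left mult_ac)
    also have "\<dots> = C\<^sup>2 * (\<Sum>k<m. (\<Sum>a\<in>I. w a * (\<Sum>i<2 ^ k. (norm (x (mid k i) a))\<^sup>2)) / 2 ^ k)"
      unfolding z_def by (subst sum.swap) (simp add: sum_divide_distrib[of _ I])
    also have "\<dots> = C\<^sup>2 * (\<Sum>k<m. (\<Sum>i<2 ^ k. (wnorm w I (x (mid k i)))\<^sup>2) / 2 ^ k)"
    proof -
      have "(\<Sum>a\<in>I. w a * (\<Sum>i<2 ^ k. (norm (x (mid k i) a))\<^sup>2)) = (\<Sum>i<2 ^ k. (wnorm w I (x (mid k i)))\<^sup>2)" for k
        by (rule sum_norm_eq_wnorm) (rule w)
      then show ?thesis by simp
    qed
    also have "\<dots> \<le> C\<^sup>2 * (\<Sum>k<m. (\<Sum>i<(2::nat) ^ k. 1) / 2 ^ k)"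
      using x1 mid_less wnorm_nonneg[OF w] by (intro mult_left_mono sum_mono divide_right_mono) (auto intro!: power_le_one)
    also have "\<dots> = C\<^sup>2 * m" by simp
    finally have "(\<Sum>c<2 ^ m. (N c)\<^sup>2) \<le> C\<^sup>2 * m * 2 ^ m" by (simp add: field_simps)
    then have "sqrt (\<Sum>c<2 ^ m. (N c)\<^sup>2) \<le> sqrt (C\<^sup>2 * m * 2 ^ m)" by (rule real_sqrt_le_mono)
    then have "sqrt (\<Sum>c<2 ^ m. (N c)\<^sup>2) \<le> C * sqrt m * sqrt (2 ^ m)" using C0 by (simp add: real_sqrt_mult)
    then have "sqrt (\<Sum>c<2 ^ m. (N c)\<^sup>2) * sqrt (2 ^ m) \<le> C * sqrt m * sqrt (2 ^ m) * sqrt (2 ^ m)"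
      by (rule mult_right_mono) simp
    then have up: "(\<Sum>c<2 ^ m. N c) \<le> C * sqrt m * 2 ^ m"
    proof -
      have "(\<Sum>c<2 ^ m. N c) \<le> (\<Sum>c<2 ^ m. \<bar>N c\<bar>)" by (rule sum_mono) simp
      also note sqrt_avg[of N]
      also note \<open>sqrt (\<Sum>c<2 ^ m. (N c)\<^sup>2) * sqrt (2 ^ m) \<le> C * sqrt m * sqrt (2 ^ m) * sqrt (2 ^ m)\<close>
      finally show ?thesis by (simp add: mult.assoc)
    qed
    have "(\<theta> / 2 * m - (\<theta> / 2 + K) * sqrt m) * 2 ^ m = (\<theta> / 2 * m) * 2 ^ m - (\<theta> / 2 + K) * (sqrt m * 2 ^ m)"
      by (simp add: algebra_simps)
    also have "\<dots> \<le> (\<theta> / 2 * m) * 2 ^ m - (\<theta> / 2 + K) * (\<Sum>c<2 ^ m. \<bar>D c\<bar>)"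
      using Dsum th K by (intro diff_left_mono mult_left_mono) auto
    also have "\<dots> = (\<Sum>c<(2::nat) ^ m. \<theta> / 2 * m - (\<theta> / 2 + K) * \<bar>D c\<bar>)"
      by (simp add: sum_subtractf sum_distrib_left)
    also have "\<dots> \<le> (\<Sum>c<2 ^ m. N c)" using Nlow by (intro sum_mono) auto
    also note up
    finally show ?thesis by simp
  qed
  show ?thesis
  \<comment> \<open>For \<open>m = 0\<close> both sides vanish; otherwise division by
    \<open>sqrt m\<close> lets \<open>bound\<close> pass to the infimum.\<close>
  proof (cases "m = 0")
    case False
    then have s: "0 < sqrt m" by simp
    have "(\<theta> / 2 * m - (\<theta> / 2 + K) * sqrt m) / sqrt m \<le> tau_haar m T"
      unfolding ideal_norms_eq_Inf
      by (rule cInf_greatest[OF haar_bounds_nonempty(1)[OF T]]) (use bound s in \<open>simp add: pos_divide_le_eq\<close>)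
    then show ?thesis using s by (simp add: pos_divide_le_eq)
  qed simp
qed

section \<open>Passage to the limit\<close>

lemma ladder_of_not_small:
  fixes T :: "'a::real_normed_vector \<Rightarrow> 'b::real_normed_vector"
  assumes T: "bounded_linear T" and not: "\<not> martingale_subtype T \<or> \<not> martingale_subcotype T"
  obtains \<theta> where "0 < \<theta>" "\<And>M. ladder T \<theta> M"
proof -
  obtain K where K: "0 < K" "\<And>x. norm (T x) \<le> K * norm x"
    using bounded_linear.pos_bounded[OF T] by (auto simp: mult.commute)
  \<comment> \<open>As \<open>f\<close> is nonnegative, failure of convergence keeps the quotient
    above some \<open>e\<close> infinitely often; halving \<open>e\<close> makes the inequality
    strict, as the ladder lemmas require.\<close>
  have large: "\<exists>\<epsilon>>0. \<forall>n0. \<exists>n\<ge>n0. 0 < n \<and> \<epsilon> * sqrt n < f n"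
    if f: "\<not> (\<lambda>n. f n / sqrt (real n)) \<longlonglongrightarrow> 0" and f0: "\<And>n. 0 \<le> f n" for f :: "nat \<Rightarrow> real"
  proof -
    obtain e where e: "0 < e" "\<forall>n0. \<exists>n\<ge>n0. e \<le> f n / sqrt n"
      using f f0 unfolding LIMSEQ_iff by (auto simp: not_less)
    have "\<exists>n\<ge>n0. 0 < n \<and> e / 2 * sqrt n < f n" for n0
    proof -
      \<comment> \<open>\<open>Suc n0\<close> forces \<open>n\<close> to be positive, so that
        \<open>sqrt n\<close> is a genuine divisor.\<close>
      obtain n where n: "n \<ge> Suc n0" "e \<le> f n / sqrt n" using e by blast
      then have "e * sqrt n \<le> f n" by (simp add: pos_le_divide_eq)
      moreover have "e / 2 * sqrt n < e * sqrt n" using e n(1) by simp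
      ultimately show ?thesis using n(1) by (intro exI[of _ n]) auto
    qed
    then show ?thesis using e(1) by (intro exI[of _ "e / 2"]) auto
  qed
  have big: "\<exists>n0. \<forall>n\<ge>n0. c \<le> d * real n" if "0 < d" for c d :: real
  proof (intro exI allI impI)
    fix n assume "nat \<lceil>c / d\<rceil> \<le> n"
    then have "c / d \<le> n" by linarith
    then show "c \<le> d * n" using that by (simp add: pos_divide_le_eq mult.commute)
  qed
  from not show thesis
  proof
    assume "\<not> martingale_subtype T"
    then obtain \<epsilon> where e: "0 < \<epsilon>" "\<forall>n0. \<exists>n\<ge>n0. 0 < n \<and> \<epsilon> * sqrt n < tau_mart n T"
      unfolding martingale_subtype_def using large[of "\<lambda>n. tau_mart n T"] ideal_norms_nonneg(1)[OF T] by blast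
    \<comment> \<open>\<open>\<epsilon>\<close> is fixed before \<open>M\<close>: longer ladders
      only ask for larger \<open>n\<close>, not for a smaller constant.\<close>
    have "ladder T (\<epsilon> / 2) M" for M
    proof -
      obtain n0 where n0: "\<forall>n\<ge>n0. 4 * K\<^sup>2 * real M \<le> \<epsilon>\<^sup>2 * real n" using big[of "\<epsilon>\<^sup>2"] e(1) by auto
      obtain n where "n \<ge> n0" "\<epsilon> * sqrt n < tau_mart n T" using e(2) by blast
      then show ?thesis using ladder_of_tau_mart[OF T K e(1)] n0 by blast
    qed
    then show thesis using that[of "\<epsilon> / 2"] e(1) by simp
  next
    assume "\<not> martingale_subcotype T"
    then obtain \<epsilon> where e: "0 < \<epsilon>" "\<forall>n0. \<exists>n\<ge>n0. 0 < n \<and> \<epsilon> * sqrt n < gamma_mart n T"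
      unfolding martingale_subcotype_def using large[of "\<lambda>n. gamma_mart n T"] ideal_norms_nonneg(2)[OF T] by blast
    have "ladder T (\<epsilon> / 4) M" for M
    proof -
      obtain n0 where n0: "\<forall>n\<ge>n0. 16 * K\<^sup>2 * real M \<le> 3 * \<epsilon>\<^sup>2 * real n" using big[of "3 * \<epsilon>\<^sup>2"] e(1) by auto
      obtain n where "n \<ge> n0" "\<epsilon> * sqrt n < gamma_mart n T" using e(2) by blast
      then show ?thesis using ladder_of_gamma_mart[OF T K e(1)] n0 by blast
    qed
    then show thesis using that[of "\<epsilon> / 4"] e(1) by simp
  qed
qed

text \<open>Ladders of length \<open>2 ^ m\<close> keep the quotient of \<open>gamma_haar\<close>
  above \<open>\<theta> / 2\<close>. For \<open>tau_haar\<close> the imbalance of signs leaves an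
  error of order \<open>1 / \<surd>m\<close>, which disappears in the limit.\<close>

lemma not_haar_of_ladder:
  fixes T :: "'a::real_normed_vector \<Rightarrow> 'b::real_normed_vector"
  assumes T: "bounded_linear T" and th: "0 < \<theta>" and lad: "\<And>M. ladder T \<theta> M"
  shows "\<not> haar_subtype T" "\<not> haar_subcotype T"
proof -
  obtain K where K: "0 \<le> K" "\<And>x. norm (T x) \<le> K * norm x"
    using bounded_linear.nonneg_bounded[OF T] by (auto simp: mult.commute)
  show "\<not> haar_subcotype T"
  proof
    assume "haar_subcotype T"
    then have "(\<lambda>m. gamma_haar m T / sqrt m) \<longlonglongrightarrow> 0" unfolding haar_subcotype_def .
    moreover have "\<forall>\<^sub>F m in sequentially. \<theta> / 2 \<le> gamma_haar m T / sqrt m"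
      using eventually_gt_at_top[of 0]
    proof eventually_elim
      case (elim m)
      then show ?case using gamma_haar_ge_of_ladder[OF T less_imp_le[OF th] lad, of m] by (simp add: pos_le_divide_eq)
    qed
    ultimately have "\<theta> / 2 \<le> 0" by (intro tendsto_lowerbound) auto
    then show False using th by simp
  qed
  show "\<not> haar_subtype T"
  proof
    assume "haar_subtype T"
    then have "(\<lambda>m. tau_haar m T / sqrt m) \<longlonglongrightarrow> 0" unfolding haar_subtype_def .
    moreover have "(\<lambda>m. (\<theta> / 2 + K) * inverse (sqrt (real m))) \<longlonglongrightarrow> (\<theta> / 2 + K) * 0"
      by (intro tendsto_mult tendsto_const tendsto_inverse_0_at_top filterlim_compose[OF sqrt_at_top] filterlim_real_sequentially)
    ultimately have "(\<lambda>m. tau_haar m T / sqrt m + (\<theta> / 2 + K) * inverse (sqrt (real m))) \<longlonglongrightarrow> 0 + (\<theta> / 2 + K) * 0"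
      by (rule tendsto_add)
    moreover have "\<forall>\<^sub>F m in sequentially. \<theta> / 2 \<le> tau_haar m T / sqrt m + (\<theta> / 2 + K) * inverse (sqrt (real m))"
      using eventually_gt_at_top[of 0]
    proof eventually_elim
      case (elim m)
      define s where "s = sqrt (real m)"
      have s: "0 < s" "real m = s * s" unfolding s_def using elim by auto
      have "\<theta> / 2 * (s * s) - (\<theta> / 2 + K) * s \<le> tau_haar m T * s"
        using tau_haar_ge_of_ladder[OF T K less_imp_le[OF th] lad, of m] unfolding s_def by simp
      then have "(\<theta> / 2 * s - (\<theta> / 2 + K)) * s \<le> tau_haar m T * s" by (simp add: algebra_simps)
      then have "\<theta> / 2 * s - (\<theta> / 2 + K) \<le> tau_haar m T" using s(1) by simp
      then have "\<theta> / 2 * s \<le> tau_haar m T + (\<theta> / 2 + K)" by simp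
      then have "\<theta> / 2 \<le> (tau_haar m T + (\<theta> / 2 + K)) / s" using s(1) by (simp add: pos_le_divide_eq)
      also have "\<dots> = tau_haar m T / s + (\<theta> / 2 + K) * inverse s" using s(1) by (simp add: field_simps)
      finally show ?case unfolding s_def .
    qed
    ultimately have "\<theta> / 2 \<le> 0 + (\<theta> / 2 + K) * 0" by (rule tendsto_lowerbound) simp
    then show False using th by simp
  qed
qed

lemma haar_small_of_mart_small:
  fixes f g :: "nat \<Rightarrow> real"
  assumes lim: "(\<lambda>n. f n / sqrt (real n)) \<longlonglongrightarrow> 0" and le: "\<And>m. g m \<le> f (Suc m)" and g0: "\<And>m. 0 \<le> g m"
  shows "(\<lambda>n. g n / sqrt (real n)) \<longlonglongrightarrow> 0"
proof (rule tendsto_sandwich)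
  show "\<forall>\<^sub>F n in sequentially. 0 \<le> g n / sqrt (real n)" using g0 by simp
  show "\<forall>\<^sub>F n in sequentially. g n / sqrt (real n) \<le> 2 * (f (Suc n) / sqrt (real (Suc n)))"
    using eventually_gt_at_top[of 0]
  proof eventually_elim
    case (elim n)
    \<comment> \<open>The generous factor 4 has an exact root, so shifting the index costs a factor
      2.\<close>
    have "sqrt (real (Suc n)) \<le> sqrt (4 * real n)" using elim by (intro real_sqrt_le_mono) auto
    then have s: "sqrt (real (Suc n)) \<le> 2 * sqrt (real n)" by (simp add: real_sqrt_mult)
    have f0: "0 \<le> f (Suc n)" using le[of n] g0[of n] by linarith
    have "g n / sqrt (real n) \<le> f (Suc n) / sqrt (real n)" using le by (intro divide_right_mono) auto
    also have "\<dots> = 2 * f (Suc n) / (2 * sqrt (real n))" by simp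
    also have "\<dots> \<le> 2 * f (Suc n) / sqrt (real (Suc n))"
      using s f0 elim by (intro divide_left_mono) auto
    finally show ?case by simp
  qed
  have "(\<lambda>n. 2 * (f (Suc n) / sqrt (real (Suc n)))) \<longlonglongrightarrow> 2 * 0"
    by (intro tendsto_mult tendsto_const LIMSEQ_Suc[OF lim])
  then show "(\<lambda>n. 2 * (f (Suc n) / sqrt (real (Suc n)))) \<longlonglongrightarrow> 0" by simp
qed simp

theorem proposition1:
  fixes T :: "'a::banach \<Rightarrow> 'b::banach"
  assumes "bounded_linear T"
  shows "(martingale_subtype T \<longleftrightarrow> martingale_subcotype T) \<and>
         (martingale_subcotype T \<longleftrightarrow> haar_subtype T) \<and>
         (haar_subtype T \<longleftrightarrow> haar_subcotype T)"
proof -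
  note T = assms
  have "haar_subtype T" if "martingale_subtype T"
    unfolding haar_subtype_def
    by (rule haar_small_of_mart_small[OF that[unfolded martingale_subtype_def]
          haar_norm_le_mart_norm(1)[OF T] ideal_norms_nonneg(3)[OF T]])
  moreover have "haar_subcotype T" if "martingale_subcotype T"
    unfolding haar_subcotype_def
    by (rule haar_small_of_mart_small[OF that[unfolded martingale_subcotype_def]
          haar_norm_le_mart_norm(2)[OF T] ideal_norms_nonneg(4)[OF T]])
  \<comment> \<open>Either martingale failure destroys both Haar properties; this crossing ties type
    to cotype, and the rest is propositional.\<close>
  moreover have "\<not> haar_subtype T \<and> \<not> haar_subcotype T" if "\<not> martingale_subtype T \<or> \<not> martingale_subcotype T"
    using ladder_of_not_small[OF T that] not_haar_of_ladder[OF T] by metis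
  ultimately show ?thesis by blast
qed

end
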